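(* Let $f:[-1,1]\to\mathbb{R}$ be a $C^1$ function on $[-1,1]$ with $0\le f(x)\le 1$ for all $x\in[-1,1]$. Then $$J\left(\int_{-1}^1 f\,d\sigma\right)-\int_{-1}^1 J(f(x))\,d\sigma(x)\;\le\;\int_{-1}^1\int_{-1}^1\left|\frac{f(x)-f(y)}{x-y}\right|\,d\sigma(x)\,d\sigma(y).$$
   Context: $\sigma$ is the semicircle law, i.e. the probability measure on $[-1,1]$ given by $\sigma(dx)=\frac{2}{\pi}1_{[-1,1]}(x)\sqrt{1-x^2}\,dx$. The inverse quantile map $\alpha:[0,1]\to[-1,1]$ is determined by $\int_{-1}^{\alpha(u)}d\sigma(t)=u$ for $u\in[0,1]$ (so $\alpha$ is the inverse of the strictly increasing distribution function $x\mapsto\sigma([-1,x])$). The free profile map $J:[0,1]\to\mathbb{R}$ is $J(u)=\frac{8}{3\pi}\left(1-\alpha(u)^2\right)^{3/2}$. The diagonal $\{x=y\}$ is $\sigma\otimes\sigma$-null, so the value of the integrand there is irrelevant. *)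

theory Defs
  imports "HOL-Analysis.Analysis"
begin

definition semicircle :: "real measure" where
  "semicircle = density lborel
     (\<lambda>x. ennreal (2 / pi * indicator {-1..1} x * sqrt (1 - x\<^sup>2)))"

(* On [0,1], semicircle_quantile u is the unique a in [-1,1] with
   semicircle-mass u on [-1,a]; arguments outside [0,1] are not meaningful. *)
definition semicircle_quantile :: "real \<Rightarrow> real" where
  "semicircle_quantile = inv_into {-1..1} (\<lambda>x. measure semicircle {-1..x})"

definition free_profile :: "real \<Rightarrow> real" where
  "free_profile u = 8 / (3 * pi) * (1 - (semicircle_quantile u)\<^sup>2) powr (3 / 2)"

end

theory Submission
  imports Defs
begin

text \<open>For \<open>A \<subseteq> [-1, 1]\<close> let \<open>P(A)\<close> be the double integral for the indicator of \<open>A\<close>. Half-lines \<open>[-1, a]\<close> satisfy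
  \<open>P = J(\<sigma>([-1, a]))\<close>, and they minimise \<open>P\<close> at given mass: among the boundary points of a finite union of
  intervals, take the first and the third and move them towards each other with unit speed in quantile
  coordinates. This keeps the mass, and \<open>P\<close> is concave along the motion because the density is
  concave, so one of the two directions lowers \<open>P\<close> until boundary points collide. A single interval is
  slid to the edge instead.

  For a step function on cells of mass \<open>1/n\<close>, the layer-cake formula and the isoperimetric inequality
  bound the double integral below by \<open>\<integral> J(\<sigma>(f > t)) dt\<close>. It remains to see that
  \<open>J(\<integral> m) \<le> \<integral> J(m) + \<integral> J(m\<^sup>-\<^sup>1)\<close> for decreasing step functions \<open>m\<close> on \<open>[0, 1]\<close>; the right side minus
  the left is concave in every breakpoint, since \<open>-1/J''\<close> is concave, so breakpoints may again be merged.
  A \<open>C\<^sup>1\<close> function is approximated by step functions; the error is the total perimeter of the cells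
  weighted by their lengths.\<close>

section \<open>Closed forms of the interaction energies\<close>

text \<open>The perimeter is a quadratic form in the indicator function, so for a union of intervals
  it is a signed sum of interactions of half-lines. These have elementary closed forms, and the
  isoperimetric argument is calculus with them, free of improper integrals. The double integral
  enters only in the limit, where a lower bound over pairs of distinct cells suffices and the
  singular diagonal cells are discarded.

  The first and third boundary points enter the indicator with the same sign, so opposite mass
  increments cancel, and the points beyond them enter only through an alternating sum, which is
  controlled by its first term. Along the motion the interaction of the two moving points a and b
  contributes the convex term 2 / (b - a). The competing terms are integrals of the density between
  a, the middle point c and b against inverse squares of distances. Replacing the density by its
  chord, which concavity allows, reduces the comparison to an elementary logarithmic inequality.

  Mass is the coordinate throughout. In it J' = -4 \<open>quantile\<close> and J'' = -4 /
  \<open>sc_dens\<close> at the quantile; the constant 8 / (3 pi) in J is the one that makes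
  half-lines extremal with equality.\<close>

text \<open>With \<open>\<sigma>(dy) = sc_dens y dy\<close>, for \<open>a < b\<close>: \<open>cauchy a b\<close> is \<open>\<integral>\<^bsub>[b,1]\<^esub> \<sigma>(dy) / (y - a)\<close>, \<open>dcauchy\<close> is its derivative in \<open>a\<close>,
  \<open>mutual a b\<close> is the integral of \<open>1 / (y - x)\<close> over \<open>[-1, a] \<times> [b, 1]\<close>, and \<open>edge_perim a = 2 mutual a a\<close> is
  the perimeter of \<open>[-1, a]\<close>. At \<open>a = b\<close> the junk value of \<open>log_ratio\<close> is multiplied by 0 in \<open>mutual\<close>.\<close>

definition chord :: "real \<Rightarrow> real" where
  "chord x = sqrt (1 - x\<^sup>2)"

definition sc_dens :: "real \<Rightarrow> real" where
  "sc_dens x = 2 / pi * chord x"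

text \<open>For -1 < a < b <= 1 this is \<open>chord a\<close> times the integral of 1 /
  (\<open>chord y\<close> * (y - a)) over y in [b, 1].\<close>

definition log_ratio :: "real \<Rightarrow> real \<Rightarrow> real" where
  "log_ratio a b = ln ((1 - a * b + chord a * chord b) / (b - a))"

definition cauchy :: "real \<Rightarrow> real \<Rightarrow> real" where
  "cauchy a b = 2 / pi * (- chord b - a * (pi / 2 - arcsin b) + chord a * log_ratio a b)"

definition dcauchy :: "real \<Rightarrow> real \<Rightarrow> real" where
  "dcauchy a b = 2 / pi * (- (pi / 2 - arcsin b) - a / chord a * log_ratio a b + chord b / (b - a))"

definition mutual :: "real \<Rightarrow> real \<Rightarrow> real" where
  "mutual a b = 4 / pi\<^sup>2 * (((pi / 2 - arcsin b) * chord a ^ 3 + (pi / 2 + arcsin a) * chord b ^ 3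
       + chord a * chord b * (b - a)) / 3 - ((b - b ^ 3 / 3) - (a - a ^ 3 / 3)) * log_ratio a b)"

definition edge_perim :: "real \<Rightarrow> real" where
  "edge_perim x = 8 / (3 * pi) * chord x ^ 3"

definition sc_cdf :: "real \<Rightarrow> real" where
  "sc_cdf x = (x * chord x + arcsin x) / pi + 1 / 2"

lemma chord_pos: "-1 < x \<Longrightarrow> x < 1 \<Longrightarrow> 0 < chord x"
  unfolding chord_def using abs_square_less_1[of x] by simp

lemma chord_nonneg: "-1 \<le> x \<Longrightarrow> x \<le> 1 \<Longrightarrow> 0 \<le> chord x"
  unfolding chord_def using abs_square_le_1[of x] by simp

lemma chord_sq: "-1 \<le> x \<Longrightarrow> x \<le> 1 \<Longrightarrow> chord x * chord x = 1 - x * x"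
  unfolding chord_def using abs_square_le_1[of x] by (simp add: power2_eq_square)

lemma chord_minus [simp]: "chord (- x) = chord x"
  by (simp add: chord_def)

lemma chord_ends [simp]: "chord 1 = 0" "chord (-1) = 0"
  by (simp_all add: chord_def)

lemma sc_dens_minus [simp]: "sc_dens (- x) = sc_dens x"
  by (simp add: sc_dens_def)

lemma sc_dens_pos: "-1 < x \<Longrightarrow> x < 1 \<Longrightarrow> 0 < sc_dens x"
  unfolding sc_dens_def by (simp add: chord_pos)

lemma sc_dens_nonneg: "-1 \<le> x \<Longrightarrow> x \<le> 1 \<Longrightarrow> 0 \<le> sc_dens x"
  unfolding sc_dens_def by (simp add: chord_nonneg)

lemma log_ratio_reflect: "log_ratio (- b) (- a) = log_ratio a b"
  by (simp add: log_ratio_def mult.commute)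

lemma edge_perim_ends [simp]: "edge_perim 1 = 0" "edge_perim (-1) = 0"
  by (simp_all add: edge_perim_def)

lemma mutual_diag: "mutual a a = edge_perim a / 2"
  by (simp add: mutual_def edge_perim_def power2_eq_square field_simps)

lemma log_ratio_right: "a < 1 \<Longrightarrow> log_ratio a 1 = 0"
  by (simp add: log_ratio_def add.commute)

lemma mutual_left [simp]: "mutual (-1) b = 0"
  by (cases "b = -1") (auto simp: mutual_def log_ratio_def add.commute)

lemma mutual_right [simp]: "mutual a 1 = 0"
  by (cases "a = 1") (auto simp: mutual_def log_ratio_def add.commute)

lemma cauchy_right: "a < 1 \<Longrightarrow> cauchy a 1 = 0"
  by (simp add: cauchy_def log_ratio_right)

lemma sc_cdf_ends [simp]: "sc_cdf (-1) = 0" "sc_cdf 1 = 1"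
  by (simp_all add: sc_cdf_def)

section \<open>Derivatives of the closed forms\<close>

lemma chord_deriv:
  assumes "(f has_real_derivative f') (at t within S)" "-1 < f t" "f t < 1"
  shows "((\<lambda>t. chord (f t)) has_real_derivative - f t / chord (f t) * f') (at t within S)"
proof -
  have "1 - (f t)\<^sup>2 > 0" using assms abs_square_less_1[of "f t"] by simp
  then show ?thesis unfolding chord_def
    by (auto intro!: derivative_eq_intros assms simp: field_simps)
qed

lemma arcsin_deriv:
  assumes "(f has_real_derivative f') (at t within S)" "-1 < f t" "f t < 1"
  shows "((\<lambda>t. arcsin (f t)) has_real_derivative f' / chord (f t)) (at t within S)"
  using DERIV_chain2[OF DERIV_arcsin[OF assms(2,3)] assms(1)]
  by (simp add: chord_def field_simps)

lemma num_pos: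
  fixes a b :: real
  assumes "-1 < a" "a < 1" "-1 \<le> b" "b \<le> 1"
  shows "0 < 1 - a * b"
proof -
  have "a * b \<le> \<bar>a\<bar> * \<bar>b\<bar>" by (metis abs_ge_self abs_mult)
  also have "\<dots> \<le> \<bar>a\<bar> * 1" using assms by (intro mult_left_mono) auto
  also have "\<dots> < 1" using assms by auto
  finally show ?thesis by simp
qed

text \<open>The reciprocals of \<open>chord a\<close>, \<open>chord b\<close>, b - a and of the
  numerator of \<open>log_ratio\<close> become free variables \<open>i\<close>, \<open>j\<close>,
  \<open>k\<close>, \<open>M\<close> tied down by their defining equations; \<open>f\<close> and
  \<open>g\<close> stand for the derivatives of a and b. What remains is polynomial: differences of
  two sides are written as explicit combinations of these equations. The next two lemmas follow the
  same pattern.\<close>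

lemma log_ratio_deriv_algebra:
  fixes a b s r i j k M f g :: real
  assumes "s * s = 1 - a * a" "r * r = 1 - b * b" "s * i = 1" "r * j = 1" "(b - a) * k = 1"
    "(1 - a * b + s * r) * M = 1"
  shows "((- (f * b + a * g) + ((- a * i * f) * r + s * (- b * j * g))) * (b - a) - (1 - a * b + s * r) * (g - f))
        * (k * k) * (M * (b - a)) = r * (i * k) * f - s * (j * k) * g"
proof -
  have "(- b - a * i * r) * (b - a) + (1 - a * b + s * r) - r * i * (1 - a * b + s * r)
      = - (r * r - (1 - b * b)) + r * i * (s * s - (1 - a * a)) - (r * r + r * s) * (s * i - 1)"
    by (simp add: algebra_simps)
  then have 1: "(- b - a * i * r) * (b - a) + (1 - a * b + s * r) = r * i * (1 - a * b + s * r)"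
    by (simp add: assms(1-3))
  have "(- a - b * j * s) * (b - a) - (1 - a * b + s * r) + s * j * (1 - a * b + s * r)
      = (s * s - (1 - a * a)) - s * j * (r * r - (1 - b * b)) + (s * r + s * s) * (r * j - 1)"
    by (simp add: algebra_simps)
  then have 2: "(- a - b * j * s) * (b - a) - (1 - a * b + s * r) = - s * j * (1 - a * b + s * r)"
    using assms(1,2,4) by simp
  have "(- (f * b + a * g) + ((- a * i * f) * r + s * (- b * j * g))) * (b - a) - (1 - a * b + s * r) * (g - f)
     = f * ((- b - a * i * r) * (b - a) + (1 - a * b + s * r)) + g * ((- a - b * j * s) * (b - a) - (1 - a * b + s * r))"
    by (simp add: algebra_simps)
  also have "\<dots> = (1 - a * b + s * r) * (f * (r * i) - g * (s * j))"
    unfolding 1 2 by (simp add: algebra_simps)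
  finally have "((- (f * b + a * g) + ((- a * i * f) * r + s * (- b * j * g))) * (b - a) - (1 - a * b + s * r) * (g - f))
        * (k * k) * (M * (b - a)) = ((1 - a * b + s * r) * M) * ((b - a) * k) * (k * (f * (r * i) - g * (s * j)))"
    by (simp only: mult_ac)
  then show ?thesis unfolding assms(5,6) by (simp add: algebra_simps)
qed

lemma cauchy_deriv_algebra:
  fixes a b s r i j k A l f g :: real
  assumes "s * s = 1 - a * a" "r * r = 1 - b * b" "s * i = 1" "r * j = 1" "(b - a) * k = 1"
  shows "- (- b * j * g) - (f * A + a * (- (g * j))) + ((- a * i * f) * l + s * (r * (i * k) * f - s * (j * k) * g))
   = (- A - a * i * l + r * k) * f - r * k * g" (is "?L = ?R")
proof -
  have "?L - ?R = f * (r * k) * (s * i - 1) + g * (- ((b + a) * j) * ((b - a) * k - 1) + j * k * ((r * r - (1 - b * b)) - (s * s - (1 - a * a))) - r * k * (r * j - 1))"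
    by (simp add: algebra_simps)
  then show ?thesis by (simp add: assms)
qed

text \<open>\<open>A\<close> and \<open>B\<close> stand for pi / 2 - arcsin b and pi / 2 + arcsin a,
  and \<open>l\<close> for \<open>log_ratio a b\<close>. Up to the factor 2 / pi, the brackets on
  the right are the closed forms of \<open>cauchy a b\<close> and \<open>cauchy (- b) (- a)\<close>;
  the overall factor 3 clears denominators.\<close>

lemma mutual_deriv_algebra:
  fixes a b s r i j k A B l f g :: real
  assumes "s * s = 1 - a * a" "r * r = 1 - b * b" "s * i = 1" "r * j = 1" "(b - a) * k = 1"
  shows "((- (g * j)) * (s * s * s) + A * (3 * (s * s) * (- a * i * f))
     + (f * i) * (r * r * r) + B * (3 * (r * r) * (- b * j * g))
     + ((- a * i * f) * r + s * (- b * j * g)) * (b - a) + s * r * (g - f))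
     - 3 * (((1 - b * b) * g - (1 - a * a) * f) * l) - ((3 * b - b * b * b) - (3 * a - a * a * a)) *
          (r * (i * k) * f - s * (j * k) * g)
   = 3 * (s * (- r - a * A + s * l) * f - r * (- s + b * B + r * l) * g)" (is "?L = ?R")
proof -
  have Q: "(3 * b - b * b * b) - (3 * a - a * a * a) = (3 - (a * a + a * b + b * b)) * (b - a)"
    by (simp add: algebra_simps)
  have "?L - ?R = f * (- (3 * A * a * s) * (s * i - 1) + r * i * (r * r - (1 - b * b)) + 2 * (r * i) * (s * s - (1 - a * a)) - 2 * (r * s) * (s * i - 1) - 3 * l * (s * s - (1 - a * a)))
     + g * (- (3 * B * b * r) * (r * j - 1) - s * j * (s * s - (1 - a * a)) - 2 * (s * j) * (r * r - (1 - b * b)) + 2 * (s * r) * (r * j - 1) + 3 * l * (r * r - (1 - b * b)))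
     - (3 - (a * a + a * b + b * b)) * (r * i * f - s * j * g) * ((b - a) * k - 1)"
    unfolding Q by (simp add: algebra_simps)
  then show ?thesis by (simp add: assms)
qed

lemma log_ratio_deriv:
  assumes a: "(f has_real_derivative f') (at t within S)" "-1 < f t" "f t < 1"
    and b: "(g has_real_derivative g') (at t within S)" "-1 < g t" "g t < 1"
    and ab: "f t < g t"
  shows "((\<lambda>t. log_ratio (f t) (g t)) has_real_derivative
     chord (g t) / (chord (f t) * (g t - f t)) * f' - chord (f t) / (chord (g t) * (g t - f t)) * g') (at t within S)"
proof -
  let ?a = "f t" and ?b = "g t"
  let ?s = "chord ?a" and ?r = "chord ?b"
  have p: "?s > 0" "?r > 0" using a b chord_pos by auto
  have sq: "?s * ?s = 1 - ?a * ?a" "?r * ?r = 1 - ?b * ?b" using a b by (auto intro!: chord_sq)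
  have n: "0 < 1 - ?a * ?b" using num_pos a b by auto
  then have N: "0 < 1 - ?a * ?b + ?s * ?r" using p by (simp add: add_pos_pos)
  let ?N = "1 - ?a * ?b + ?s * ?r"
  have dN: "((\<lambda>t. 1 - f t * g t + chord (f t) * chord (g t)) has_real_derivative
      (- (f' * ?b + ?a * g') + ((- ?a / ?s * f') * ?r + ?s * (- ?b / ?r * g')))) (at t within S)"
    by (rule derivative_eq_intros chord_deriv a b refl)+ (simp add: algebra_simps)
  have dh: "((\<lambda>t. g t - f t) has_real_derivative (g' - f')) (at t within S)"
    by (rule derivative_intros a b)+
  have "((\<lambda>t. log_ratio (f t) (g t)) has_real_derivative
      ((- (f' * ?b + ?a * g') + ((- ?a / ?s * f') * ?r + ?s * (- ?b / ?r * g'))) * (?b - ?a) - ?N * (g' - f'))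
        / ((?b - ?a) * (?b - ?a)) / (?N / (?b - ?a))) (at t within S)"
    unfolding log_ratio_def
    using DERIV_chain2[OF DERIV_ln_divide DERIV_divide[OF dN dh]] N ab by (simp add: mult.commute)
  moreover have "((- (f' * ?b + ?a * g') + ((- ?a / ?s * f') * ?r + ?s * (- ?b / ?r * g'))) * (?b - ?a) - ?N * (g' - f'))
        / ((?b - ?a) * (?b - ?a)) / (?N / (?b - ?a)) =
     ?r / (?s * (?b - ?a)) * f' - ?s / (?r * (?b - ?a)) * g'"
    using log_ratio_deriv_algebra[OF sq, of "inverse ?s" "inverse ?r" "inverse (?b - ?a)" "inverse ?N" f' g'] p N ab
    by (simp add: divide_inverse)
  ultimately show ?thesis by simp
qed

lemma cauchy_deriv:
  assumes a: "(f has_real_derivative f') (at t within S)" "-1 < f t" "f t < 1"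
    and b: "(g has_real_derivative g') (at t within S)" "-1 < g t" "g t < 1"
    and ab: "f t < g t"
  shows "((\<lambda>t. cauchy (f t) (g t)) has_real_derivative
     dcauchy (f t) (g t) * f' - sc_dens (g t) / (g t - f t) * g') (at t within S)"
proof -
  let ?a = "f t" and ?b = "g t"
  let ?s = "chord ?a" and ?r = "chord ?b" and ?l = "log_ratio (f t) (g t)"
  have p: "?s > 0" "?r > 0" using a b chord_pos by auto
  have sq: "?s * ?s = 1 - ?a * ?a" "?r * ?r = 1 - ?b * ?b" using a b by (auto intro!: chord_sq)
  have h: "?b - ?a > 0" using ab by simp
  define Y where "Y = - (- ?b / ?r * g') - (f' * (pi / 2 - arcsin ?b) + ?a * (- (g' / ?r)))
        + ((- ?a / ?s * f') * ?l + ?s * (?r / (?s * (?b - ?a)) * f' - ?s / (?r * (?b - ?a)) * g'))"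
  have dA: "((\<lambda>t. - chord (g t) - f t * (pi / 2 - arcsin (g t))) has_real_derivative
      - (- ?b / ?r * g') - (f' * (pi / 2 - arcsin ?b) + ?a * (- (g' / ?r)))) (at t within S)"
    by (rule derivative_eq_intros chord_deriv[OF b] arcsin_deriv[OF b] a b refl)+ (simp add: algebra_simps)
  have "((\<lambda>t. cauchy (f t) (g t)) has_real_derivative 2 / pi * Y) (at t within S)"
    unfolding cauchy_def Y_def
    by (rule DERIV_cmult[OF DERIV_add[OF dA DERIV_cong[OF DERIV_mult[OF chord_deriv[OF a] log_ratio_deriv[OF a b ab]]]]])
      (simp add: mult.commute)
  moreover have "Y = (- (pi / 2 - arcsin ?b) - ?a / ?s * ?l + ?r / (?b - ?a)) * f' - ?r / (?b - ?a) * g'"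
    using cauchy_deriv_algebra[OF sq, of "inverse ?s" "inverse ?r" "inverse (?b - ?a)" g' f' "pi / 2 - arcsin ?b" ?l] p h
    unfolding Y_def divide_inverse inverse_mult_distrib by simp
  moreover have "2 / pi * Y = (2 / pi * C) * f' - (2 / pi * r) / h * g'" if "Y = C * f' - r / h * g'" for C r h :: real
    unfolding that by (simp add: algebra_simps)
  ultimately show ?thesis unfolding dcauchy_def sc_dens_def by (metis (no_types, lifting))
qed

text \<open>Moving a adds mass at rate \<open>sc_dens a\<close> that interacts with [b, 1], whence
  \<open>cauchy a b\<close>. Moving b removes mass that interacts with [-1, a]; after the reflection
  x -> -x the integral of 1 / (b - x) over [-1, a] is \<open>cauchy (- b) (- a)\<close>.\<close>

lemma mutual_deriv:
  assumes a: "(f has_real_derivative f') (at t within S)" "-1 < f t" "f t < 1"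
    and b: "(g has_real_derivative g') (at t within S)" "-1 < g t" "g t < 1"
    and ab: "f t < g t"
  shows "((\<lambda>t. mutual (f t) (g t)) has_real_derivative
     sc_dens (f t) * cauchy (f t) (g t) * f' - sc_dens (g t) * cauchy (- g t) (- f t) * g') (at t within S)"
proof -
  let ?a = "f t" and ?b = "g t"
  let ?s = "chord ?a" and ?r = "chord ?b" and ?l = "log_ratio (f t) (g t)"
  have p: "?s > 0" "?r > 0" using a b chord_pos by auto
  have sq: "?s * ?s = 1 - ?a * ?a" "?r * ?r = 1 - ?b * ?b" using a b by (auto intro!: chord_sq)
  have h: "?b - ?a > 0" using ab by simp
  let ?Q = "?b - ?b ^ 3 / 3 - (?a - ?a ^ 3 / 3)"
  let ?D = "(- (g' / ?r)) * ?s ^ 3 + (pi / 2 - arcsin ?b) * (3 * ?s\<^sup>2 * (- ?a / ?s * f'))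
     + (f' / ?s) * ?r ^ 3 + (pi / 2 + arcsin ?a) * (3 * ?r\<^sup>2 * (- ?b / ?r * g'))
     + ((- ?a / ?s * f') * ?r + ?s * (- ?b / ?r * g')) * (?b - ?a) + ?s * ?r * (g' - f')"
  let ?q = "(1 - ?b\<^sup>2) * g' - (1 - ?a\<^sup>2) * f'"
  have dD: "((\<lambda>t. (pi / 2 - arcsin (g t)) * chord (f t) ^ 3 + (pi / 2 + arcsin (f t)) * chord (g t) ^ 3
       + chord (f t) * chord (g t) * (g t - f t)) has_real_derivative ?D) (at t within S)"
    by (rule derivative_eq_intros chord_deriv[OF a] chord_deriv[OF b] arcsin_deriv[OF a] arcsin_deriv[OF b] a b refl)+
      (simp add: algebra_simps)
  have dQ: "((\<lambda>t. g t - g t ^ 3 / 3 - (f t - f t ^ 3 / 3)) has_real_derivative ?q) (at t within S)"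
    by (rule derivative_eq_intros a b refl | simp add: algebra_simps)+
  define X where "X = ?r / (?s * (?b - ?a)) * f' - ?s / (?r * (?b - ?a)) * g'"
  define Q3 where "Q3 = 3 * ?b - ?b * ?b * ?b - (3 * ?a - ?a * ?a * ?a)"
  define D where "D = ?D"
  define q where "q = ?q"
  have d: "((\<lambda>t. mutual (f t) (g t)) has_real_derivative 4 / pi\<^sup>2 * (D / 3 - (q * ?l + X * ?Q))) (at t within S)"
    unfolding mutual_def D_def q_def X_def
    by (rule DERIV_cmult[OF DERIV_diff[OF DERIV_cdivide[OF dD] DERIV_mult[OF dQ log_ratio_deriv[OF a b ab]]]])
  have Q: "?Q = Q3 / 3" by (simp add: Q3_def power3_eq_cube field_simps)
  have "D - 3 * (q * ?l) - Q3 * X = 3 * (?s * (- ?r - ?a * (pi / 2 - arcsin ?b) + ?s * ?l) * f'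
        - ?r * (- ?s + ?b * (pi / 2 + arcsin ?a) + ?r * ?l) * g')"
    using mutual_deriv_algebra[OF sq, of "inverse ?s" "inverse ?r" "inverse (?b - ?a)" g' "pi / 2 - arcsin ?b" f'
        "pi / 2 + arcsin ?a" ?l] p h
    unfolding D_def q_def X_def Q3_def power2_eq_square power3_eq_cube divide_inverse inverse_mult_distrib
    by (simp only: right_inverse less_imp_neq[symmetric] mult_minus_left) (simp add: mult.assoc)
  then have *: "D / 3 - (q * ?l + X * ?Q) = ?s * (- ?r - ?a * (pi / 2 - arcsin ?b) + ?s * ?l) * f'
        - ?r * (- ?s + ?b * (pi / 2 + arcsin ?a) + ?r * ?l) * g'"
    unfolding Q by (simp add: field_simps)
  have cb: "cauchy (- ?b) (- ?a) = 2 / pi * (- ?s + ?b * (pi / 2 + arcsin ?a) + ?r * ?l)"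
    using a by (simp add: cauchy_def log_ratio_reflect arcsin_minus)
  have gen: "s * A * x - r * B * y = pi\<^sup>2 / 4 * (2 / pi * s * (2 / pi * A) * x - 2 / pi * r * (2 / pi * B) * y)"
    for s r A B x y :: real
    by (simp add: power2_eq_square field_simps)
  have e: "?s * (- ?r - ?a * (pi / 2 - arcsin ?b) + ?s * ?l) * f'
        - ?r * (- ?s + ?b * (pi / 2 + arcsin ?a) + ?r * ?l) * g' =
     pi\<^sup>2 / 4 * (sc_dens ?a * cauchy ?a ?b * f' - sc_dens ?b * cauchy (- ?b) (- ?a) * g')"
    unfolding cauchy_def[of ?a ?b] sc_dens_def cb by (rule gen)
  show ?thesis using d unfolding * e by (simp add: diff_divide_distrib)
qed

lemma chord_cont: "continuous_on S chord"
  unfolding chord_def by (intro continuous_intros)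

lemma sc_dens_cont: "continuous_on S sc_dens"
  unfolding sc_dens_def by (intro continuous_intros chord_cont)

lemma sc_cdf_cont: "continuous_on {-1..1} sc_cdf"
  unfolding sc_cdf_def by (intro continuous_intros chord_cont) auto

lemma edge_perim_cont: "continuous_on S edge_perim"
  unfolding edge_perim_def by (intro continuous_intros chord_cont)

lemma sc_cdf_deriv:
  assumes a: "(f has_real_derivative f') (at t within S)" "-1 < f t" "f t < 1"
  shows "((\<lambda>t. sc_cdf (f t)) has_real_derivative sc_dens (f t) * f') (at t within S)"
proof -
  let ?s = "chord (f t)"
  have p: "?s > 0" and sq: "?s * ?s = 1 - f t * f t" using a chord_pos chord_sq by auto
  have "((\<lambda>t. f t * chord (f t) + arcsin (f t)) has_real_derivative
     f' * ?s + f t * (- f t / ?s * f') + f' / ?s) (at t within S)"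
    by (rule DERIV_cong[OF DERIV_add[OF DERIV_mult[OF a(1) chord_deriv[OF a]] arcsin_deriv[OF a]]]) simp
  from DERIV_add[OF DERIV_cdivide[OF this, of pi] DERIV_const[of "1 / 2"]]
  have "((\<lambda>t. sc_cdf (f t)) has_real_derivative
     (f' * ?s + f t * (- f t / ?s * f') + f' / ?s) / pi) (at t within S)"
    unfolding sc_cdf_def by simp
  moreover have "f' * ?s + f t * (- f t / ?s * f') + f' / ?s = f' * (?s + (1 - f t * f t) / ?s)"
    using p by (simp add: field_simps)
  moreover have "\<dots> = f' * (2 * ?s)" unfolding sq[symmetric] using p by simp
  moreover have "f' * (2 * ?s) / pi = sc_dens (f t) * f'" by (simp add: sc_dens_def)
  ultimately show ?thesis by (simp only:)
qed

text \<open>Divided by the rate of change of mass, \<open>sc_dens\<close>, the slope is -4 times the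
  position. This is J' = -4 \<open>quantile\<close>, the form in which J enters the concavity
  arguments.\<close>

lemma edge_perim_deriv:
  assumes a: "(f has_real_derivative f') (at t within S)" "-1 < f t" "f t < 1"
  shows "((\<lambda>t. edge_perim (f t)) has_real_derivative - 4 * f t * sc_dens (f t) * f') (at t within S)"
proof -
  have p: "chord (f t) > 0" using a chord_pos by auto
  show ?thesis unfolding edge_perim_def
    by (rule derivative_eq_intros chord_deriv a refl)+
      (use p in \<open>simp add: sc_dens_def power2_eq_square field_simps\<close>)
qed

section \<open>Distribution function and quantile map of the semicircle law\<close>

lemma sc_cdf_strict_mono:
  assumes "-1 \<le> x" "x < y" "y \<le> 1"
  shows "sc_cdf x < sc_cdf y"
proof (rule DERIV_pos_imp_increasing_open[OF assms(2)])
  fix t assume t: "x < t" "t < y"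
  then have "(sc_cdf has_real_derivative sc_dens t * 1) (at t)" "sc_dens t > 0"
    using assms sc_cdf_deriv[of "\<lambda>t. t" 1 t UNIV] sc_dens_pos[of t] by auto
  then show "\<exists>d. (sc_cdf has_real_derivative d) (at t) \<and> 0 < d" by auto
next
  show "continuous_on {x..y} sc_cdf" by (rule continuous_on_subset[OF sc_cdf_cont]) (use assms in auto)
qed

lemma sc_cdf_mono: "-1 \<le> x \<Longrightarrow> x \<le> y \<Longrightarrow> y \<le> 1 \<Longrightarrow> sc_cdf x \<le> sc_cdf y"
  using sc_cdf_strict_mono[of x y] by (cases "x = y") auto

lemma sc_cdf_range: "-1 \<le> x \<Longrightarrow> x \<le> 1 \<Longrightarrow> 0 \<le> sc_cdf x \<and> sc_cdf x \<le> 1"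
  using sc_cdf_mono[of "-1" x] sc_cdf_mono[of x 1] by auto

lemma sc_cdf_less_iff: "-1 \<le> x \<Longrightarrow> x \<le> 1 \<Longrightarrow> -1 \<le> y \<Longrightarrow> y \<le> 1 \<Longrightarrow> sc_cdf x < sc_cdf y \<longleftrightarrow> x < y"
  using sc_cdf_strict_mono[of x y] sc_cdf_mono[of y x] by (cases "x < y") auto

lemma sc_cdf_minus: "sc_cdf (- x) = 1 - sc_cdf x" if "-1 \<le> x" "x \<le> 1"
  using that by (simp add: sc_cdf_def arcsin_minus field_simps)

lemma sc_dens_has_integral:
  assumes "-1 \<le> x" "x \<le> y" "y \<le> 1"
  shows "(sc_dens has_integral (sc_cdf y - sc_cdf x)) {x..y}"
proof (rule fundamental_theorem_of_calculus_interior)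
  show "continuous_on {x..y} sc_cdf" by (rule continuous_on_subset[OF sc_cdf_cont]) (use assms in auto)
  fix t assume "t \<in> {x<..<y}"
  then show "(sc_cdf has_vector_derivative sc_dens t) (at t)"
    using assms sc_cdf_deriv[of "\<lambda>t. t" 1 t UNIV]
    by (auto simp: has_real_derivative_iff_has_vector_derivative)
qed (use assms in auto)

lemma semicircle_sc_dens: "semicircle = density lborel (\<lambda>x. ennreal (indicator {-1..1} x * sc_dens x))"
  unfolding semicircle_def sc_dens_def chord_def by (simp add: mult_ac)

lemma sc_dens_measurable [measurable]: "sc_dens \<in> borel_measurable borel"
  by (rule borel_measurable_continuous_onI[OF sc_dens_cont])

lemma measure_semicircle_Icc:
  assumes "-1 \<le> x" "x \<le> y" "y \<le> 1"
  shows "emeasure semicircle {x..y} = ennreal (sc_cdf y - sc_cdf x)"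
proof -
  have *: "emeasure semicircle {x..y} = (\<integral>\<^sup>+ t. ennreal (indicator {x..y} t * sc_dens t) \<partial>lborel)"
    unfolding semicircle_sc_dens
    by (subst emeasure_density) (use assms in \<open>auto intro!: nn_integral_cong simp: indicator_def\<close>)
  have eq: "(\<lambda>t. if t \<in> {x..y} then sc_dens t else 0) = (\<lambda>t. indicator {x..y} t * sc_dens t)"
    by (auto simp: indicator_def)
  have "(\<integral>\<^sup>+ t. ennreal (indicator {x..y} t * sc_dens t) \<partial>lborel) = ennreal (sc_cdf y - sc_cdf x)"
  proof (rule nn_integral_has_integral_lborel)
    show "\<And>t. 0 \<le> indicator {x..y} t * sc_dens t"
      using assms by (auto simp: indicator_def intro!: sc_dens_nonneg)
    show "((\<lambda>t. indicator {x..y} t * sc_dens t) has_integral (sc_cdf y - sc_cdf x)) UNIV"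
      using sc_dens_has_integral[OF assms] has_integral_restrict_UNIV[of "{x..y}" sc_dens "sc_cdf y - sc_cdf x", unfolded eq]
      by simp
  qed auto
  with * show ?thesis by simp
qed

lemma measure_semicircle_sc_cdf: "measure semicircle {-1..x} = sc_cdf x" if "-1 \<le> x" "x \<le> 1"
  using measure_semicircle_Icc[of "-1" x] that sc_cdf_range[of x] by (simp add: measure_def)

lemma sc_cdf_surj:
  assumes "0 \<le> u" "u \<le> 1"
  shows "\<exists>x\<in>{-1..1}. sc_cdf x = u"
  using IVT'[of sc_cdf "-1" u 1] sc_cdf_cont assms by auto

text \<open>The two distribution functions are compared only on [-1, 1], and \<open>inv_into\<close>
  looks no further; hence the comparison under \<open>Eps\<close>.\<close>

lemma quantile_eq: "semicircle_quantile u = inv_into {-1..1} sc_cdf u"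
  unfolding semicircle_quantile_def inv_into_def
  by (rule arg_cong[of _ _ Eps]) (auto simp: fun_eq_iff measure_semicircle_sc_cdf)

abbreviation quantile where "quantile \<equiv> semicircle_quantile"

lemma quantile_range: "0 \<le> u \<Longrightarrow> u \<le> 1 \<Longrightarrow> -1 \<le> quantile u \<and> quantile u \<le> 1"
  unfolding quantile_eq using sc_cdf_surj[of u] inv_into_into[of u sc_cdf "{-1..1}"] by auto

lemma sc_cdf_quantile: "0 \<le> u \<Longrightarrow> u \<le> 1 \<Longrightarrow> sc_cdf (quantile u) = u"
  unfolding quantile_eq using sc_cdf_surj[of u] by (auto intro!: f_inv_into_f)

lemma quantile_sc_cdf: "-1 \<le> x \<Longrightarrow> x \<le> 1 \<Longrightarrow> quantile (sc_cdf x) = x"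
  using sc_cdf_quantile[of "sc_cdf x"] quantile_range[of "sc_cdf x"] sc_cdf_range[of x] sc_cdf_strict_mono[of x "quantile (sc_cdf x)"]
    sc_cdf_strict_mono[of "quantile (sc_cdf x)" x]
  by (cases "quantile (sc_cdf x)" x rule: linorder_cases) auto

lemma quantile_ends [simp]: "quantile 0 = -1" "quantile 1 = 1"
  using quantile_sc_cdf[of "-1"] quantile_sc_cdf[of 1] by auto

lemma quantile_less_iff: "0 \<le> u \<Longrightarrow> u \<le> 1 \<Longrightarrow> 0 \<le> v \<Longrightarrow> v \<le> 1 \<Longrightarrow> quantile u < quantile v \<longleftrightarrow> u < v"
  using sc_cdf_less_iff[of "quantile u" "quantile v"] quantile_range[of u] quantile_range[of v] sc_cdf_quantile by simp

lemma quantile_le_iff: "0 \<le> u \<Longrightarrow> u \<le> 1 \<Longrightarrow> 0 \<le> v \<Longrightarrow> v \<le> 1 \<Longrightarrow> quantile u \<le> quantile v \<longleftrightarrow> u \<le> v"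
  using quantile_less_iff[of v u] by (auto simp: not_less[symmetric])

lemma quantile_open: "0 < u \<Longrightarrow> u < 1 \<Longrightarrow> -1 < quantile u \<and> quantile u < 1"
  using quantile_less_iff[of 0 u] quantile_less_iff[of u 1] by auto

lemma quantile_minus: "quantile (1 - u) = - quantile u" if "0 \<le> u" "u \<le> 1"
  using quantile_sc_cdf[of "- quantile u"] sc_cdf_minus[of "quantile u"] sc_cdf_quantile[of u] quantile_range[of u] that by auto

lemma quantile_cont: "continuous_on {0..1} quantile"
proof -
  have "continuous_on (sc_cdf ` {-1..1}) quantile"
    by (rule continuous_on_inv[OF sc_cdf_cont]) (auto simp: quantile_sc_cdf)
  moreover have "sc_cdf ` {-1..1} = {0..1}"
    using sc_cdf_surj sc_cdf_range by (auto simp: image_iff) metis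
  ultimately show ?thesis by simp
qed

lemma quantile_deriv_at:
  assumes "0 < u" "u < 1"
  shows "(quantile has_real_derivative 1 / sc_dens (quantile u)) (at u)"
proof -
  have r: "-1 < quantile u" "quantile u < 1" using quantile_open assms by auto
  have "DERIV quantile u :> inverse (sc_dens (quantile u))"
  proof (rule DERIV_inverse_function[where f = sc_cdf and a = 0 and b = 1])
    show "DERIV sc_cdf (quantile u) :> sc_dens (quantile u)"
      using sc_cdf_deriv[of "\<lambda>t. t" 1 "quantile u" UNIV] r by simp
    show "isCont quantile u" using quantile_cont assms by (simp add: continuous_on_interior)
  qed (use assms sc_dens_pos[OF r] sc_cdf_quantile in auto)
  then show ?thesis by (simp add: inverse_eq_divide)
qed

lemma quantile_deriv:
  assumes "(f has_real_derivative f') (at t within S)" "0 < f t" "f t < 1"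
  shows "((\<lambda>t. quantile (f t)) has_real_derivative f' / sc_dens (quantile (f t))) (at t within S)"
  using DERIV_chain2[OF quantile_deriv_at[OF assms(2,3)] assms(1)] by simp

lemma free_profile_eq: "free_profile u = edge_perim (quantile u)" if "0 \<le> u" "u \<le> 1"
proof -
  have "0 \<le> 1 - (quantile u)\<^sup>2" using quantile_range[OF that] abs_square_le_1[of "quantile u"] by (simp add: abs_le_iff)
  then have "(1 - (quantile u)\<^sup>2) powr (3 / 2) = sqrt (1 - (quantile u)\<^sup>2) ^ 3"
    by (cases "1 - (quantile u)\<^sup>2 = 0")
      (simp_all add: powr_half_sqrt[symmetric] powr_powr powr_realpow[symmetric])
  then show ?thesis by (simp add: free_profile_def edge_perim_def chord_def)
qed

section \<open>Perimeter of finite unions of intervals\<close>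

lemma two_ln_le:
  fixes y :: real
  assumes "1 \<le> y"
  shows "2 * ln y \<le> y - 1 / y"
proof -
  have "(1::real) - 1 / 1 - 2 * ln 1 \<le> y - 1 / y - 2 * ln y"
  proof (rule DERIV_nonneg_imp_nondecreasing[OF assms])
    fix x :: real assume x: "1 \<le> x" "x \<le> y"
    have "((\<lambda>y. y - 1 / y - 2 * ln y) has_real_derivative (1 - 1 / x)\<^sup>2) (at x)"
      using x by (auto intro!: derivative_eq_intros simp: power2_eq_square field_simps)
    then show "\<exists>d. ((\<lambda>y. y - 1 / y - 2 * ln y) has_real_derivative d) (at x) \<and> 0 \<le> d"
      by (intro exI[of _ "(1 - 1 / x)\<^sup>2"]) auto
  qed
  then show ?thesis by simp
qed

text \<open>With q = exp x this reads x^2 <= 4 sinh^2 (x / 2). For q >= 1 it is the square of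
  \<open>two_ln_le\<close> at the square root of q; otherwise q is replaced by 1 / q.\<close>

lemma ln_square_le:
  fixes q :: real
  assumes "0 < q"
  shows "(ln q)\<^sup>2 \<le> q + 1 / q - 2"
proof -
  have ge1: "(ln q)\<^sup>2 \<le> q + 1 / q - 2" if "1 \<le> q" for q :: real
  proof -
    have s: "1 \<le> sqrt q" using that by simp
    have "ln q = 2 * ln (sqrt q)" using that by (simp add: ln_sqrt)
    also have "\<dots> \<le> sqrt q - 1 / sqrt q" by (rule two_ln_le[OF s])
    finally have "(ln q)\<^sup>2 \<le> (sqrt q - 1 / sqrt q)\<^sup>2"
      using that by (intro power_mono) auto
    also have "\<dots> = q + 1 / q - 2"
      using that by (simp add: power2_diff power_divide)
    finally show ?thesis .
  qed
  show ?thesis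
  proof (cases "1 \<le> q")
    case False
    then show ?thesis using ge1[of "1 / q"] assms by (simp add: ln_div)
  qed (rule ge1)
qed

text \<open>Here t is the relative position of the middle point in [a, b] and r the ratio of the
  densities at b and a. Put X = ln (1 / t) and Y = ln (1 / (1 - t)). Minimising over r by AM-GM
  leaves (sqrt X - sqrt Y)^2 <= 1 / t + 1 / (1 - t) - 4. Since X + Y >= 1, the left side is at most
  (X - Y)^2, and X - Y is the logarithm of q = (1 - t) / t, so \<open>ln_square_le\<close>
  applies.\<close>

lemma chord_log_ineq:
  fixes t r :: real
  assumes t: "0 < t" "t < 1" and r: "0 < r"
  shows "0 \<le> 1 / t + 1 / (1 - t) - 4 + (r - 1) * ln (1 / t) + (1 / r - 1) * ln (1 / (1 - t))"
proof -
  define X where "X = ln (1 / t)"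
  define Y where "Y = ln (1 / (1 - t))"
  have XY: "0 < X" "0 < Y" unfolding X_def Y_def using t by auto
  have amgm: "2 * (sqrt X * sqrt Y) \<le> r * X + Y / r"
  proof -
    have "0 \<le> (sqrt r * sqrt X - sqrt Y / sqrt r)\<^sup>2" by simp
    also have "\<dots> = r * X + Y / r - 2 * (sqrt X * sqrt Y)"
      using XY r by (simp add: power2_diff power_mult_distrib power_divide)
    finally show ?thesis by simp
  qed
  have "X + Y = ln (1 / (t * (1 - t)))"
    using t by (simp add: X_def Y_def ln_div ln_mult)
  \<comment> \<open>This works because t (1 - t) <= 1 / 4 and 4 exceeds e.\<close>
  moreover have "exp 1 \<le> 1 / (t * (1 - t))"
  proof -
    have "t * (1 - t) \<le> 1 / 4" using sum_squares_bound[of t "1 - t"] by (simp add: power2_eq_square algebra_simps)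
    then have "4 \<le> 1 / (t * (1 - t))" using t by (simp add: field_simps)
    then show ?thesis using exp_le by linarith
  qed
  ultimately have S: "1 \<le> X + Y" using t by (simp add: ln_ge_iff)
  have "(sqrt X - sqrt Y)\<^sup>2 * 1 \<le> (sqrt X - sqrt Y)\<^sup>2 * (sqrt X + sqrt Y)\<^sup>2"
    using S XY by (intro mult_left_mono) (auto simp: power2_sum intro: order_trans)
  also have "\<dots> = (X - Y)\<^sup>2"
  proof -
    have "(sqrt X - sqrt Y) * (sqrt X + sqrt Y) = X - Y" using XY by (simp add: algebra_simps)
    then show ?thesis by (simp add: power_mult_distrib[symmetric])
  qed
  also have "X - Y = ln ((1 - t) / t)" using t by (simp add: X_def Y_def ln_div)
  also have "(ln ((1 - t) / t))\<^sup>2 \<le> (1 - t) / t + 1 / ((1 - t) / t) - 2"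
    by (rule ln_square_le) (use t in simp)
  also have "\<dots> = 1 / t + 1 / (1 - t) - 4" using t by (simp add: field_simps)
  finally have "X + Y - 2 * (sqrt X * sqrt Y) \<le> 1 / t + 1 / (1 - t) - 4"
    using XY by (simp add: power2_diff mult.assoc)
  then show ?thesis using amgm unfolding X_def[symmetric] Y_def[symmetric] by (simp add: algebra_simps)
qed

text \<open>The points (a, \<open>chord a\<close>) and (b, \<open>chord b\<close>) lie on the unit
  circle, so the segment joining them stays in the disc and hence below the upper arc.\<close>

lemma sc_dens_chord:
  assumes "-1 \<le> a" "a < b" "b \<le> 1" "a \<le> y" "y \<le> b"
  shows "sc_dens a + (sc_dens b - sc_dens a) / (b - a) * (y - a) \<le> sc_dens y"
proof -
  define t where "t = (y - a) / (b - a)"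
  have t: "0 \<le> t" "t \<le> 1" using assms by (auto simp: t_def)
  have "t * (b - a) = y - a" using assms by (simp add: t_def)
  then have y: "y = (1 - t) * a + t * b" by (simp add: algebra_simps)
  have sq: "chord a * chord a = 1 - a * a" "chord b * chord b = 1 - b * b" using assms by (auto intro!: chord_sq)
  have "0 \<le> (a - b)\<^sup>2 + (chord a - chord b)\<^sup>2" by simp
  then have ab: "a * b + chord a * chord b \<le> 1"
    using sq by (simp add: power2_eq_square algebra_simps)
  have "((1 - t) * chord a + t * chord b)\<^sup>2 + y\<^sup>2
     = (1 - t)\<^sup>2 * (chord a * chord a + a * a) + t\<^sup>2 * (chord b * chord b + b * b) + 2 * (t * (1 - t)) * (a * b + chord a * chord b)"
    unfolding y by (simp add: power2_eq_square algebra_simps)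
  also have "\<dots> \<le> (1 - t)\<^sup>2 * 1 + t\<^sup>2 * 1 + 2 * (t * (1 - t)) * 1"
    using ab t by (intro add_mono mult_left_mono) (auto simp: sq)
  also have "\<dots> = 1" by (simp add: power2_eq_square algebra_simps)
  finally have "(1 - t) * chord a + t * chord b \<le> chord y"
    unfolding chord_def[of y] by (intro real_le_rsqrt) simp
  then have "2 / pi * ((1 - t) * chord a + t * chord b) \<le> sc_dens y"
    unfolding sc_dens_def by (intro mult_left_mono) auto
  moreover have "sc_dens a + (sc_dens b - sc_dens a) / (b - a) * (y - a) = sc_dens a + (sc_dens b - sc_dens a) * t"
    by (simp add: t_def)
  ultimately show ?thesis by (simp add: sc_dens_def algebra_simps)
qed

lemma dcauchy_deriv:
  assumes "-1 < a" "a < y" "y < 1"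
  shows "((\<lambda>y. dcauchy a y) has_real_derivative - sc_dens y / (y - a)\<^sup>2) (at y)"
proof -
  let ?s = "chord a" and ?r = "chord y"
  have p: "?s > 0" "?r > 0" using assms chord_pos by auto
  have sq: "?r * ?r = 1 - y * y" using assms by (auto intro!: chord_sq)
  have i: "((\<lambda>y. y) has_real_derivative 1) (at y)" by simp
  have c: "((\<lambda>y. a) has_real_derivative 0) (at y)" by simp
  have h: "y - a > 0" using assms by simp
  have l: "((\<lambda>y. log_ratio a y) has_real_derivative - ?s / (?r * (y - a))) (at y)"
    using log_ratio_deriv[OF c _ _ i, of ] assms by simp
  have q: "((\<lambda>y. chord y / (y - a)) has_real_derivative ((- y / ?r * 1) * (y - a) - ?r * (1 - 0)) / ((y - a) * (y - a))) (at y)"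
    by (rule DERIV_divide[OF chord_deriv[OF i] DERIV_diff[OF i c]]) (use assms in auto)
  have s: "((\<lambda>y. - (pi / 2 - arcsin y)) has_real_derivative 1 / ?r) (at y)"
    by (rule DERIV_cong[OF DERIV_minus[OF DERIV_diff[OF DERIV_const arcsin_deriv[OF i]]]]) (use assms in auto)
  have "((\<lambda>y. dcauchy a y) has_real_derivative
     2 / pi * (1 / ?r - a / ?s * (- ?s / (?r * (y - a))) + ((- y / ?r * 1) * (y - a) - ?r * (1 - 0)) / ((y - a) * (y - a)))) (at y)"
    unfolding dcauchy_def
    by (rule DERIV_cmult[OF DERIV_add[OF DERIV_diff[OF s DERIV_cmult[OF l]] q]])
  moreover have "1 / ?r - a / ?s * (- ?s / (?r * (y - a))) + ((- y / ?r * 1) * (y - a) - ?r * (1 - 0)) / ((y - a) * (y - a))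
     = - ?r / (y - a)\<^sup>2"
  proof -
    have "1 / ?r - a / ?s * (- ?s / (?r * (y - a))) + ((- y / ?r * 1) * (y - a) - ?r * (1 - 0)) / ((y - a) * (y - a))
       = ((y - a) * (y - a) + a * (y - a) - y * (y - a) - ?r * ?r) / (?r * ((y - a) * (y - a)))"
      using p h by (simp add: divide_simps) (simp add: algebra_simps)
    also have "(y - a) * (y - a) + a * (y - a) - y * (y - a) - ?r * ?r = - (?r * ?r)"
      by (simp add: algebra_simps)
    finally show ?thesis using p by (simp add: power2_eq_square)
  qed
  ultimately have "((\<lambda>y. dcauchy a y) has_real_derivative 2 / pi * (- ?r / (y - a)\<^sup>2)) (at y)"
    by (simp only:)
  then show ?thesis by (simp add: sc_dens_def)
qed

text \<open>\<open>dcauchy a c - dcauchy a b\<close> is the integral of \<open>sc_dens y / (y - a)\<^sup>2\<close> over \<open>[c, b]\<close>; the density is replaced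
  by its chord over \<open>[a, b]\<close>.\<close>

lemma dcauchy_diff_ge:
  assumes "-1 < a" "a < c" "c < b" "b < 1"
  shows "sc_dens a * (1 / (c - a) - 1 / (b - a)) + (sc_dens b - sc_dens a) / (b - a) * ln ((b - a) / (c - a))
     \<le> dcauchy a c - dcauchy a b"
proof -
  define m where "m = (sc_dens b - sc_dens a) / (b - a)"
  have "- dcauchy a c - (m * ln (c - a) - sc_dens a / (c - a)) \<le> - dcauchy a b - (m * ln (b - a) - sc_dens a / (b - a))"
  proof (rule DERIV_nonneg_imp_nondecreasing[where f = "\<lambda>y. - dcauchy a y - (m * ln (y - a) - sc_dens a / (y - a))"])
    fix y assume y: "c \<le> y" "y \<le> b"
    let ?d = "(sc_dens y - (sc_dens a + m * (y - a))) / (y - a)\<^sup>2"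
    have d: "((\<lambda>y. m * ln (y - a) - sc_dens a / (y - a)) has_real_derivative (m * (1 / (y - a)) + sc_dens a / (y - a)\<^sup>2)) (at y)"
      using y assms by (auto intro!: derivative_eq_intros simp: power2_eq_square)
    have "((\<lambda>y. - dcauchy a y - (m * ln (y - a) - sc_dens a / (y - a))) has_real_derivative
       - (- sc_dens y / (y - a)\<^sup>2) - (m * (1 / (y - a)) + sc_dens a / (y - a)\<^sup>2)) (at y)"
      by (rule DERIV_diff[OF DERIV_minus[OF dcauchy_deriv] d]) (use y assms in auto)
    also have "- (- sc_dens y / (y - a)\<^sup>2) - (m * (1 / (y - a)) + sc_dens a / (y - a)\<^sup>2) = ?d"
      using y assms by (simp add: divide_simps power2_eq_square)
    finally have "((\<lambda>y. - dcauchy a y - (m * ln (y - a) - sc_dens a / (y - a))) has_real_derivative ?d) (at y)" .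
    moreover have "0 \<le> ?d" using sc_dens_chord[of a b y] y assms by (simp add: m_def)
    ultimately show "\<exists>d. ((\<lambda>y. - dcauchy a y - (m * ln (y - a) - sc_dens a / (y - a))) has_real_derivative d) (at y) \<and> 0 \<le> d"
      by blast
  qed (use assms in auto)
  then show ?thesis unfolding m_def[symmetric] using assms by (simp add: ln_div algebra_simps)
qed

text \<open>Each quotient is bounded by \<open>dcauchy_diff_ge\<close>, the second one after the
  reflection x -> -x, which exchanges t with 1 - t and r with 1 / r. Multiplied by b - a, the two
  bounds add up to 2 plus the expression of \<open>chord_log_ineq\<close>.\<close>

lemma swap_second_order:
  assumes "-1 < a" "a < c" "c < b" "b < 1"
  shows "2 / (b - a) \<le> (dcauchy a c - dcauchy a b) / sc_dens a + (dcauchy (- b) (- c) - dcauchy (- b) (- a)) / sc_dens b"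
proof -
  define h where "h = b - a"
  define t where "t = (c - a) / h"
  define r where "r = sc_dens b / sc_dens a"
  have p: "sc_dens a > 0" "sc_dens b > 0" "h > 0" using assms sc_dens_pos by (auto simp: h_def)
  have t: "0 < t" "t < 1" "c - a = t * h" "b - c = (1 - t) * h"
    using assms p by (auto simp: t_def h_def field_simps)
  have r: "0 < r" using p by (simp add: r_def)
  have gen: "(1 / t - 1 + (Y / X - 1) * L) / h = (X * (1 / (t * h) - 1 / h) + (Y - X) / h * L) / X"
    if "X \<noteq> 0" "t \<noteq> 0" for X Y L t :: real
    using that p by (simp add: divide_simps)
  have A: "(1 / t - 1 + (r - 1) * ln (1 / t)) / h \<le> (dcauchy a c - dcauchy a b) / sc_dens a"
  proof -
    have "(1 / t - 1 + (r - 1) * ln (1 / t)) / h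
       = (sc_dens a * (1 / (c - a) - 1 / (b - a)) + (sc_dens b - sc_dens a) / (b - a) * ln ((b - a) / (c - a))) / sc_dens a"
      using gen[of "sc_dens a" t "sc_dens b" "ln (1 / t)"] p t unfolding t(3) h_def[symmetric] r_def by simp
    then show ?thesis using dcauchy_diff_ge[OF assms] p by (simp add: divide_right_mono)
  qed
  have B: "(1 / (1 - t) - 1 + (1 / r - 1) * ln (1 / (1 - t))) / h \<le> (dcauchy (- b) (- c) - dcauchy (- b) (- a)) / sc_dens b"
  proof -
    have "(1 / (1 - t) - 1 + (1 / r - 1) * ln (1 / (1 - t))) / h
       = (sc_dens b * (1 / (b - c) - 1 / (b - a)) + (sc_dens a - sc_dens b) / (b - a) * ln ((b - a) / (b - c))) / sc_dens b"
      using gen[of "sc_dens b" "1 - t" "sc_dens a" "ln (1 / (1 - t))"] p t unfolding t(4) h_def[symmetric] r_def by simp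
    then show ?thesis using dcauchy_diff_ge[of "- b" "- c" "- a"] assms p by (simp add: divide_right_mono)
  qed
  have "2 / h \<le> (1 / t - 1 + (r - 1) * ln (1 / t)) / h + (1 / (1 - t) - 1 + (1 / r - 1) * ln (1 / (1 - t))) / h"
    using chord_log_ineq[OF t(1,2) r] p by (simp add: add_divide_distrib[symmetric] divide_right_mono)
  then show ?thesis using A B by (simp add: h_def)
qed

section \<open>Continuity of the interaction energy up to the diagonal\<close>

lemma log_ratio_nonneg:
  assumes "-1 \<le> a" "a < b" "b \<le> 1"
  shows "0 \<le> log_ratio a b" and "b - a \<le> 1 - a * b + chord a * chord b"
proof -
  have "0 \<le> (1 - b) * (1 + a)" using assms by simp
  then show n: "b - a \<le> 1 - a * b + chord a * chord b"
  proof -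
    have "0 \<le> chord a * chord b" using assms by (intro mult_nonneg_nonneg chord_nonneg) auto
    with \<open>0 \<le> (1 - b) * (1 + a)\<close> show ?thesis by (simp add: algebra_simps)
  qed
  show "0 \<le> log_ratio a b" unfolding log_ratio_def using n assms by simp
qed

lemma chord_le_1: "chord x \<le> 1"
  unfolding chord_def by simp

text \<open>The numerator of \<open>log_ratio\<close> is at most 3, enlarged to 4 for the sake of
  its square root, and ln y <= 2 sqrt y. So the logarithmic singularity at a = b is killed by a
  factor b - a.\<close>

lemma log_ratio_bound:
  assumes "-1 \<le> a" "a \<le> b" "b \<le> 1"
  shows "\<bar>(b - a) * log_ratio a b\<bar> \<le> 4 * sqrt (b - a)"
proof (cases "a = b")
  case False
  then have ab: "a < b" using assms by simp
  define N where "N = 1 - a * b + chord a * chord b"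
  have "N \<le> 3"
  proof -
    have "\<bar>a * b\<bar> \<le> 1 * 1" unfolding abs_mult by (rule mult_mono) (use assms in auto)
    moreover have "chord a * chord b \<le> 1 * 1" using chord_le_1 assms by (intro mult_mono chord_nonneg) auto
    ultimately show ?thesis by (simp add: N_def)
  qed
  moreover have N: "b - a \<le> N" unfolding N_def by (rule log_ratio_nonneg) (use assms ab in auto)
  ultimately have q: "0 < N / (b - a)" "N / (b - a) \<le> 4 / (b - a)" using ab by (auto simp: divide_right_mono)
  have "log_ratio a b = ln (N / (b - a))" by (simp add: log_ratio_def N_def)
  also have "\<dots> = 2 * ln (sqrt (N / (b - a)))" using q by (simp add: ln_sqrt)
  also have "\<dots> \<le> 2 * sqrt (N / (b - a))"
    using ln_le_minus_one[of "sqrt (N / (b - a))"] q by simp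
  also have "\<dots> \<le> 2 * sqrt (4 / (b - a))" using q by simp
  also have "\<dots> = 4 / sqrt (b - a)" by (simp add: real_sqrt_divide)
  finally have "(b - a) * log_ratio a b \<le> (b - a) * (4 / sqrt (b - a))" using ab by (intro mult_left_mono) auto
  also have "\<dots> = 4 * ((b - a) / sqrt (b - a))" by simp
  also have "\<dots> = 4 * sqrt (b - a)" using ab real_div_sqrt[of "b - a"] by (simp only:)
  finally show ?thesis using log_ratio_nonneg(1)[of a b] ab assms by simp
qed simp

text \<open>The coefficient of \<open>log_ratio\<close> is divisible by b - a, so the only delicate
  term is (b - a) * \<open>log_ratio a b\<close>, which tends to 0 at the diagonal, corners
  included.\<close>

lemma mutual_cont: "continuous_on {p. -1 \<le> fst p \<and> fst p \<le> snd p \<and> snd p \<le> 1} (\<lambda>p. mutual (fst p) (snd p))"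
proof -
  let ?T = "{p::real \<times> real. -1 \<le> fst p \<and> fst p \<le> snd p \<and> snd p \<le> 1}"
  have L: "continuous_on ?T (\<lambda>p. (snd p - fst p) * log_ratio (fst p) (snd p))"
    unfolding continuous_on_def
  proof
    fix p assume p: "p \<in> ?T"
    show "((\<lambda>p. (snd p - fst p) * log_ratio (fst p) (snd p)) \<longlongrightarrow> (snd p - fst p) * log_ratio (fst p) (snd p)) (at p within ?T)"
    proof (cases "fst p = snd p")
      case True
      have "((\<lambda>p. (snd p - fst p) * log_ratio (fst p) (snd p)) \<longlongrightarrow> 0) (at p within ?T)"
      proof (rule Lim_null_comparison)
        show "\<forall>\<^sub>F x in at p within ?T. norm ((snd x - fst x) * log_ratio (fst x) (snd x)) \<le> 4 * sqrt (snd x - fst x)"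
          using log_ratio_bound by (auto simp: eventually_at_filter)
        have "((\<lambda>x. 4 * sqrt (snd x - fst x)) \<longlongrightarrow> 4 * sqrt (snd p - fst p)) (at p within ?T)"
          by (intro tendsto_intros)
        then show "((\<lambda>x. 4 * sqrt (snd x - fst x)) \<longlongrightarrow> 0) (at p within ?T)" using True by simp
      qed
      then show ?thesis using True by simp
    next
      case False
      then have lt: "fst p < snd p" using p by auto
      have n: "0 < 1 - fst p * snd p + chord (fst p) * chord (snd p)"
        using log_ratio_nonneg(2)[of "fst p" "snd p"] p lt by auto
      have ic: "isCont chord x" for x
        using chord_cont[of UNIV] by (simp add: continuous_on_eq_continuous_at)
      have t: "((\<lambda>x. chord (fst x)) \<longlongrightarrow> chord (fst p)) (at p within ?T)" "((\<lambda>x. chord (snd x)) \<longlongrightarrow> chord (snd p)) (at p within ?T)"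
        by (rule isCont_tendsto_compose[OF ic tendsto_fst[OF tendsto_ident_at]],
            rule isCont_tendsto_compose[OF ic tendsto_snd[OF tendsto_ident_at]])
      show ?thesis unfolding log_ratio_def by (intro tendsto_intros t) (use n lt in auto)
    qed
  qed
  have c: "continuous_on ?T (\<lambda>p. chord (fst p))" "continuous_on ?T (\<lambda>p. chord (snd p))"
    by (intro continuous_on_compose2[OF chord_cont[of UNIV]] continuous_intros; simp)+
  have eq: "mutual a b = 4 / pi\<^sup>2 * (((pi / 2 - arcsin b) * chord a ^ 3 + (pi / 2 + arcsin a) * chord b ^ 3
       + chord a * chord b * (b - a)) / 3 - (1 - (a\<^sup>2 + a * b + b\<^sup>2) / 3) * ((b - a) * log_ratio a b))" for a b
  proof -
    have "b - b ^ 3 / 3 - (a - a ^ 3 / 3) = (1 - (a\<^sup>2 + a * b + b\<^sup>2) / 3) * (b - a)"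
      by (simp add: power2_eq_square power3_eq_cube field_simps)
    then show ?thesis by (simp add: mutual_def mult.assoc)
  qed
  show ?thesis unfolding eq
    by (intro continuous_intros L c) auto
qed

lemma mutual_cont_comp:
  assumes "continuous_on S f" "continuous_on S g"
    "\<And>t. t \<in> S \<Longrightarrow> -1 \<le> f t \<and> f t \<le> g t \<and> g t \<le> 1"
  shows "continuous_on S (\<lambda>t. mutual (f t) (g t))"
proof -
  have "continuous_on S (\<lambda>t. (f t, g t))" by (intro continuous_intros assms(1,2))
  moreover have "(\<lambda>t. (f t, g t)) ` S \<subseteq> {p. - 1 \<le> fst p \<and> fst p \<le> snd p \<and> snd p \<le> 1}"
    using assms(3) by auto
  ultimately show ?thesis using continuous_on_compose2[OF mutual_cont] by fastforce
qed

lemma mutual_reflect: "mutual (- b) (- a) = mutual a b" if "-1 \<le> a" "a \<le> 1" "-1 \<le> b" "b \<le> 1"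
  using that by (simp add: mutual_def log_ratio_reflect arcsin_minus algebra_simps)

text \<open>The slope at x decides: if it is nonnegative, so is every slope to the left and M l <= M
  x; otherwise M decreases from x to r. Differentiability is asked only in the interior because the
  quantile has infinite slope at 0 and 1.\<close>

lemma concave_min_at_ends:
  fixes M M' :: "real \<Rightarrow> real"
  assumes cont: "continuous_on {l..r} M"
    and deriv: "\<And>t. l < t \<Longrightarrow> t < r \<Longrightarrow> (M has_real_derivative M' t) (at t)"
    and anti: "\<And>s t. l < s \<Longrightarrow> s < t \<Longrightarrow> t < r \<Longrightarrow> M' t \<le> M' s"
    and x: "l \<le> x" "x \<le> r"
  shows "M l \<le> M x \<or> M r \<le> M x"
proof (cases "x = l \<or> x = r")
  case False
  then have x': "l < x" "x < r" using x by auto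
  show ?thesis
  proof (cases "0 \<le> M' x")
    case True
    have "M l \<le> M x"
    proof (rule DERIV_nonneg_imp_increasing_open[OF x(1)])
      fix t assume t: "l < t" "t < x"
      then show "\<exists>d. (M has_real_derivative d) (at t) \<and> 0 \<le> d"
        using deriv[of t] anti[of t x] True x' by (intro exI[of _ "M' t"]) auto
    qed (rule continuous_on_subset[OF cont], use x in auto)
    then show ?thesis by simp
  next
    case neg: False
    have "M r \<le> M x"
    proof (rule DERIV_nonpos_imp_decreasing_open[OF x(2)])
      fix t assume t: "x < t" "t < r"
      then show "\<exists>d. (M has_real_derivative d) (at t) \<and> d \<le> 0"
        using deriv[of t] anti[of x t] neg x' by (intro exI[of _ "M' t"]) auto
    qed (rule continuous_on_subset[OF cont], use x in auto)
    then show ?thesis by simp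
  qed
qed auto

section \<open>Sliding a single interval: trigonometric inequalities\<close>

lemma sin_chord:
  fixes g d :: real
  assumes "0 \<le> d" "d \<le> g" "g \<le> pi"
  shows "d * sin g \<le> g * sin d"
proof -
  have "g * sin 0 - 0 * sin g \<le> g * sin d - d * sin g \<or> g * sin g - g * sin g \<le> g * sin d - d * sin g"
  proof (rule concave_min_at_ends[where M = "\<lambda>d. g * sin d - d * sin g" and M' = "\<lambda>d. g * cos d - sin g"])
    show "\<And>t. ((\<lambda>d. g * sin d - d * sin g) has_real_derivative g * cos t - sin g) (at t)"
      by (auto intro!: derivative_eq_intros)
    show "\<And>s t. 0 < s \<Longrightarrow> s < t \<Longrightarrow> t < g \<Longrightarrow> g * cos t - sin g \<le> g * cos s - sin g"
      using assms by (auto intro!: mult_left_mono cos_monotone_0_pi_le)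
  qed (use assms in \<open>auto intro!: continuous_intros\<close>)
  then show ?thesis by auto
qed

text \<open>The expression vanishes at x = g and decreases in x. Minus its slope, sin x + g cos x -
  sin g, is nonnegative because it is concave with end values g - sin g and g cos g. This serves
  intervals with right end b >= 0, and \<open>sin_chord\<close> those with b < 0.\<close>

lemma cos_sin_ineq:
  fixes g x :: real
  assumes "0 \<le> x" "x \<le> g" "g \<le> pi / 2"
  shows "0 \<le> cos x - cos g - g * sin x + x * sin g"
proof -
  have k: "0 \<le> sin y + g * cos y - sin g" if "0 \<le> y" "y \<le> g" for y
  proof -
    have "sin 0 + g * cos 0 - sin g \<le> sin y + g * cos y - sin g \<or> sin g + g * cos g - sin g \<le> sin y + g * cos y - sin g"
    proof (rule concave_min_at_ends[where M = "\<lambda>y. sin y + g * cos y - sin g" and M' = "\<lambda>y. cos y - g * sin y"])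
      show "\<And>t. ((\<lambda>y. sin y + g * cos y - sin g) has_real_derivative cos t - g * sin t) (at t)"
        by (auto intro!: derivative_eq_intros)
      fix s t :: real assume "0 < s" "s < t" "t < g"
      then have "cos t \<le> cos s" "g * sin s \<le> g * sin t"
        using assms by (auto intro!: cos_monotone_0_pi_le mult_left_mono sin_monotone_2pi_le)
      then show "cos t - g * sin t \<le> cos s - g * sin s" by simp
    qed (use that in \<open>auto intro!: continuous_intros\<close>)
    moreover have "sin g \<le> g" using sin_x_le_x assms by auto
    moreover have "0 \<le> g * cos g" using assms by (auto intro!: mult_nonneg_nonneg cos_ge_zero)
    ultimately show ?thesis by auto
  qed
  have "cos g - cos g - g * sin g + g * sin g \<le> cos x - cos g - g * sin x + x * sin g"
  proof (rule DERIV_nonpos_imp_nonincreasing[where f = "\<lambda>x. cos x - cos g - g * sin x + x * sin g"])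
    fix y assume "x \<le> y" "y \<le> g"
    then have "((\<lambda>x. cos x - cos g - g * sin x + x * sin g) has_real_derivative - (sin y + g * cos y - sin g)) (at y)"
      "- (sin y + g * cos y - sin g) \<le> 0"
      using k[of y] assms by (auto intro!: derivative_eq_intros)
    then show "\<exists>d. ((\<lambda>x. cos x - cos g - g * sin x + x * sin g) has_real_derivative d) (at y) \<and> d \<le> 0" by blast
  qed (use assms in auto)
  then show ?thesis by simp
qed

lemma chord_arcsin: "chord x = cos (arcsin x)" if "-1 \<le> x" "x \<le> 1"
  using that by (simp add: chord_def cos_arcsin)

text \<open>The sign of the slope of the perimeter when an interval left of the centre slides to the right.\<close>

lemma slide_derivative_sign:
  assumes "-1 < a" "a < b" "b < 1" "a + b \<le> 0"
  shows "0 \<le> - a - b - cauchy a b + cauchy (- b) (- a)"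
proof -
  define g where "g = arcsin (- a)"
  have a0: "a < 0" using assms by simp
  have g: "0 \<le> g" "g \<le> pi / 2" "sin g = - a" "arcsin a = - g"
    using assms arcsin_ubound[of "- a"] arcsin_le_mono[of 0 "-a"] by (auto simp: g_def arcsin_minus)
  have cg: "chord a = cos g" using chord_arcsin[of "- a"] assms by (simp add: g_def)
  define x where "x = arcsin b"
  have x: "sin x = b" "cos x = chord b" "-pi/2 \<le> x" "x \<le> pi / 2"
    using assms chord_arcsin[of b] arcsin_bounded[of b] by (auto simp: x_def)
  have chord: "chord a \<le> chord b"
  proof -
    have "\<bar>b\<bar> \<le> \<bar>a\<bar>" using assms by auto
    then have "b\<^sup>2 \<le> a\<^sup>2" by (simp add: abs_le_square_iff)
    then show ?thesis by (simp add: chord_def)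
  qed
  \<comment> \<open>In the closed forms the pi / 2 terms of the two \<open>cauchy\<close> values
    cancel -a - b. What is left is 2 / pi times the sum of this expression and (chord b - chord a) *
    \<open>log_ratio a b\<close>. In the angles it reads x sin g - g sin x + cos x - cos g.\<close>
  have "0 \<le> b * arcsin a - a * arcsin b + (chord b - chord a)"
  proof (cases "0 \<le> b")
    case True
    have "x \<le> g" unfolding x_def g_def using assms by (subst arcsin_le_mono) auto
    moreover have "0 \<le> x" unfolding x_def using True assms arcsin_le_mono[of 0 b] by auto
    ultimately show ?thesis using cos_sin_ineq[of x g] g x cg by (simp add: x_def algebra_simps)
  next
    case False
    have "- x \<le> g" unfolding x_def g_def using assms False by (subst arcsin_minus[symmetric]; (subst arcsin_le_mono)?) auto
    moreover have "0 \<le> - x" unfolding x_def using False assms arcsin_le_mono[of b 0] by auto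
    ultimately have "- x * sin g \<le> g * sin (- x)" using g by (intro sin_chord) (auto intro: order_trans[of _ "pi/2"])
    then show ?thesis using g x chord by (simp add: x_def algebra_simps)
  qed
  moreover have "0 \<le> (chord b - chord a) * log_ratio a b" using chord log_ratio_nonneg[of a b] assms by simp
  ultimately have "0 \<le> b * arcsin a - a * arcsin b + (chord b - chord a) * (log_ratio a b + 1)"
    by (simp add: algebra_simps)
  then have "0 \<le> 2 / pi * (b * arcsin a - a * arcsin b + (chord b - chord a) * (log_ratio a b + 1))"
    by simp
  also have "\<dots> = - a - b - cauchy a b + cauchy (- b) (- a)"
    using assms by (simp add: cauchy_def log_ratio_reflect arcsin_minus field_simps)
  finally show ?thesis .
qed

text \<open>The sorted list \<open>[b\<^sub>1, b\<^sub>2, b\<^sub>3, \<dots>]\<close> stands for the set \<open>[-1, b\<^sub>1] \<union> [b\<^sub>2, b\<^sub>3] \<union> \<dots>\<close>. Its mass is \<open>alt_mass\<close> for lists of odd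
  length; for even length \<open>alt_mass\<close> is minus the mass of the complement. Repeated points cancel.\<close>

primrec alt_mutual :: "real \<Rightarrow> real list \<Rightarrow> real" where
  "alt_mutual x [] = 0"
| "alt_mutual x (c # cs) = mutual x c - alt_mutual x cs"

text \<open>Up to an additive constant, the indicator of the set is the alternating sum of the
  indicators of [-1, b_i], up to null sets. The perimeter is a quadratic form in it that ignores
  constants, which is why both parities share one formula. For half-lines with ends a <= b the
  associated bilinear form is 2 \<open>mutual a b\<close>, so a pair i < j contributes 4 (-1)^(j -
  i) times its \<open>mutual\<close>.\<close>

primrec perim :: "real list \<Rightarrow> real" where
  "perim [] = 0"
| "perim (b # bs) = edge_perim b - 4 * alt_mutual b bs + perim bs"

primrec alt_mass :: "real list \<Rightarrow> real" where
  "alt_mass [] = 0"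
| "alt_mass (b # bs) = sc_cdf b - alt_mass bs"

primrec alt_cauchy :: "real \<Rightarrow> real list \<Rightarrow> real" where
  "alt_cauchy x [] = 0"
| "alt_cauchy x (c # cs) = cauchy x c - alt_cauchy x cs"

definition config :: "real list \<Rightarrow> bool" where
  "config bs \<longleftrightarrow> sorted bs \<and> set bs \<subseteq> {-1..1}"

lemma alt_mutual_left [simp]: "alt_mutual (-1) bs = 0"
  by (induction bs) auto

section \<open>Variation of the perimeter in its boundary points\<close>

lemma mutual_deriv_left:
  assumes "(f has_real_derivative f') (at t)" "-1 < f t" "f t < d" "d \<le> 1"
  shows "((\<lambda>t. mutual (f t) d) has_real_derivative sc_dens (f t) * cauchy (f t) d * f') (at t)"
proof (cases "d = 1")
  case True
  then show ?thesis using assms by (simp add: cauchy_right)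
next
  case False
  then show ?thesis using mutual_deriv[OF assms(1,2) _ DERIV_const, of d] assms by simp
qed

lemma alt_mutual_deriv:
  assumes "(f has_real_derivative f') (at t)" "-1 < f t" "\<And>d. d \<in> set bs \<Longrightarrow> f t < d \<and> d \<le> 1"
  shows "((\<lambda>t. alt_mutual (f t) bs) has_real_derivative sc_dens (f t) * alt_cauchy (f t) bs * f') (at t)"
  using assms(3)
proof (induction bs)
  case (Cons d bs)
  have "((\<lambda>t. mutual (f t) d - alt_mutual (f t) bs) has_real_derivative
     sc_dens (f t) * cauchy (f t) d * f' - sc_dens (f t) * alt_cauchy (f t) bs * f') (at t)"
    by (rule DERIV_diff[OF mutual_deriv_left Cons.IH]) (use assms(1,2) Cons.prems in auto)
  then show ?case by (simp add: algebra_simps)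
qed simp

lemma alt_mutual_cont:
  assumes "continuous_on S f" "\<And>t d. t \<in> S \<Longrightarrow> d \<in> set bs \<Longrightarrow> -1 \<le> f t \<and> f t \<le> d \<and> d \<le> 1"
  shows "continuous_on S (\<lambda>t. alt_mutual (f t) bs)"
  using assms(2)
proof (induction bs)
  case (Cons d bs)
  then show ?case using assms(1)
    by (auto intro!: continuous_on_diff mutual_cont_comp)
qed simp

lemma cauchy_cont:
  assumes "-1 < z" "z < c" "d \<le> 1"
  shows "continuous_on {c..d} (\<lambda>y. cauchy z y)"
proof -
  have "y - z \<noteq> 0 \<and> (1 - z * y + chord z * chord y) / (y - z) \<noteq> 0" if "y \<in> {c..d}" for y
    using log_ratio_nonneg(2)[of z y] that assms by auto
  then show ?thesis unfolding cauchy_def log_ratio_def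
    by (intro continuous_intros chord_cont) (use assms in auto)
qed

text \<open>The difference is the integral of 1 / (y - x') - 1 / (y - x), which is nonnegative,
  against the density over y from c to 1; it shrinks as the lower end moves right.\<close>

lemma cauchy_diff_antimono:
  assumes x: "-1 < x" "x < x'" "x' < c" "c \<le> d" "d \<le> 1"
  shows "cauchy x' d - cauchy x d \<le> cauchy x' c - cauchy x c"
proof (rule DERIV_nonpos_imp_decreasing_open[OF x(4), where f = "\<lambda>y. cauchy x' y - cauchy x y"])
  fix y assume y: "c < y" "y < d"
  have i: "((\<lambda>y. y) has_real_derivative 1) (at y)" by simp
  have D: "((\<lambda>y. cauchy z y) has_real_derivative - sc_dens y / (y - z)) (at y)" if "-1 < z" "z < y" for z
    using cauchy_deriv[OF DERIV_const _ _ i, of z] that y x by simp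
  have "((\<lambda>y. cauchy x' y - cauchy x y) has_real_derivative - sc_dens y / (y - x') - - sc_dens y / (y - x)) (at y)"
    by (rule DERIV_diff[OF D D]) (use x y in auto)
  moreover have "sc_dens y / (y - x) \<le> sc_dens y / (y - x')"
    using x y sc_dens_nonneg[of y] by (intro divide_left_mono) auto
  ultimately show "\<exists>D. ((\<lambda>y. cauchy x' y - cauchy x y) has_real_derivative D) (at y) \<and> D \<le> 0"
    by (intro exI[of _ "- sc_dens y / (y - x') - - sc_dens y / (y - x)"]) auto
next
  show "continuous_on {c..d} (\<lambda>y. cauchy x' y - cauchy x y)"
    by (intro continuous_on_diff cauchy_cont) (use x in auto)
qed

text \<open>As in the Leibniz criterion, an alternating sum of nonnegative decreasing terms lies
  between 0 and its first term. The terms are the increments of \<open>cauchy\<close> from x to x',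
  decreasing in the second argument; \<open>c\<close> is a lower bound for the list, kept variable
  for the induction.\<close>

lemma alt_ctr_mono_aux:
  assumes x: "-1 < x" "x < x'" "x' < c" "c \<le> 1"
  shows "\<lbrakk>sorted bs; \<And>d. d \<in> set bs \<Longrightarrow> c \<le> d \<and> d \<le> 1\<rbrakk> \<Longrightarrow>
     0 \<le> alt_cauchy x' bs - alt_cauchy x bs \<and> alt_cauchy x' bs - alt_cauchy x bs \<le> cauchy x' c - cauchy x c"
  using x(3,4)
proof (induction bs arbitrary: c)
  case Nil
  then show ?case using cauchy_diff_antimono[of x x' c 1] x(1,2) by (auto simp: cauchy_right)
next
  case (Cons d bs)
  have d: "c \<le> d" "d \<le> 1" using Cons.prems by auto
  have "0 \<le> alt_cauchy x' bs - alt_cauchy x bs \<and> alt_cauchy x' bs - alt_cauchy x bs \<le> cauchy x' d - cauchy x d"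
    by (rule Cons.IH) (use Cons.prems d in \<open>auto intro: less_le_trans\<close>)
  moreover have "cauchy x' d - cauchy x d \<le> cauchy x' c - cauchy x c"
    by (rule cauchy_diff_antimono) (use Cons.prems d x in auto)
  ultimately show ?case by auto
qed

lemma alt_ctr_mono:
  assumes "-1 < x" "x \<le> x'" "sorted bs" "\<And>d. d \<in> set bs \<Longrightarrow> x' < d \<and> d \<le> 1"
  shows "alt_cauchy x bs \<le> alt_cauchy x' bs"
proof (cases "x = x' \<or> bs = []")
  case False
  then obtain c cs where bs: "bs = c # cs" by (cases bs) auto
  show ?thesis using alt_ctr_mono_aux[of x x' c bs] assms False bs by auto
qed auto

text \<open>In mass coordinates the interval is [t, t + m]. Its perimeter does not decrease as t
  grows up to the symmetric position (1 - m) / 2, and at t = 0 the interval is a half-line.\<close>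

lemma perim_interval_aux:
  assumes m: "0 < m" "m < 1" and t: "0 \<le> t" "t \<le> (1 - m) / 2"
  shows "free_profile m \<le> perim [quantile t, quantile (t + m)]"
proof -
  let ?M = "\<lambda>t. edge_perim (quantile t) + edge_perim (quantile (t + m)) - 4 * mutual (quantile t) (quantile (t + m))"
  have c: "continuous_on {0..t} (\<lambda>t. quantile t)" "continuous_on {0..t} (\<lambda>t. quantile (t + m))"
    by (rule continuous_on_compose2[OF quantile_cont]; (intro continuous_intros)?; use m t in force)+
  have "?M 0 \<le> ?M t"
  proof (rule DERIV_nonneg_imp_increasing_open[OF t(1)])
    show "continuous_on {0..t} ?M"
      by (intro continuous_intros continuous_on_compose2[OF edge_perim_cont[of UNIV]] mutual_cont_comp c)
        (use m t quantile_range quantile_le_iff in auto)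
    fix s assume s: "0 < s" "s < t"
    let ?a = "quantile s" and ?b = "quantile (s + m)"
    have ab: "-1 < ?a" "?a < ?b" "?b < 1" using quantile_open[of s] quantile_open[of "s+m"] quantile_less_iff[of s "s+m"] s t m by auto
    \<comment> \<open>Since s + m <= 1 - s, the right end lies at or below the mirror image of the
      left end.\<close>
    have "?b \<le> quantile (1 - s)" using s t m by (subst quantile_le_iff) auto
    then have sum: "?a + ?b \<le> 0" using quantile_minus[of s] s t m by auto
    have i: "((\<lambda>s. s) has_real_derivative 1) (at s)" "((\<lambda>s. s + m) has_real_derivative 1) (at s)"
      by (auto intro!: derivative_eq_intros)
    have da: "(quantile has_real_derivative 1 / sc_dens ?a) (at s)" using quantile_deriv[OF i(1)] s t m by simp
    have db: "((\<lambda>s. quantile (s + m)) has_real_derivative 1 / sc_dens ?b) (at s)" using quantile_deriv[OF i(2)] s t m by simp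
    have dp: "sc_dens ?a > 0" "sc_dens ?b > 0" using sc_dens_pos ab by auto
    have "(?M has_real_derivative (- 4 * ?a * sc_dens ?a * (1 / sc_dens ?a) + - 4 * ?b * sc_dens ?b * (1 / sc_dens ?b)
       - 4 * (sc_dens ?a * cauchy ?a ?b * (1 / sc_dens ?a) - sc_dens ?b * cauchy (- ?b) (- ?a) * (1 / sc_dens ?b)))) (at s)"
      by (intro DERIV_diff[OF DERIV_add[OF edge_perim_deriv[OF da] edge_perim_deriv[OF db]] DERIV_cmult[OF mutual_deriv[OF da _ _ db]]])
        (use ab in auto)
    moreover have "(- 4 * ?a * sc_dens ?a * (1 / sc_dens ?a) + - 4 * ?b * sc_dens ?b * (1 / sc_dens ?b)
       - 4 * (sc_dens ?a * cauchy ?a ?b * (1 / sc_dens ?a) - sc_dens ?b * cauchy (- ?b) (- ?a) * (1 / sc_dens ?b)))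
       = 4 * (- ?a - ?b - cauchy ?a ?b + cauchy (- ?b) (- ?a))" using dp by simp
    moreover have "0 \<le> 4 * (- ?a - ?b - cauchy ?a ?b + cauchy (- ?b) (- ?a))"
      using slide_derivative_sign[OF ab sum] by simp
    ultimately show "\<exists>D. (?M has_real_derivative D) (at s) \<and> 0 \<le> D" by (intro exI[of _ "4 * (- ?a - ?b - cauchy ?a ?b + cauchy (- ?b) (- ?a))"] conjI) (simp only:)
  qed
  then show ?thesis using m by (simp add: free_profile_eq)
qed

lemma perim_interval:
  assumes "-1 \<le> a" "a \<le> b" "b \<le> 1"
  shows "free_profile (sc_cdf b - sc_cdf a) \<le> perim [a, b]"
proof -
  define m where "m = sc_cdf b - sc_cdf a"
  have r: "0 \<le> sc_cdf a" "sc_cdf a \<le> sc_cdf b" "sc_cdf b \<le> 1" using assms sc_cdf_mono sc_cdf_range by auto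
  have b: "quantile (sc_cdf a + m) = b" "quantile (sc_cdf a) = a" using assms by (auto simp: m_def quantile_sc_cdf)
  consider "m = 0" | "m = 1" | "0 < m" "m < 1" using r by (fastforce simp: m_def)
  then show ?thesis
  proof cases
    case 1
    then have "a = b" using b by simp
    then show ?thesis by (simp add: free_profile_eq mutual_diag)
  next
    case 2
    then have "sc_cdf a = 0" "sc_cdf b = 1" using r by (auto simp: m_def)
    then have "a = -1" "b = 1" using quantile_sc_cdf[of a] quantile_sc_cdf[of b] assms by auto
    then show ?thesis by (simp add: free_profile_eq)
  next
    case 3
    show ?thesis
    proof (cases "sc_cdf a \<le> (1 - m) / 2")
      case True
      then show ?thesis using perim_interval_aux[OF 3, of "sc_cdf a"] r b by (simp add: m_def)
    next
      case False
      \<comment> \<open>Beyond the symmetric position the interval is first reflected about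
        0.\<close>
      have "free_profile m \<le> perim [quantile (1 - sc_cdf b), quantile (1 - sc_cdf b + m)]"
        by (rule perim_interval_aux[OF 3]) (use False r in \<open>auto simp: m_def field_simps\<close>)
      also have "quantile (1 - sc_cdf b) = - b" using quantile_minus[of "sc_cdf b"] assms r quantile_sc_cdf by auto
      also have "quantile (1 - sc_cdf b + m) = - a" using quantile_minus[of "sc_cdf a"] assms r quantile_sc_cdf by (auto simp: m_def)
      also have "perim [- b, - a] = perim [a, b]" using assms by (simp add: mutual_reflect edge_perim_def)
      finally show ?thesis by (simp add: m_def)
    qed
  qed
qed

text \<open>Moving \<open>a\<close> to the right and \<open>b\<close> to the left at the same speed in quantile coordinates preserves
  the mass and is a concave perturbation of the perimeter.\<close>

lemma swap_deriv:
  assumes abc: "-1 < quantile (u + s)" "quantile (u + s) < c" "c < quantile (v - s)" "quantile (v - s) < 1"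
    and uv: "0 < u + s" "u + s < 1" "0 < v - s" "v - s < 1"
    and rest: "\<And>d. d \<in> set rest \<Longrightarrow> quantile (v - s) < d \<and> d \<le> 1"
  defines "a \<equiv> quantile (u + s)" and "b \<equiv> quantile (v - s)"
  shows "((\<lambda>s. perim (quantile (u + s) # c # quantile (v - s) # rest)) has_real_derivative
     4 * ((b - a) - (cauchy a c - cauchy a b) - (cauchy (- b) (- c) - cauchy (- b) (- a)))
     + 4 * (alt_cauchy b rest - alt_cauchy a rest)) (at s)"
proof -
  have dp: "sc_dens a > 0" "sc_dens b > 0" using sc_dens_pos abc unfolding a_def b_def by auto
  have i: "((\<lambda>s. u + s) has_real_derivative 1) (at s)" "((\<lambda>s. v - s) has_real_derivative -1) (at s)"
    by (auto intro!: derivative_eq_intros)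
  have da: "((\<lambda>s. quantile (u + s)) has_real_derivative 1 / sc_dens a) (at s)" using quantile_deriv[OF i(1)] uv by (simp add: a_def)
  have db: "((\<lambda>s. quantile (v - s)) has_real_derivative - 1 / sc_dens b) (at s)" using quantile_deriv[OF i(2)] uv by (simp add: b_def)
  have 1: "((\<lambda>s. edge_perim (quantile (u + s))) has_real_derivative - 4 * a) (at s)"
    using edge_perim_deriv[OF da] abc dp by (simp add: a_def)
  have 2: "((\<lambda>s. edge_perim (quantile (v - s))) has_real_derivative 4 * b) (at s)"
    using edge_perim_deriv[OF db] abc dp by (simp add: b_def)
  have 3: "((\<lambda>s. mutual (quantile (u + s)) c) has_real_derivative cauchy a c) (at s)"
    using mutual_deriv_left[OF da, of c] abc dp by (simp add: a_def)
  have 4: "((\<lambda>s. mutual (quantile (u + s)) (quantile (v - s))) has_real_derivative cauchy a b + cauchy (- b) (- a)) (at s)"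
    using mutual_deriv[OF da _ _ db] abc dp by (simp add: a_def b_def)
  have 5: "((\<lambda>s. mutual c (quantile (v - s))) has_real_derivative cauchy (- b) (- c)) (at s)"
    using mutual_deriv[OF DERIV_const _ _ db, of c] abc dp by (simp add: b_def)
  have 6: "((\<lambda>s. alt_mutual (quantile (u + s)) rest) has_real_derivative alt_cauchy a rest) (at s)"
    using alt_mutual_deriv[OF da, of rest] abc rest dp by (force simp: a_def)
  have 7: "((\<lambda>s. alt_mutual (quantile (v - s)) rest) has_real_derivative - alt_cauchy b rest) (at s)"
    using alt_mutual_deriv[OF db, of rest] abc rest dp by (force simp: b_def)
  have "((\<lambda>s. edge_perim (quantile (u + s)) - 4 * (mutual (quantile (u + s)) c - (mutual (quantile (u + s)) (quantile (v - s)) - alt_mutual (quantile (u + s)) rest))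
       + (edge_perim c - 4 * (mutual c (quantile (v - s)) - alt_mutual c rest)
       + (edge_perim (quantile (v - s)) - 4 * alt_mutual (quantile (v - s)) rest + perim rest))) has_real_derivative
     - 4 * a - 4 * (cauchy a c - (cauchy a b + cauchy (- b) (- a) - alt_cauchy a rest))
       + (0 - 4 * (cauchy (- b) (- c) - 0) + (4 * b - 4 * (- alt_cauchy b rest) + 0))) (at s)"
    by (intro DERIV_add DERIV_diff DERIV_cmult DERIV_const 1 2 3 4 5 6 7)
  then show ?thesis unfolding perim.simps alt_mutual.simps by (rule DERIV_cong) (simp add: algebra_simps)
qed

text \<open>This is the slope of \<open>swap_deriv\<close> without the factor 4 and without the
  points of \<open>rest\<close>. Its derivative consists of 2 / (b - a), of minus the two quotients
  of \<open>swap_second_order\<close>, which outweigh it, and of the negative terms -1 /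
  \<open>sc_dens a\<close> - 1 / \<open>sc_dens b\<close>.\<close>

lemma swap_slope_antimono:
  assumes st: "s \<le> t"
    and rng: "\<And>x. s \<le> x \<Longrightarrow> x \<le> t \<Longrightarrow> 0 < u + x \<and> u + x < 1 \<and> 0 < v - x \<and> v - x < 1
       \<and> quantile (u + x) < c \<and> c < quantile (v - x)"
  shows "(quantile (v - t) - quantile (u + t)) - (cauchy (quantile (u + t)) c - cauchy (quantile (u + t)) (quantile (v - t)))
           - (cauchy (- quantile (v - t)) (- c) - cauchy (- quantile (v - t)) (- quantile (u + t)))
      \<le> (quantile (v - s) - quantile (u + s)) - (cauchy (quantile (u + s)) c - cauchy (quantile (u + s)) (quantile (v - s)))
           - (cauchy (- quantile (v - s)) (- c) - cauchy (- quantile (v - s)) (- quantile (u + s)))"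
proof (rule DERIV_nonpos_imp_nonincreasing[OF st, where f =
   "\<lambda>x. (quantile (v - x) - quantile (u + x)) - (cauchy (quantile (u + x)) c - cauchy (quantile (u + x)) (quantile (v - x)))
           - (cauchy (- quantile (v - x)) (- c) - cauchy (- quantile (v - x)) (- quantile (u + x)))"])
  fix x assume x: "s \<le> x" "x \<le> t"
  define a where "a = quantile (u + x)"
  define b where "b = quantile (v - x)"
  have r: "0 < u + x" "u + x < 1" "0 < v - x" "v - x < 1" using rng[OF x] by auto
  have ab: "-1 < a" "a < c" "c < b" "b < 1" using rng[OF x] quantile_open by (auto simp: a_def b_def)
  have dp: "sc_dens a > 0" "sc_dens b > 0" using sc_dens_pos ab by auto
  have i: "((\<lambda>s. u + s) has_real_derivative 1) (at x)" "((\<lambda>s. v - s) has_real_derivative -1) (at x)"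
    by (auto intro!: derivative_eq_intros)
  have da: "((\<lambda>s. quantile (u + s)) has_real_derivative 1 / sc_dens a) (at x)" using quantile_deriv[OF i(1)] r by (simp add: a_def)
  have db: "((\<lambda>s. quantile (v - s)) has_real_derivative - 1 / sc_dens b) (at x)" using quantile_deriv[OF i(2)] r by (simp add: b_def)
  have db': "((\<lambda>s. - quantile (v - s)) has_real_derivative 1 / sc_dens b) (at x)" using DERIV_minus[OF db] by simp
  have da': "((\<lambda>s. - quantile (u + s)) has_real_derivative - 1 / sc_dens a) (at x)" using DERIV_minus[OF da] by simp
  have 1: "((\<lambda>x. cauchy (quantile (u + x)) c) has_real_derivative dcauchy a c / sc_dens a) (at x)"
    using cauchy_deriv[OF da _ _ DERIV_const, of c] ab by (simp add: a_def)
  have 2: "((\<lambda>x. cauchy (quantile (u + x)) (quantile (v - x))) has_real_derivative dcauchy a b / sc_dens a + 1 / (b - a)) (at x)"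
    using cauchy_deriv[OF da _ _ db] ab dp by (simp add: a_def b_def)
  have 3: "((\<lambda>x. cauchy (- quantile (v - x)) (- c)) has_real_derivative dcauchy (- b) (- c) / sc_dens b) (at x)"
    using cauchy_deriv[OF db' _ _ DERIV_const, of "- c"] ab by (simp add: b_def)
  have 4: "((\<lambda>x. cauchy (- quantile (v - x)) (- quantile (u + x))) has_real_derivative dcauchy (- b) (- a) / sc_dens b + 1 / (b - a)) (at x)"
    using cauchy_deriv[OF db' _ _ da'] ab dp by (simp add: a_def b_def)
  let ?D = "- 1 / sc_dens b - 1 / sc_dens a - (dcauchy a c / sc_dens a - (dcauchy a b / sc_dens a + 1 / (b - a)))
    - (dcauchy (- b) (- c) / sc_dens b - (dcauchy (- b) (- a) / sc_dens b + 1 / (b - a)))"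
  have "((\<lambda>x. (quantile (v - x) - quantile (u + x)) - (cauchy (quantile (u + x)) c - cauchy (quantile (u + x)) (quantile (v - x)))
           - (cauchy (- quantile (v - x)) (- c) - cauchy (- quantile (v - x)) (- quantile (u + x)))) has_real_derivative ?D) (at x)"
    by (intro DERIV_diff 1 2 3 4 da db)
  moreover have "?D \<le> 0"
  proof -
    have "2 / (b - a) \<le> (dcauchy a c - dcauchy a b) / sc_dens a + (dcauchy (- b) (- c) - dcauchy (- b) (- a)) / sc_dens b"
      by (rule swap_second_order[OF ab])
    moreover have "0 < 1 / sc_dens a" "0 < 1 / sc_dens b" using dp by auto
    moreover have "2 / (b - a) = 1 / (b - a) + 1 / (b - a)" by simp
    ultimately show ?thesis unfolding diff_divide_distrib minus_divide_left[symmetric] by linarith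
  qed
  ultimately show "\<exists>D. ((\<lambda>x. (quantile (v - x) - quantile (u + x)) - (cauchy (quantile (u + x)) c - cauchy (quantile (u + x)) (quantile (v - x)))
           - (cauchy (- quantile (v - x)) (- c) - cauchy (- quantile (v - x)) (- quantile (u + x)))) has_real_derivative D) (at x) \<and> D \<le> 0"
    by blast
qed

text \<open>The displacement s = 0 is the given configuration. At \<open>l\<close> the point a
  reaches -1 or b reaches the barrier \<open>p\<close>; at \<open>r\<close> one of them reaches c.
  As s grows, b moves left and a moves right, so by \<open>alt_ctr_mono\<close> the contribution of
  \<open>rest\<close> to the slope decreases too.\<close>

lemma swap_min_at_ends:
  assumes cfg: "config (a # c # b # rest)"
    and p: "b \<le> p" "p \<le> 1" "\<And>d. d \<in> set rest \<Longrightarrow> p \<le> d"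
  defines "l \<equiv> - min (sc_cdf a) (sc_cdf p - sc_cdf b)" and "r \<equiv> min (sc_cdf c - sc_cdf a) (sc_cdf b - sc_cdf c)"
  shows "\<exists>s\<in>{l, r}. perim (quantile (sc_cdf a + s) # c # quantile (sc_cdf b - s) # rest) \<le> perim (a # c # b # rest)"
proof -
  let ?u = "sc_cdf a" and ?v = "sc_cdf b"
  have o: "-1 \<le> a" "a \<le> c" "c \<le> b" "b \<le> 1" "\<And>d. d \<in> set rest \<Longrightarrow> b \<le> d \<and> d \<le> 1" "sorted rest"
    using cfg by (auto simp: config_def)
  have F: "0 \<le> sc_cdf a" "sc_cdf a \<le> sc_cdf c" "sc_cdf c \<le> sc_cdf b" "sc_cdf b \<le> sc_cdf p" "sc_cdf p \<le> 1"
    using o p sc_cdf_mono sc_cdf_range by auto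
  have ra: "-1 \<le> quantile (?u + s)" "quantile (?u + s) \<le> c" "c \<le> quantile (?v - s)" "quantile (?v - s) \<le> p" if "s \<in> {l..r}" for s
  proof -
    have *: "0 \<le> ?u + s" "?u + s \<le> sc_cdf c" "sc_cdf c \<le> ?v - s" "?v - s \<le> sc_cdf p"
      using that F by (auto simp: l_def r_def)
    have "quantile (?u + s) \<le> quantile (sc_cdf c)" "quantile (sc_cdf c) \<le> quantile (?v - s)" "quantile (?v - s) \<le> quantile (sc_cdf p)"
      using * F by (auto simp: quantile_le_iff)
    then show "-1 \<le> quantile (?u + s)" "quantile (?u + s) \<le> c" "c \<le> quantile (?v - s)" "quantile (?v - s) \<le> p"
      using quantile_range[of "?u + s"] * F o p by (auto simp: quantile_sc_cdf)
  qed
  have ri: "0 < ?u + s \<and> ?u + s < 1 \<and> 0 < ?v - s \<and> ?v - s < 1 \<and> -1 < quantile (?u + s) \<and> quantile (?u + s) < c \<and> c < quantile (?v - s) \<and> quantile (?v - s) < p"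
    if "l < s" "s < r" for s
  proof -
    have *: "0 < ?u + s" "?u + s < sc_cdf c" "sc_cdf c < ?v - s" "?v - s < sc_cdf p"
      using that F by (auto simp: l_def r_def)
    have "quantile 0 < quantile (?u + s)" "quantile (?u + s) < quantile (sc_cdf c)" "quantile (sc_cdf c) < quantile (?v - s)" "quantile (?v - s) < quantile (sc_cdf p)"
      by (subst quantile_less_iff; use * F in simp)+
    then show ?thesis using * F o p by (auto simp: quantile_sc_cdf)
  qed
  have "perim (quantile (?u + l) # c # quantile (?v - l) # rest) \<le> perim (quantile (?u + 0) # c # quantile (?v - 0) # rest)
     \<or> perim (quantile (?u + r) # c # quantile (?v - r) # rest) \<le> perim (quantile (?u + 0) # c # quantile (?v - 0) # rest)"
  proof (rule concave_min_at_ends[where M = "\<lambda>s. perim (quantile (?u + s) # c # quantile (?v - s) # rest)"])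
    fix s assume s: "l < s" "s < r"
    show "((\<lambda>s. perim (quantile (?u + s) # c # quantile (?v - s) # rest)) has_real_derivative
      4 * ((quantile (?v - s) - quantile (?u + s)) - (cauchy (quantile (?u + s)) c - cauchy (quantile (?u + s)) (quantile (?v - s)))
           - (cauchy (- quantile (?v - s)) (- c) - cauchy (- quantile (?v - s)) (- quantile (?u + s))))
     + 4 * (alt_cauchy (quantile (?v - s)) rest - alt_cauchy (quantile (?u + s)) rest)) (at s)"
      by (rule swap_deriv) (use ri[OF s] p o in \<open>auto intro: less_le_trans\<close>)
  next
    fix s t assume st: "l < s" "s < t" "t < r"
    have "alt_cauchy (quantile (?v - t)) rest \<le> alt_cauchy (quantile (?v - s)) rest"
      using ri[of s] ri[of t] st p o by (intro alt_ctr_mono) (auto simp: quantile_le_iff intro: less_le_trans)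
    moreover have "alt_cauchy (quantile (?u + s)) rest \<le> alt_cauchy (quantile (?u + t)) rest"
    proof (rule alt_ctr_mono)
      fix d assume "d \<in> set rest"
      then show "quantile (?u + t) < d \<and> d \<le> 1" using ri[of t] st p(3)[of d] o(5)[of d] by auto
    qed (use ri[of s] ri[of t] st o in \<open>auto simp: quantile_le_iff\<close>)
    moreover have "(quantile (?v - t) - quantile (?u + t)) - (cauchy (quantile (?u + t)) c - cauchy (quantile (?u + t)) (quantile (?v - t)))
           - (cauchy (- quantile (?v - t)) (- c) - cauchy (- quantile (?v - t)) (- quantile (?u + t)))
      \<le> (quantile (?v - s) - quantile (?u + s)) - (cauchy (quantile (?u + s)) c - cauchy (quantile (?u + s)) (quantile (?v - s)))
           - (cauchy (- quantile (?v - s)) (- c) - cauchy (- quantile (?v - s)) (- quantile (?u + s)))"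
      by (rule swap_slope_antimono) (use ri st in auto)
    ultimately show "4 * ((quantile (?v - t) - quantile (?u + t)) - (cauchy (quantile (?u + t)) c - cauchy (quantile (?u + t)) (quantile (?v - t)))
           - (cauchy (- quantile (?v - t)) (- c) - cauchy (- quantile (?v - t)) (- quantile (?u + t))))
     + 4 * (alt_cauchy (quantile (?v - t)) rest - alt_cauchy (quantile (?u + t)) rest)
     \<le> 4 * ((quantile (?v - s) - quantile (?u + s)) - (cauchy (quantile (?u + s)) c - cauchy (quantile (?u + s)) (quantile (?v - s)))
           - (cauchy (- quantile (?v - s)) (- c) - cauchy (- quantile (?v - s)) (- quantile (?u + s))))
     + 4 * (alt_cauchy (quantile (?v - s)) rest - alt_cauchy (quantile (?u + s)) rest)"
      by (intro add_mono mult_left_mono) auto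
  next
    have c: "continuous_on {l..r} (\<lambda>s. quantile (?u + s))" "continuous_on {l..r} (\<lambda>s. quantile (?v - s))"
    proof -
      have "(\<lambda>s. ?u + s) ` {l..r} \<subseteq> {0..1}" "(\<lambda>s. ?v - s) ` {l..r} \<subseteq> {0..1}"
        using F by (auto simp: l_def r_def)
      then show "continuous_on {l..r} (\<lambda>s. quantile (?u + s))" "continuous_on {l..r} (\<lambda>s. quantile (?v - s))"
        by (auto intro!: continuous_on_compose2[OF quantile_cont] continuous_intros)
    qed
    have k: "continuous_on {l..r} (\<lambda>s. alt_mutual (quantile (?u + s)) rest)" "continuous_on {l..r} (\<lambda>s. alt_mutual (quantile (?v - s)) rest)"
    proof -
      have "quantile (?u + s) \<le> d \<and> quantile (?v - s) \<le> d \<and> -1 \<le> quantile (?u + s) \<and> -1 \<le> quantile (?v - s) \<and> d \<le> 1"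
        if "s \<in> {l..r}" "d \<in> set rest" for s d
        using ra[OF that(1)] p(3)[OF that(2)] o(1,2) o(5)[OF that(2)] by linarith
      then show "continuous_on {l..r} (\<lambda>s. alt_mutual (quantile (?u + s)) rest)" "continuous_on {l..r} (\<lambda>s. alt_mutual (quantile (?v - s)) rest)"
        by (auto intro!: alt_mutual_cont c)
    qed
    have k2: "continuous_on {l..r} (\<lambda>s. mutual (quantile (?u + s)) c)" "continuous_on {l..r} (\<lambda>s. mutual c (quantile (?v - s)))"
      "continuous_on {l..r} (\<lambda>s. mutual (quantile (?u + s)) (quantile (?v - s)))"
    proof -
      have *: "-1 \<le> quantile (?u + s) \<and> quantile (?u + s) \<le> c \<and> c \<le> quantile (?v - s) \<and> quantile (?v - s) \<le> 1 \<and> quantile (?u + s) \<le> quantile (?v - s) \<and> -1 \<le> c \<and> c \<le> 1"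
        if "s \<in> {l..r}" for s
        using ra[OF that] p(1,2) o(1,2,3,4) by linarith
      show "continuous_on {l..r} (\<lambda>s. mutual (quantile (?u + s)) c)" "continuous_on {l..r} (\<lambda>s. mutual c (quantile (?v - s)))"
        "continuous_on {l..r} (\<lambda>s. mutual (quantile (?u + s)) (quantile (?v - s)))"
        by (rule mutual_cont_comp[OF c(1) continuous_on_const], use * in blast,
            rule mutual_cont_comp[OF continuous_on_const c(2)], use * in blast,
            rule mutual_cont_comp[OF c], use * in blast)
    qed
    have k3: "continuous_on {l..r} (\<lambda>s. edge_perim (quantile (?u + s)))" "continuous_on {l..r} (\<lambda>s. edge_perim (quantile (?v - s)))"
      by (rule continuous_on_compose2[OF edge_perim_cont[of UNIV] c(1)], simp, rule continuous_on_compose2[OF edge_perim_cont[of UNIV] c(2)], simp)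
    show "continuous_on {l..r} (\<lambda>s. perim (quantile (?u + s) # c # quantile (?v - s) # rest))"
      unfolding perim.simps alt_mutual.simps by (intro continuous_intros k k2 k3)
    show "l \<le> 0" "0 \<le> r" using F by (auto simp: l_def r_def)
  qed
  then show ?thesis using o by (auto simp: quantile_sc_cdf)
qed

lemma free_profile_reflect: "free_profile (1 - u) = free_profile u" if "0 \<le> u" "u \<le> 1"
  using that by (simp add: free_profile_eq quantile_minus edge_perim_def)

text \<open>The absolute value makes one statement serve both parities: a list of even length stands
  for a set whose complement has mass \<open>\<bar>alt_mass bs\<bar>\<close>, and complements have
  equal perimeter. The induction therefore may drop a single point as well as a colliding
  pair.\<close>

lemma isoperimetric:
  assumes "config bs"
  shows "free_profile \<bar>alt_mass bs\<bar> \<le> perim bs"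
  using assms
proof (induction bs rule: measure_induct_rule[of length])
  case (less bs)
  consider "bs = []" | b where "bs = [b]" | a b where "bs = [a, b]" | a c b rest where "bs = a # c # b # rest"
    by (cases bs rule: remdups_adj.cases; metis neq_Nil_conv)
  then show ?case
  proof cases
    case 1
    then show ?thesis by (simp add: free_profile_eq)
  next
    case 2
    then have "-1 \<le> b" "b \<le> 1" using less.prems by (auto simp: config_def)
    then show ?thesis using 2 sc_cdf_range[of b] by (simp add: free_profile_eq quantile_sc_cdf)
  next
    case 3
    then have "-1 \<le> a" "a \<le> b" "b \<le> 1" using less.prems by (auto simp: config_def)
    moreover from this have "\<bar>alt_mass bs\<bar> = sc_cdf b - sc_cdf a" using 3 sc_cdf_mono[of a b] by simp
    ultimately show ?thesis using perim_interval[of a b] unfolding 3 by simp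
  next
    case 4
    \<comment> \<open>The boundary point after b, or the right end 1 of the support; b must not be
      pushed past it.\<close>
    define p where "p = (case rest of [] \<Rightarrow> 1 | x # _ \<Rightarrow> x)"
    have o: "-1 \<le> a" "a \<le> c" "c \<le> b" "b \<le> 1" "\<And>d. d \<in> set rest \<Longrightarrow> b \<le> d \<and> d \<le> 1" "sorted rest"
      using less.prems 4 by (auto simp: config_def)
    have p: "b \<le> p" "p \<le> 1" "\<And>d. d \<in> set rest \<Longrightarrow> p \<le> d"
      using o by (auto simp: p_def split: list.splits)
    have F: "0 \<le> sc_cdf a" "sc_cdf a \<le> sc_cdf c" "sc_cdf c \<le> sc_cdf b" "sc_cdf b \<le> sc_cdf p" "sc_cdf p \<le> 1"
      using o p sc_cdf_mono sc_cdf_range by auto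
    define l where "l = - min (sc_cdf a) (sc_cdf p - sc_cdf b)"
    define r where "r = min (sc_cdf c - sc_cdf a) (sc_cdf b - sc_cdf c)"
    obtain s where s: "s \<in> {l, r}" and P: "perim (quantile (sc_cdf a + s) # c # quantile (sc_cdf b - s) # rest) \<le> perim bs"
      using swap_min_at_ends[of a c b rest p] less.prems p unfolding 4 l_def r_def by blast
    define a' where "a' = quantile (sc_cdf a + s)"
    define b' where "b' = quantile (sc_cdf b - s)"
    have u: "0 \<le> sc_cdf a + s" "sc_cdf a + s \<le> sc_cdf c" "sc_cdf c \<le> sc_cdf b - s" "sc_cdf b - s \<le> sc_cdf p"
      using s F by (auto simp: l_def r_def)
    have ca: "sc_cdf a' = sc_cdf a + s" "sc_cdf b' = sc_cdf b - s" unfolding a'_def b'_def using u F by (auto simp: sc_cdf_quantile)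
    have "quantile (sc_cdf a + s) \<le> quantile (sc_cdf c)" "quantile (sc_cdf c) \<le> quantile (sc_cdf b - s)" "quantile (sc_cdf b - s) \<le> quantile (sc_cdf p)"
      using u F by (auto simp: quantile_le_iff)
    then have ab: "-1 \<le> a'" "a' \<le> c" "c \<le> b'" "b' \<le> p"
      using quantile_range[of "sc_cdf a + s"] u F o p by (auto simp: a'_def b'_def quantile_sc_cdf)
    have rng: "d \<le> 1" "-1 \<le> d" "b' \<le> d" "c \<le> d" "a' \<le> d" if "d \<in> set rest" for d
      using o(5)[OF that] p(3)[OF that] ab o by auto
    have ab2: "b' \<le> 1" "c \<le> 1" "a' \<le> 1" "-1 \<le> c" "-1 \<le> b'" "a' \<le> b'" using ab o p by auto
    have mass: "alt_mass (a' # c # b' # rest) = alt_mass bs" using ca 4 by simp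
    have P': "perim (a' # c # b' # rest) \<le> perim bs" using P by (simp add: a'_def b'_def)
    have shorter: "free_profile \<bar>alt_mass bs\<bar> \<le> perim bs"
      if "config bs'" "length bs' < length bs" "perim bs' = perim (a' # c # b' # rest)"
        "\<bar>alt_mass bs'\<bar> = \<bar>alt_mass (a' # c # b' # rest)\<bar>" for bs'
      using less.IH[OF that(2,1)] P' mass that by simp
    consider (ac) "a' = c" | (cb) "b' = c" | (left) "a' = -1" | (right) "b' = p"
    proof -
      have "sc_cdf a + s = sc_cdf c \<or> sc_cdf b - s = sc_cdf c \<or> sc_cdf a + s = 0 \<or> sc_cdf b - s = sc_cdf p"
        using s by (auto simp: l_def r_def min_def split: if_splits)
      then show ?thesis using that o p quantile_sc_cdf[of c] quantile_sc_cdf[of p] unfolding a'_def b'_def by fastforce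
    qed
    then show ?thesis
    proof cases
      case ac
      have "config (b' # rest)" using o(6) ab ab2 rng unfolding config_def by auto
      then show ?thesis by (rule shorter) (use 4 in \<open>auto simp: ac mutual_diag\<close>)
    next
      case cb
      have "config (a' # rest)" using o(6) ab ab2 rng unfolding config_def by auto
      then show ?thesis by (rule shorter) (use 4 in \<open>auto simp: cb mutual_diag\<close>)
    next
      case left
      have "config (c # b' # rest)" using o(6) ab ab2 rng unfolding config_def by auto
      \<comment> \<open>A point at -1 has \<open>sc_cdf\<close> 0 and no interaction; dropping it
        only reverses the sign of \<open>alt_mass\<close>.\<close>
      then show ?thesis by (rule shorter) (use 4 in \<open>auto simp: left\<close>)
    next
      case right
      show ?thesis
      proof (cases rest)
        case Nil
        have b1: "b' = 1" using right Nil by (simp add: p_def)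
        \<comment> \<open>A last point at 1 has no interaction but \<open>sc_cdf\<close> 1, so
          dropping it replaces the mass u by 1 - u, and the symmetry of J is needed.\<close>
        have "config [a', c]" using ab ab2 unfolding config_def by auto
        then have "free_profile \<bar>alt_mass [a', c]\<bar> \<le> perim [a', c]"
          by (rule less.IH[rotated]) (use 4 in simp)
        also have "perim [a', c] = perim (a' # c # b' # rest)" using b1 Nil by simp
        also have "\<bar>alt_mass [a', c]\<bar> = 1 - (sc_cdf a' - sc_cdf c + 1)" using ca u by simp
        also have "free_profile \<dots> = free_profile (sc_cdf a' - sc_cdf c + 1)"
          by (rule free_profile_reflect) (use ca u F in auto)
        also have "sc_cdf a' - sc_cdf c + 1 = \<bar>alt_mass (a' # c # b' # rest)\<bar>" using b1 Nil ca u F by simp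
        finally show ?thesis using P' mass by simp
      next
        case (Cons x xs)
        have x: "b' = x" using right Cons by (simp add: p_def)
        have "config (a' # c # xs)" using o(6) ab ab2 rng Cons unfolding config_def by auto
        then show ?thesis by (rule shorter) (use 4 Cons in \<open>auto simp: x mutual_diag\<close>)
      qed
    qed
  qed
qed

section \<open>Concavity of the density as a function of mass\<close>

lemma sc_dens_quantile_deriv:
  assumes "0 < t" "t < 1"
  shows "((\<lambda>t. sc_dens (quantile t)) has_real_derivative - quantile t / (1 - quantile t * quantile t)) (at t)"
proof -
  have r: "-1 < quantile t" "quantile t < 1" using quantile_open assms by auto
  have p: "chord (quantile t) > 0" and sq: "chord (quantile t) * chord (quantile t) = 1 - quantile t * quantile t" using chord_pos chord_sq r by auto
  have "((\<lambda>t. sc_dens (quantile t)) has_real_derivative 2 / pi * (- quantile t / chord (quantile t) * (1 / sc_dens (quantile t)))) (at t)"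
    unfolding sc_dens_def
    by (rule DERIV_cmult[OF chord_deriv[OF quantile_deriv_at[OF assms, unfolded sc_dens_def] r]])
  moreover have "2 / pi * (- quantile t / chord (quantile t) * (1 / sc_dens (quantile t))) = - quantile t / (chord (quantile t) * chord (quantile t))"
    using p by (simp add: sc_dens_def)
  ultimately show ?thesis unfolding sq by simp
qed

text \<open>W = \<open>sc_dens\<close> after \<open>quantile\<close> equals -4 / J''. It is concave,
  since its slope -x / (1 - x^2) decreases in x, and it vanishes at 0 and 1. For q = d p + m this
  gives W q >= (q / p) W p left of p and W q >= ((1 - q) / (1 - p)) W p right of p, and both factors
  are at least d.\<close>

lemma sc_dens_quantile_ge_scaled:
  assumes p: "0 < p" "p < 1" and d: "0 \<le> d" "0 \<le> m" "m + d \<le> 1"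
  shows "d * sc_dens (quantile p) \<le> sc_dens (quantile (d * p + m))"
proof -
  define q where "q = d * p + m"
  have q: "d * p \<le> q" "d * (1 - p) \<le> 1 - q" using d by (auto simp: q_def algebra_simps)
  have "0 \<le> d * p" "0 \<le> d * (1 - p)" using p d by auto
  then have q01: "0 \<le> q" "q \<le> 1" using q by linarith+
  have W: "0 < sc_dens (quantile p)" using sc_dens_pos quantile_open p by auto
  have anti: "- quantile t / (1 - quantile t * quantile t) \<le> - quantile s / (1 - quantile s * quantile s)" if "0 < s" "s < t" "t < 1" for s t
  proof -
    have r: "-1 < quantile s" "quantile s < quantile t" "quantile t < 1" using that quantile_open[of s] quantile_open[of t] quantile_less_iff[of s t] by auto
    have "0 < (1 - quantile s) * (1 + quantile s)" "0 < (1 - quantile t) * (1 + quantile t)" using r by auto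
    then have n: "0 < 1 - quantile s * quantile s" "0 < 1 - quantile t * quantile t" by (auto simp: algebra_simps)
    have "\<bar>quantile s * quantile t\<bar> \<le> 1 * 1" unfolding abs_mult by (rule mult_mono) (use r in auto)
    then have "0 \<le> (quantile t - quantile s) * (1 + quantile s * quantile t)" using r by (intro mult_nonneg_nonneg) auto
    then have "quantile s * (1 - quantile t * quantile t) \<le> quantile t * (1 - quantile s * quantile s)" by (simp add: algebra_simps)
    then show ?thesis using n by (simp add: field_simps)
  qed
  have c: "continuous_on S (\<lambda>t. sc_dens (quantile t))" if "S \<subseteq> {0..1}" for S
    by (rule continuous_on_compose2[OF sc_dens_cont[of UNIV] continuous_on_subset[OF quantile_cont that]]) simp
  show ?thesis
  proof (cases "q \<le> p")
    case True
    let ?M = "\<lambda>t. sc_dens (quantile t) - t / p * sc_dens (quantile p)"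
    have "?M 0 \<le> ?M q \<or> ?M p \<le> ?M q"
    proof (rule concave_min_at_ends[where M = ?M and M' = "\<lambda>t. - quantile t / (1 - quantile t * quantile t) - 1 / p * sc_dens (quantile p)"])
      show "continuous_on {0..p} ?M" by (intro continuous_intros c) (use p in auto)
      show "(?M has_real_derivative - quantile t / (1 - quantile t * quantile t) - 1 / p * sc_dens (quantile p)) (at t)" if "0 < t" "t < p" for t
        by (intro DERIV_diff sc_dens_quantile_deriv DERIV_cmult_right DERIV_cdivide DERIV_ident) (use that p in auto)
    qed (use True q01 p anti in auto)
    then have "0 \<le> ?M q" using p by (auto simp: sc_dens_def)
    moreover have "d * sc_dens (quantile p) \<le> q / p * sc_dens (quantile p)" using q p W by (intro mult_right_mono) (auto simp: field_simps)
    ultimately show ?thesis by (simp add: q_def)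
  next
    case False
    let ?M = "\<lambda>t. sc_dens (quantile t) - (1 - t) / (1 - p) * sc_dens (quantile p)"
    have "?M p \<le> ?M q \<or> ?M 1 \<le> ?M q"
    proof (rule concave_min_at_ends[where M = ?M and M' = "\<lambda>t. - quantile t / (1 - quantile t * quantile t) - (0 - 1) / (1 - p) * sc_dens (quantile p)"])
      show "continuous_on {p..1} ?M" by (intro continuous_intros c) (use p in auto)
      show "(?M has_real_derivative - quantile t / (1 - quantile t * quantile t) - (0 - 1) / (1 - p) * sc_dens (quantile p)) (at t)" if "p < t" "t < 1" for t
        by (intro DERIV_diff sc_dens_quantile_deriv DERIV_cmult_right DERIV_cdivide DERIV_ident DERIV_const) (use that p in auto)
    qed (use False q01 p anti in auto)
    then have "0 \<le> ?M q" using p by (auto simp: sc_dens_def)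
    moreover have "d * sc_dens (quantile p) \<le> (1 - q) / (1 - p) * sc_dens (quantile p)" using q p W by (intro mult_right_mono) (auto simp: field_simps)
    ultimately show ?thesis by (simp add: q_def)
  qed
qed

section \<open>Decreasing step functions\<close>

text \<open>\<open>p\<close>, \<open>c\<close> and the list \<open>[(p\<^sub>1, c\<^sub>1), (p\<^sub>2, c\<^sub>2), \<dots>]\<close> describe the function with value \<open>c\<close> on \<open>[p, p\<^sub>1)\<close>,
  \<open>c\<^sub>1\<close> on \<open>[p\<^sub>1, p\<^sub>2)\<close>, and so on up to 1.\<close>

primrec step_mean :: "real \<Rightarrow> real \<Rightarrow> (real \<times> real) list \<Rightarrow> real" where
  "step_mean p c [] = (1 - p) * c"
| "step_mean p c (x # xs) = (fst x - p) * c + step_mean (fst x) (snd x) xs"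

text \<open>The product of jump height and \<open>free_profile (fst x)\<close> is the part of
  \<integral> J(\<open>m\<^sup>-\<^sup>1\<close>) coming from the levels inside the jump at that
  breakpoint. Levels below the last value would contribute J(1) = 0.\<close>

primrec step_profile :: "real \<Rightarrow> real \<Rightarrow> (real \<times> real) list \<Rightarrow> real" where
  "step_profile p c [] = (1 - p) * free_profile c"
| "step_profile p c (x # xs) = (fst x - p) * free_profile c + (c - snd x) * free_profile (fst x)
     + step_profile (fst x) (snd x) xs"

definition steps :: "real \<Rightarrow> real \<Rightarrow> (real \<times> real) list \<Rightarrow> bool" where
  "steps p c xs \<longleftrightarrow> 0 \<le> p \<and> c \<le> 1 \<and> sorted (p # map fst xs @ [1]) \<and> sorted (rev (c # map snd xs @ [0]))"

lemma steps_Nil: "steps p c [] \<longleftrightarrow> 0 \<le> p \<and> p \<le> 1 \<and> 0 \<le> c \<and> c \<le> 1"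
  by (auto simp: steps_def)

lemma steps_Cons: "steps p c ((q, e) # xs) \<longleftrightarrow> 0 \<le> p \<and> p \<le> q \<and> e \<le> c \<and> c \<le> 1 \<and> steps q e xs"
  by (fastforce simp: steps_def sorted_append)

lemma step_mean_shift: "step_mean p c xs = step_mean 0 c xs - p * c"
  by (cases xs) (auto simp: algebra_simps)

lemma step_profile_shift: "step_profile p c xs = step_profile 0 c xs - p * free_profile c"
  by (cases xs) (auto simp: algebra_simps)

lemma steps_start: "steps p c xs \<Longrightarrow> steps 0 c xs"
  by (cases xs) (auto simp: steps_Nil steps_Cons)

lemma step_mean_range: "steps p c xs \<Longrightarrow> 0 \<le> step_mean p c xs \<and> step_mean p c xs \<le> (1 - p) * c"
proof (induction xs arbitrary: p c)
  case Nil
  then show ?case by (simp add: steps_Nil)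
next
  case (Cons x xs)
  obtain q e where x: "x = (q, e)" by (cases x)
  have h: "0 \<le> p" "p \<le> q" "e \<le> c" "steps q e xs" using Cons.prems unfolding x by (auto simp: steps_Cons)
  have q: "q \<le> 1" "0 \<le> e" using h(4) by (cases xs; auto simp: steps_def)+
  have "step_mean q e xs \<le> (1 - q) * e" "0 \<le> step_mean q e xs" using Cons.IH[OF h(4)] by auto
  moreover have "(1 - q) * e \<le> (1 - q) * c" "0 \<le> (q - p) * c" using h q by (auto intro!: mult_left_mono)
  ultimately show ?case unfolding x by (auto simp: algebra_simps)
qed

text \<open>The right-hand side minus the left-hand side is concave in each breakpoint, so breakpoints may be
  moved until they merge or leave the unit interval.\<close>

lemma monotone_step_ineq:
  assumes "steps 0 c xs"
  shows "free_profile (step_mean 0 c xs) \<le> step_profile 0 c xs"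
  using assms
proof (induction xs arbitrary: c rule: measure_induct_rule[of length])
  case (less xs)
  show ?case
  proof (cases xs)
    case Nil
    then show ?thesis by simp
  next
    case (Cons x ys)
    obtain p1 c1 where x: "x = (p1, c1)" by (cases x)
    define p2 where "p2 = (case ys of [] \<Rightarrow> 1 | y # _ \<Rightarrow> fst y)"
    have h: "0 \<le> p1" "c1 \<le> c" "c \<le> 1" "steps p1 c1 ys" "steps 0 c1 ys"
      using less.prems unfolding Cons x by (auto simp: steps_Cons intro: steps_start)
    have p2: "p1 \<le> p2" "p2 \<le> 1" using h(4) by (auto simp: p2_def steps_def split: list.splits)
    define d where "d = c - c1"
    define mu where "mu = step_mean 0 c1 ys"
    have mu: "0 \<le> mu" "mu \<le> c1" using step_mean_range[OF h(5)] by (auto simp: mu_def)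
    have d: "0 \<le> d" "mu + d \<le> 1" using h mu by (auto simp: d_def)
    \<comment> \<open>The mean is affine in the first breakpoint p with slope d, so the dependence
      on p is an affine function plus d J(p) - J(d p + mu).\<close>
    let ?E = "\<lambda>p. p * free_profile c + d * edge_perim (quantile p) - p * free_profile c1 + step_profile 0 c1 ys - edge_perim (quantile (d * p + mu))"
    have rng: "0 \<le> d * p + mu \<and> d * p + mu \<le> 1" if "0 \<le> p" "p \<le> 1" for p
      using that d mu mult_left_mono[of p 1 d] by auto
    have E: "step_profile 0 c ((p, c1) # ys) - free_profile (step_mean 0 c ((p, c1) # ys)) = ?E p" if "0 \<le> p" "p \<le> 1" for p
    proof -
      have "step_mean 0 c ((p, c1) # ys) = d * p + mu"
        unfolding mu_def d_def using step_mean_shift[of p c1 ys] by (simp add: algebra_simps)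
      moreover have "step_profile 0 c ((p, c1) # ys)
         = p * free_profile c + d * free_profile p - p * free_profile c1 + step_profile 0 c1 ys"
        unfolding d_def using step_profile_shift[of p c1 ys] by simp
      ultimately show ?thesis using free_profile_eq[of p] free_profile_eq[of "d * p + mu"] rng that by simp
    qed
    have "?E 0 \<le> ?E p1 \<or> ?E p2 \<le> ?E p1"
    proof (cases "d = 0")
      case True
      then show ?thesis by (simp add: d_def)
    next
      case False
      then have d0: "0 < d" using d by simp
      have int: "0 < d * t + mu \<and> d * t + mu < 1" if "0 < t" "t < 1" for t
      proof -
        have "0 < d * t" "d * t < d * 1" using that d0 by (simp_all only: mult_pos_pos mult_less_cancel_left_pos)
        then show ?thesis using mu d by linarith
      qed
      show ?thesis
      proof (rule concave_min_at_ends[where M = ?E and M' = "\<lambda>p. free_profile c + d * (- 4 * quantile p) - free_profile c1 - (- 4 * d * quantile (d * p + mu))"])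
        have "continuous_on {0..p2} (\<lambda>p. quantile p)" "continuous_on {0..p2} (\<lambda>p. quantile (d * p + mu))"
          by (rule continuous_on_subset[OF quantile_cont], use p2 in force,
              rule continuous_on_compose2[OF quantile_cont], intro continuous_intros, use p2 rng in force)
        then have "continuous_on {0..p2} (\<lambda>p. edge_perim (quantile p))" "continuous_on {0..p2} (\<lambda>p. edge_perim (quantile (d * p + mu)))"
          by (auto intro: continuous_on_compose2[OF edge_perim_cont[of UNIV]])
        then show "continuous_on {0..p2} ?E" by (intro continuous_intros)
      next
        fix t assume t: "0 < t" "t < p2"
        then have t1: "t < 1" using p2 by simp
        have i: "((\<lambda>p. d * p + mu) has_real_derivative d) (at t)" by (auto intro!: derivative_eq_intros)
        have o: "-1 < quantile t" "quantile t < 1" "-1 < quantile (d * t + mu)" "quantile (d * t + mu) < 1" using quantile_open t t1 int by auto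
        have 1: "((\<lambda>p. edge_perim (quantile p)) has_real_derivative - 4 * quantile t) (at t)"
          using edge_perim_deriv[OF quantile_deriv_at[OF t(1) t1]] o sc_dens_pos[of "quantile t"] by simp
        have 2: "((\<lambda>p. edge_perim (quantile (d * p + mu))) has_real_derivative - 4 * d * quantile (d * t + mu)) (at t)"
          using edge_perim_deriv[OF quantile_deriv[OF i]] int[OF t(1) t1] o sc_dens_pos[of "quantile (d * t + mu)"] by (simp add: mult_ac)
        have 3: "((\<lambda>p. p * k) has_real_derivative k) (at t)" for k
          using DERIV_cmult_right[OF DERIV_ident, of k t UNIV] by simp
        have "(?E has_real_derivative free_profile c + d * (- 4 * quantile t) - free_profile c1 + 0 - (- 4 * d * quantile (d * t + mu))) (at t)"
          by (intro DERIV_add DERIV_diff DERIV_cmult DERIV_const 1 2 3)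
        then show "(?E has_real_derivative free_profile c + d * (- 4 * quantile t) - free_profile c1 - (- 4 * d * quantile (d * t + mu))) (at t)"
          by simp
      next
        fix s t assume st: "0 < s" "s < t" "t < p2"
        \<comment> \<open>Times 4 d this is the varying part of the slope of \<open>?E\<close>. With
          W the density at the quantile, its derivative is d / W(d p + mu) - 1 / W(p).\<close>
        have "quantile (d * t + mu) - quantile t \<le> quantile (d * s + mu) - quantile s"
        proof (rule DERIV_nonpos_imp_nonincreasing[where f = "\<lambda>p. quantile (d * p + mu) - quantile p"])
          fix p assume p: "s \<le> p" "p \<le> t"
          have p01: "0 < p" "p < 1" using p st p2 by auto
          have i: "((\<lambda>p. d * p + mu) has_real_derivative d) (at p)" by (auto intro!: derivative_eq_intros)
          have W: "0 < sc_dens (quantile p)" "0 < sc_dens (quantile (d * p + mu))"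
            using sc_dens_pos quantile_open p01 int by auto
          have "((\<lambda>p. quantile (d * p + mu) - quantile p) has_real_derivative d / sc_dens (quantile (d * p + mu)) - 1 / sc_dens (quantile p)) (at p)"
            by (intro DERIV_diff quantile_deriv[OF i] quantile_deriv_at) (use p01 int in auto)
          moreover have "d / sc_dens (quantile (d * p + mu)) \<le> 1 / sc_dens (quantile p)"
            using sc_dens_quantile_ge_scaled[OF p01 d(1) mu(1) d(2)] W by (simp add: field_simps)
          ultimately show "\<exists>D. ((\<lambda>p. quantile (d * p + mu) - quantile p) has_real_derivative D) (at p) \<and> D \<le> 0"
            by (intro exI[of _ "d / sc_dens (quantile (d * p + mu)) - 1 / sc_dens (quantile p)"]) simp
        qed (use st in auto)
        from mult_left_mono[OF this, of "4 * d"] d0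
        show "free_profile c + d * (- 4 * quantile t) - free_profile c1 - (- 4 * d * quantile (d * t + mu))
          \<le> free_profile c + d * (- 4 * quantile s) - free_profile c1 - (- 4 * d * quantile (d * s + mu))"
          by (simp add: algebra_simps)
      qed (use h p2 in auto)
    qed
    moreover have "0 \<le> ?E 0"
    proof -
      have "free_profile (step_mean 0 c1 ys) \<le> step_profile 0 c1 ys"
        by (rule less.IH) (use Cons h in auto)
      then show ?thesis using free_profile_eq[of mu] rng[of 0] by (simp add: mu_def)
    qed
    moreover have "0 \<le> ?E p2"
    proof (cases ys)
      case Nil
      \<comment> \<open>Here \<open>p2\<close> is 1: the function has become the constant c, and
        equality holds because J(1) = 0.\<close>
      then have "step_mean 0 c ((p2, c1) # ys) = c" "step_profile 0 c ((p2, c1) # ys) = free_profile c"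
        using free_profile_eq[of 1] by (auto simp: p2_def)
      then show ?thesis using E[of p2] h p2 by simp
    next
      case (Cons y zs)
      obtain c2 where y: "y = (p2, c2)" unfolding p2_def Cons by (cases y) auto
      \<comment> \<open>The value \<open>c1\<close> is now taken on an empty interval, so the jumps
        from c to c1 and from c1 to c2 merge into one.\<close>
      have "steps 0 c ((p2, c2) # zs)" using h(1-4) p2 unfolding Cons y by (auto simp: steps_Cons)
      then have "free_profile (step_mean 0 c ((p2, c2) # zs)) \<le> step_profile 0 c ((p2, c2) # zs)"
        by (intro less.IH) (use \<open>xs = x # ys\<close> Cons in auto)
      moreover have "step_mean 0 c ((p2, c1) # ys) = step_mean 0 c ((p2, c2) # zs)"
        "step_profile 0 c ((p2, c1) # ys) = step_profile 0 c ((p2, c2) # zs)"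
        unfolding Cons y by (auto simp: algebra_simps)
      ultimately show ?thesis using E[of p2] h p2 by simp
    qed
    ultimately have "0 \<le> ?E p1" by linarith
    then show ?thesis using E[of p1] h p2 unfolding Cons x by simp
  qed
qed

section \<open>Functions constant on cells of equal mass\<close>

text \<open>The interaction energy of the cells \<open>[x i, x (i + 1)]\<close> and \<open>[x j, x (j + 1)]\<close> of a partition; on the
  diagonal, where it is infinite, it is set to 0.\<close>

definition cell_energy :: "(nat \<Rightarrow> real) \<Rightarrow> nat \<Rightarrow> nat \<Rightarrow> real" where
  "cell_energy x i j = (if i = j then 0 else
     let k = min i j; l = max i j in
       mutual (x (Suc k)) (x l) - mutual (x k) (x l) - mutual (x (Suc k)) (x (Suc l)) + mutual (x k) (x (Suc l)))"

definition cell_perim :: "(nat \<Rightarrow> real) \<Rightarrow> nat \<Rightarrow> real" where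
  "cell_perim x i = edge_perim (x i) + edge_perim (x (Suc i)) - 4 * mutual (x i) (x (Suc i))"

lemma cell_energy_commute: "cell_energy x i j = cell_energy x j i"
  by (simp add: cell_energy_def min.commute max.commute eq_commute)

lemma cell_energy_less: "i < j \<Longrightarrow> cell_energy x i j =
   mutual (x (Suc i)) (x j) - mutual (x i) (x j) - mutual (x (Suc i)) (x (Suc j)) + mutual (x i) (x (Suc j))"
  by (simp add: cell_energy_def)

lemma cell_energy_self [simp]: "cell_energy x i i = 0"
  by (simp add: cell_energy_def)

text \<open>The sums over the cells to the left and to the right of cell i telescope. The terms at
  the outer ends vanish because a half-line ending at -1 or 1 has no interaction, and the diagonal
  terms are halves of \<open>edge_perim\<close>.\<close>

lemma cell_energy_row_sum:
  assumes "i < n" "x 0 = -1" "x n = 1"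
  shows "2 * (\<Sum>j<n. cell_energy x i j) = cell_perim x i"
proof -
  let ?h = "\<lambda>j. mutual (x j) (x i) - mutual (x j) (x (Suc i))"
  let ?g = "\<lambda>j. mutual (x i) (x j) - mutual (x (Suc i)) (x j)"
  have "{..<n} = {0..<i} \<union> {i} \<union> {Suc i..<n}" using assms(1) by auto
  then have "(\<Sum>j<n. cell_energy x i j) = (\<Sum>j\<in>{0..<i}. cell_energy x i j) + (\<Sum>j\<in>{Suc i..<n}. cell_energy x i j)"
    by (simp only:) (subst sum.union_disjoint, auto)+
  also have "(\<Sum>j\<in>{0..<i}. cell_energy x i j) = (\<Sum>j\<in>{0..<i}. ?h (Suc j) - ?h j)"
    by (intro sum.cong refl) (subst cell_energy_commute, auto simp: cell_energy_less)
  also have "\<dots> = ?h i - ?h 0" by (rule sum_Suc_diff') simp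
  also have "(\<Sum>j\<in>{Suc i..<n}. cell_energy x i j) = (\<Sum>j\<in>{Suc i..<n}. ?g (Suc j) - ?g j)"
    by (intro sum.cong refl) (auto simp: cell_energy_less)
  also have "\<dots> = ?g n - ?g (Suc i)" by (rule sum_Suc_diff') (use assms in simp)
  finally show ?thesis using assms(2,3) by (simp add: mutual_diag cell_perim_def)
qed

text \<open>Being of even length, this list stands for the complement of the chosen cells, whence
  the minus sign in \<open>alt_mass_cells\<close>. Adjacent cells produce a repeated point, which
  cancels.\<close>

definition cells :: "(nat \<Rightarrow> real) \<Rightarrow> nat list \<Rightarrow> real list" where
  "cells x is = concat (map (\<lambda>i. [x i, x (Suc i)]) is)"

lemma cells_simps [simp]: "cells x [] = []" "cells x (i # is) = x i # x (Suc i) # cells x is"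
  by (auto simp: cells_def)

lemma alt_mutual_cells:
  assumes "distinct is"
  shows "alt_mutual y (cells x is) = (\<Sum>j\<in>set is. mutual y (x j) - mutual y (x (Suc j)))"
  using assms by (induction "is") auto

lemma alt_mass_cells:
  assumes "distinct is"
  shows "alt_mass (cells x is) = - (\<Sum>j\<in>set is. sc_cdf (x (Suc j)) - sc_cdf (x j))"
  using assms by (induction "is") auto

text \<open>Each cell brings its own perimeter, and the interactions between two chosen cells,
  counted in both perimeters, must be taken out again.\<close>

lemma perim_cells:
  assumes "sorted is" "distinct is"
  shows "perim (cells x is) = (\<Sum>i\<in>set is. cell_perim x i) - 2 * (\<Sum>i\<in>set is. \<Sum>j\<in>set is. cell_energy x i j)"
  using assms
proof (induction "is")
  case (Cons i "is")
  let ?B = "set is"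
  have i: "i \<notin> ?B" "\<And>j. j \<in> ?B \<Longrightarrow> i < j" using Cons.prems by (auto simp: less_le)
  have "alt_mutual (x i) (cells x is) - alt_mutual (x (Suc i)) (cells x is) = - (\<Sum>j\<in>?B. cell_energy x i j)"
    using Cons.prems i(2) by (simp add: alt_mutual_cells sum_negf[symmetric] sum_subtractf[symmetric] cell_energy_less)
      (intro sum.cong, auto)
  then have "perim (cells x (i # is)) = cell_perim x i - 4 * (\<Sum>j\<in>?B. cell_energy x i j) + perim (cells x is)"
    by (simp add: cell_perim_def)
  moreover have "(\<Sum>k\<in>?B. cell_energy x k i) = (\<Sum>j\<in>?B. cell_energy x i j)"
    by (simp add: cell_energy_commute)
  ultimately show ?case using Cons i by (simp add: sum.distrib)
qed simp

lemma config_cells: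
  assumes x: "\<And>i j. i \<le> j \<Longrightarrow> j \<le> n \<Longrightarrow> x i \<le> x j" "x 0 = -1" "x n = 1"
    and "sorted is" "distinct is" "set is \<subseteq> {..<n}"
  shows "config (cells x is)"
proof -
  have r: "-1 \<le> x i \<and> x i \<le> 1" if "i \<le> n" for i using x(1)[of 0 i] x(1)[of i n] x(2,3) that by auto
  have mem: "y \<in> set (cells x is) \<Longrightarrow> \<exists>j\<in>set is. y = x j \<or> y = x (Suc j)" for "is" y
    by (auto simp: cells_def)
  have "sorted (cells x is)"
    using assms(4-6)
  proof (induction "is")
    case (Cons i "is")
    have "x i \<le> y \<and> x (Suc i) \<le> y" if y: "y \<in> set (cells x is)" for y
    proof -
      obtain j where j: "j \<in> set is" "y = x j \<or> y = x (Suc j)" using mem[OF y] by auto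
      have "i < j" "j < n" using Cons.prems j(1) by (auto simp: less_le)
      then show ?thesis using j(2) x(1)[of i j] x(1)[of i "Suc j"] x(1)[of "Suc i" j] x(1)[of "Suc i" "Suc j"] by auto
    qed
    then show ?case using Cons x(1)[of i "Suc i"] by auto
  qed simp
  moreover have "set (cells x is) \<subseteq> {-1..1}"
  proof
    fix y assume "y \<in> set (cells x is)"
    then obtain j where "j \<in> set is" "y = x j \<or> y = x (Suc j)" using mem by blast
    then show "y \<in> {-1..1}" using r[of j] r[of "Suc j"] assms(6) by auto
  qed
  ultimately show ?thesis by (simp add: config_def)
qed

lemma discrete_isoperimetric:
  assumes x: "\<And>i j. i \<le> j \<Longrightarrow> j \<le> n \<Longrightarrow> x i \<le> x j" "x 0 = -1" "x n = 1"
    and A: "A \<subseteq> {..<n}"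
  shows "free_profile (\<Sum>i\<in>A. sc_cdf (x (Suc i)) - sc_cdf (x i)) \<le> 2 * (\<Sum>i\<in>A. \<Sum>j\<in>{..<n} - A. cell_energy x i j)"
proof -
  define "is" where "is = sorted_list_of_set A"
  have fin: "finite A" using A finite_subset by blast
  then have l: "sorted is" "distinct is" "set is = A" by (auto simp: is_def)
  have r: "-1 \<le> x i \<and> x i \<le> 1" if "i \<le> n" for i using x(1)[of 0 i] x(1)[of i n] x(2,3) that by auto
  have nonneg: "0 \<le> (\<Sum>i\<in>A. sc_cdf (x (Suc i)) - sc_cdf (x i))"
    by (intro sum_nonneg) (use A r x(1) in \<open>auto intro!: sc_cdf_mono simp: subset_eq\<close>)
  have "free_profile \<bar>alt_mass (cells x is)\<bar> \<le> perim (cells x is)"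
    by (rule isoperimetric[OF config_cells[of n]]) (use x l A in auto)
  also have "perim (cells x is) = 2 * (\<Sum>i\<in>A. \<Sum>j\<in>{..<n} - A. cell_energy x i j)"
  proof -
    have "perim (cells x is) = (\<Sum>i\<in>A. cell_perim x i) - 2 * (\<Sum>i\<in>A. \<Sum>j\<in>A. cell_energy x i j)"
      using perim_cells[OF l(1,2), of x] unfolding l(3) .
    also have "(\<Sum>i\<in>A. cell_perim x i) = (\<Sum>i\<in>A. 2 * (\<Sum>j<n. cell_energy x i j))"
      by (intro sum.cong refl cell_energy_row_sum[symmetric]) (use x A in auto)
    also have "(\<Sum>i\<in>A. 2 * (\<Sum>j<n. cell_energy x i j)) - 2 * (\<Sum>i\<in>A. \<Sum>j\<in>A. cell_energy x i j)
        = 2 * (\<Sum>i\<in>A. (\<Sum>j<n. cell_energy x i j) - (\<Sum>j\<in>A. cell_energy x i j))"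
      by (simp only: sum_subtractf sum_distrib_left[symmetric] right_diff_distrib)
    also have "\<dots> = 2 * (\<Sum>i\<in>A. \<Sum>j\<in>{..<n} - A. cell_energy x i j)"
      by (intro arg_cong2[of _ _ _ _ "(*)"] refl sum.cong sum_diff[symmetric]) (use A in auto)
    finally show ?thesis .
  qed
  finally show ?thesis using nonneg alt_mass_cells[OF l(2), of x] l(3) by simp
qed

section \<open>Layer-cake decomposition over the cells\<close>

lemma sorting_permutation:
  fixes f :: "nat \<Rightarrow> real"
  obtains q where "bij_betw q {..<n} {..<n}" "\<And>a b. a \<le> b \<Longrightarrow> b < n \<Longrightarrow> f (q b) \<le> f (q a)"
proof -
  define xs where "xs = sort_key (\<lambda>i. - f i) [0..<n]"
  have "distinct xs" unfolding xs_def by (simp only: distinct_sort distinct_upt)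
  moreover have "set xs = {..<n}" unfolding xs_def by (simp add: atLeast0LessThan)
  moreover have len: "length xs = n" unfolding xs_def by simp
  ultimately have "bij_betw ((!) xs) {..<n} {..<n}"
    using bij_betw_nth[of xs "{..<n}" "{..<n}"] by blast
  moreover have "sorted (map (\<lambda>i. - f i) xs)" unfolding xs_def by (rule sorted_sort_key)
  then have "f (xs ! b) \<le> f (xs ! a)" if "a \<le> b" "b < n" for a b
    using sorted_nth_mono[of "map (\<lambda>i. - f i) xs" a b] that len by simp
  ultimately show thesis using that[of "(!) xs"] by blast
qed

text \<open>The difference telescopes over the levels k with exactly one of a and b below k. For
  decreasing \<open>g\<close> the set of indices below k is a superlevel set, so this is the
  layer-cake formula for one pair.\<close>

lemma discrete_coarea:
  fixes g :: "nat \<Rightarrow> real"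
  assumes anti: "\<And>a b. a \<le> b \<Longrightarrow> b < n \<Longrightarrow> g b \<le> g a" and ab: "a < n" "b < n"
  shows "\<bar>g a - g b\<bar> = (\<Sum>k\<in>{1..<n}. (g (k - 1) - g k) * of_bool ((a < k) \<noteq> (b < k)))"
proof -
  have *: "g a - g b = (\<Sum>k\<in>{1..<n}. (g (k - 1) - g k) * of_bool ((a < k) \<noteq> (b < k)))" if "a \<le> b" "b < n" for a b
  proof -
    have "(\<Sum>k\<in>{1..<n}. (g (k - 1) - g k) * of_bool ((a < k) \<noteq> (b < k))) = (\<Sum>k\<in>{Suc a..<Suc b}. g (k - 1) - g k)"
      by (rule sum.mono_neutral_cong_right) (use that in auto)
    also have "\<dots> = (\<Sum>k\<in>{a..<b}. - g (Suc k) - - g k)"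
      by (subst sum.shift_bounds_Suc_ivl) simp
    also have "\<dots> = g a - g b" by (subst sum_Suc_diff') (use that in auto)
    finally show ?thesis by simp
  qed
  show ?thesis
  proof (cases "a \<le> b")
    case True
    then show ?thesis using *[of a b] anti[of a b] ab by simp
  next
    case False
    then show ?thesis using *[of b a] anti[of b a] ab by (simp add: eq_commute)
  qed
qed

text \<open>The tail of the step function with value \<open>g j\<close> on [j / n, (j + 1) / n),
  read from cell k on. The start is left free so that induction on n - k can follow the recursion;
  the application is to k = 0.\<close>

lemma step_sums:
  assumes "k < n" and g: "\<And>a b. a \<le> b \<Longrightarrow> b < n \<Longrightarrow> g b \<le> g a" "\<And>a. a < n \<Longrightarrow> 0 \<le> g a \<and> g a \<le> 1"
  defines "xs \<equiv> \<lambda>k. map (\<lambda>j. (real j / real n, g j)) [k..<n]"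
  shows "step_mean (k / n) (g k) (xs (Suc k)) = (\<Sum>j\<in>{k..<n}. g j) / n"
    and "step_profile (k / n) (g k) (xs (Suc k)) =
      (\<Sum>j\<in>{Suc k..<n}. (g (j - 1) - g j) * free_profile (j / n)) + (\<Sum>j\<in>{k..<n}. free_profile (g j)) / n"
    and "steps (k / n) (g k) (xs (Suc k))"
proof -
  have n: "0 < n" using assms by simp
  have "step_mean (k / n) (g k) (xs (Suc k)) = (\<Sum>j\<in>{k..<n}. g j) / n \<and>
     step_profile (k / n) (g k) (xs (Suc k)) =
      (\<Sum>j\<in>{Suc k..<n}. (g (j - 1) - g j) * free_profile (j / n)) + (\<Sum>j\<in>{k..<n}. free_profile (g j)) / n \<and>
     steps (k / n) (g k) (xs (Suc k))"
    using \<open>k < n\<close>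
  proof (induction "n - k" arbitrary: k)
    case (Suc d)
    show ?case
    proof (cases "Suc k < n")
      case True
      have xs: "xs (Suc k) = ((Suc k) / n, g (Suc k)) # xs (Suc (Suc k))"
        unfolding xs_def using True by (simp add: upt_conv_Cons)
      have s: "sum h {k..<n} = h k + sum h {Suc k..<n}" "sum h {Suc k..<n} = h (Suc k) + sum h {Suc (Suc k)..<n}" for h :: "nat \<Rightarrow> real"
        using True by (auto simp: sum.atLeast_Suc_lessThan)
      have w: "real (Suc k) / n - k / n = 1 / n" using n by (simp add: diff_divide_distrib[symmetric])
      have IH: "step_mean (Suc k / n) (g (Suc k)) (xs (Suc (Suc k))) = (\<Sum>j\<in>{Suc k..<n}. g j) / n"
        "step_profile (Suc k / n) (g (Suc k)) (xs (Suc (Suc k))) =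
          (\<Sum>j\<in>{Suc (Suc k)..<n}. (g (j - 1) - g j) * free_profile (j / n)) + (\<Sum>j\<in>{Suc k..<n}. free_profile (g j)) / n"
        "steps (Suc k / n) (g (Suc k)) (xs (Suc (Suc k)))"
        using Suc(1)[of "Suc k"] Suc(2) True by auto
      show ?thesis unfolding xs step_mean.simps step_profile.simps fst_conv snd_conv IH w s(1)[of g] s(1)[of "\<lambda>j. free_profile (g j)"]
          s(2)[of "\<lambda>j. (g (j - 1) - g j) * free_profile (j / n)"]
        using IH(3) g(1)[of k "Suc k"] g(2)[of k] True n
        by (auto simp: steps_Cons add_divide_distrib divide_right_mono)
    next
      case False
      then have "n = Suc k" using Suc by simp
      then show ?thesis using g(2)[of k] by (auto simp: xs_def steps_Nil field_simps)
    qed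
  qed simp
  then show "step_mean (k / n) (g k) (xs (Suc k)) = (\<Sum>j\<in>{k..<n}. g j) / n"
    and "step_profile (k / n) (g k) (xs (Suc k)) =
      (\<Sum>j\<in>{Suc k..<n}. (g (j - 1) - g j) * free_profile (j / n)) + (\<Sum>j\<in>{k..<n}. free_profile (g j)) / n"
    and "steps (k / n) (g k) (xs (Suc k))" by auto
qed

lemma discrete_inequality:
  fixes f :: "nat \<Rightarrow> real"
  assumes n: "0 < n" and f: "\<And>i. i < n \<Longrightarrow> 0 \<le> f i \<and> f i \<le> 1"
  shows "free_profile ((\<Sum>i<n. f i) / n)
     \<le> (\<Sum>i<n. free_profile (f i)) / n + (\<Sum>i<n. \<Sum>j<n. \<bar>f i - f j\<bar> * cell_energy (\<lambda>i. quantile (i / n)) i j)"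
proof -
  let ?K = "cell_energy (\<lambda>i. quantile (real i / real n))"
  obtain q where q: "bij_betw q {..<n} {..<n}" and anti: "\<And>a b. a \<le> b \<Longrightarrow> b < n \<Longrightarrow> f (q b) \<le> f (q a)"
    using sorting_permutation[of n f] by blast
  define g where "g k = f (q k)" for k
  have qn: "q a < n" if "a < n" for a using q that by (auto simp: bij_betw_def)
  have g: "\<And>a b. a \<le> b \<Longrightarrow> b < n \<Longrightarrow> g b \<le> g a" "\<And>a. a < n \<Longrightarrow> 0 \<le> g a \<and> g a \<le> 1"
    using anti f qn by (auto simp: g_def)
  have reindex: "(\<Sum>i<n. h i) = (\<Sum>a<n. h (q a))" for h :: "nat \<Rightarrow> real"
    using sum.reindex_bij_betw[OF q, of h] by simp
  have reindex2: "(\<Sum>i<n. \<Sum>j<n. h i j) = (\<Sum>a<n. \<Sum>b<n. h (q a) (q b))" for h :: "nat \<Rightarrow> nat \<Rightarrow> real"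
  proof -
    have "(\<Sum>i<n. \<Sum>j<n. h i j) = (\<Sum>a<n. \<Sum>j<n. h (q a) j)" by (rule reindex)
    also have "\<dots> = (\<Sum>a<n. \<Sum>b<n. h (q a) (q b))" by (intro sum.cong refl reindex)
    finally show ?thesis .
  qed
  \<comment> \<open>\<open>q\<close> lists the cells by decreasing value, so the first k of them
    form a superlevel set of mass k / n.\<close>
  have iso: "free_profile (k / n) \<le> (\<Sum>a<n. \<Sum>b<n. of_bool ((a < k) \<noteq> (b < k)) * ?K (q a) (q b))" if k: "k < n" for k
  proof -
    define A where "A = q ` {..<k}"
    have inj: "inj_on q {..<n}" using q by (simp add: bij_betw_def)
    have A: "A \<subseteq> {..<n}" using qn k by (auto simp: A_def)
    have inA: "q a \<in> A \<longleftrightarrow> a < k" if "a < n" for a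
      using inj_on_image_mem_iff[OF inj, of a "{..<k}"] that k by (auto simp: A_def)
    have "card A = k" unfolding A_def using inj k by (subst card_image) (auto intro: inj_on_subset)
    have step: "sc_cdf (quantile (real (Suc i) / n)) - sc_cdf (quantile (real i / n)) = 1 / n" if "i < n" for i
      using that n by (subst (1 2) sc_cdf_quantile) (auto simp: field_simps)
    have "(\<Sum>i\<in>A. sc_cdf (quantile (real (Suc i) / n)) - sc_cdf (quantile (real i / n))) = (\<Sum>i\<in>A. 1 / n)"
      by (intro sum.cong refl step) (use A in auto)
    also have "\<dots> = k / n" using \<open>card A = k\<close> by simp
    finally have "free_profile (k / n) \<le> 2 * (\<Sum>i\<in>A. \<Sum>j\<in>{..<n} - A. ?K i j)"
      using discrete_isoperimetric[of n "\<lambda>i. quantile (real i / real n)" A] A n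
      by (simp add: quantile_le_iff divide_right_mono)
    also have "(\<Sum>i\<in>A. \<Sum>j\<in>{..<n} - A. ?K i j) = (\<Sum>i<n. \<Sum>j<n. of_bool (i \<in> A \<and> j \<notin> A) * ?K i j)"
    proof -
      have "(\<Sum>i\<in>A. \<Sum>j\<in>{..<n} - A. ?K i j) = (\<Sum>i\<in>A. \<Sum>j<n. of_bool (i \<in> A \<and> j \<notin> A) * ?K i j)"
        by (intro sum.cong refl sum.mono_neutral_cong_left) auto
      also have "\<dots> = (\<Sum>i<n. \<Sum>j<n. of_bool (i \<in> A \<and> j \<notin> A) * ?K i j)"
        by (rule sum.mono_neutral_cong_left) (use A in auto)
      finally show ?thesis .
    qed
    \<comment> \<open>The factor 2 is spent on counting every separated pair in both orders, as the
      double sum does.\<close>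
    also have "2 * \<dots> = (\<Sum>i<n. \<Sum>j<n. of_bool (i \<in> A \<and> j \<notin> A) * ?K i j) + (\<Sum>i<n. \<Sum>j<n. of_bool (j \<in> A \<and> i \<notin> A) * ?K i j)"
    proof -
      have "(\<Sum>i<n. \<Sum>j<n. of_bool (i \<in> A \<and> j \<notin> A) * ?K i j) = (\<Sum>j<n. \<Sum>i<n. of_bool (i \<in> A \<and> j \<notin> A) * ?K i j)"
        by (rule sum.swap)
      also have "\<dots> = (\<Sum>j<n. \<Sum>i<n. of_bool (i \<in> A \<and> j \<notin> A) * ?K j i)"
        by (intro sum.cong refl arg_cong2[of _ _ _ _ "(*)"] cell_energy_commute)
      finally show ?thesis by simp
    qed
    also have "\<dots> = (\<Sum>i<n. \<Sum>j<n. of_bool ((i \<in> A) \<noteq> (j \<in> A)) * ?K i j)"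
      unfolding sum.distrib[symmetric] by (intro sum.cong refl) auto
    also have "\<dots> = (\<Sum>a<n. \<Sum>b<n. of_bool ((q a \<in> A) \<noteq> (q b \<in> A)) * ?K (q a) (q b))"
      by (rule reindex2)
    also have "\<dots> = (\<Sum>a<n. \<Sum>b<n. of_bool ((a < k) \<noteq> (b < k)) * ?K (q a) (q b))"
      by (intro sum.cong refl) (auto simp: inA)
    finally show ?thesis .
  qed
  have "(\<Sum>i<n. \<Sum>j<n. \<bar>f i - f j\<bar> * ?K i j) = (\<Sum>a<n. \<Sum>b<n. \<bar>g a - g b\<bar> * ?K (q a) (q b))"
    unfolding g_def by (rule reindex2)
  also have "\<dots> = (\<Sum>a<n. \<Sum>b<n. \<Sum>k\<in>{1..<n}. (g (k - 1) - g k) * (of_bool ((a < k) \<noteq> (b < k)) * ?K (q a) (q b)))"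
  proof (intro sum.cong refl)
    fix a b assume "a \<in> {..<n}" "b \<in> {..<n}"
    then have "\<bar>g a - g b\<bar> = (\<Sum>k\<in>{1..<n}. (g (k - 1) - g k) * of_bool ((a < k) \<noteq> (b < k)))"
      by (intro discrete_coarea g(1)) auto
    then show "\<bar>g a - g b\<bar> * ?K (q a) (q b)
        = (\<Sum>k\<in>{1..<n}. (g (k - 1) - g k) * (of_bool ((a < k) \<noteq> (b < k)) * ?K (q a) (q b)))"
      by (simp only: sum_distrib_right mult.assoc)
  qed
  also have "\<dots> = (\<Sum>a<n. \<Sum>k\<in>{1..<n}. \<Sum>b<n. (g (k - 1) - g k) * (of_bool ((a < k) \<noteq> (b < k)) * ?K (q a) (q b)))"
    by (intro sum.cong refl sum.swap)
  also have "\<dots> = (\<Sum>k\<in>{1..<n}. \<Sum>a<n. \<Sum>b<n. (g (k - 1) - g k) * (of_bool ((a < k) \<noteq> (b < k)) * ?K (q a) (q b)))"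
    by (rule sum.swap)
  also have "\<dots> = (\<Sum>k\<in>{1..<n}. (g (k - 1) - g k) * (\<Sum>a<n. \<Sum>b<n. of_bool ((a < k) \<noteq> (b < k)) * ?K (q a) (q b)))"
    by (simp only: sum_distrib_left)
  also have "\<dots> \<ge> (\<Sum>k\<in>{1..<n}. (g (k - 1) - g k) * free_profile (k / n))"
    by (intro sum_mono mult_left_mono iso) (auto intro!: g)
  finally have R: "(\<Sum>k\<in>{1..<n}. (g (k - 1) - g k) * free_profile (k / n)) \<le> (\<Sum>i<n. \<Sum>j<n. \<bar>f i - f j\<bar> * ?K i j)" .
  note S = step_sums[of 0 n g, OF n g]
  have "free_profile ((\<Sum>j\<in>{0..<n}. g j) / n) \<le>
     (\<Sum>j\<in>{Suc 0..<n}. (g (j - 1) - g j) * free_profile (j / n)) + (\<Sum>j\<in>{0..<n}. free_profile (g j)) / n"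
    using monotone_step_ineq[of "g 0" "map (\<lambda>j. (real j / real n, g j)) [Suc 0..<n]"] S by simp
  then show ?thesis using R reindex[of f] reindex[of "\<lambda>i. free_profile (f i)"]
    by (simp add: g_def atLeast0LessThan)
qed

section \<open>Passage to the limit\<close>

lemma cauchy_has_integral:
  assumes "-1 < x" "x < r" "r \<le> t" "t \<le> 1"
  shows "((\<lambda>y. sc_dens y / \<bar>x - y\<bar>) has_integral (cauchy x r - cauchy x t)) {r..t}"
proof -
  have "((\<lambda>y. sc_dens y / (y - x)) has_integral (- cauchy x t - - cauchy x r)) {r..t}"
  proof (rule fundamental_theorem_of_calculus_interior)
    show "continuous_on {r..t} (\<lambda>y. - cauchy x y)" by (intro continuous_on_minus cauchy_cont assms)
    fix y assume y: "y \<in> {r<..<t}"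
    have i: "((\<lambda>y. y) has_real_derivative 1) (at y)" by simp
    have "((\<lambda>y. cauchy x y) has_real_derivative - sc_dens y / (y - x)) (at y)"
      using cauchy_deriv[OF DERIV_const _ _ i, of x] y assms by simp
    from DERIV_minus[OF this] show "((\<lambda>y. - cauchy x y) has_vector_derivative sc_dens y / (y - x)) (at y)"
      by (simp add: has_real_derivative_iff_has_vector_derivative)
  qed (use assms in auto)
  then show ?thesis
    by (rule has_integral_eq[rotated, THEN has_integral_eq_rhs]) (use assms in auto)
qed

lemma reflected_has_integral:
  fixes h :: "real \<Rightarrow> real"
  assumes "((\<lambda>y. h (- y)) has_integral I) {- b..- a}"
  shows "(h has_integral I) {a..b}"
  using has_integral_reflect_real[of "\<lambda>y. h (- y)" I "-a" "-b"] assms by simp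

lemma cauchy_has_integral_left:
  assumes "-1 \<le> p" "p \<le> q" "q < x" "x < 1"
  shows "((\<lambda>y. sc_dens y / \<bar>x - y\<bar>) has_integral (cauchy (- x) (- q) - cauchy (- x) (- p))) {p..q}"
proof (rule reflected_has_integral)
  have "((\<lambda>y. sc_dens y / \<bar>- x - y\<bar>) has_integral (cauchy (- x) (- q) - cauchy (- x) (- p))) {- q..- p}"
    by (rule cauchy_has_integral) (use assms in auto)
  moreover have "\<bar>- x - y\<bar> = \<bar>x - - y\<bar>" for y by (simp add: abs_minus_commute)
  ultimately show "((\<lambda>y. sc_dens (- y) / \<bar>x - - y\<bar>) has_integral (cauchy (- x) (- q) - cauchy (- x) (- p))) {- q..- p}"
    by simp
qed

text \<open>The intervals may touch at q = r, where the integrand can be singular at the end point.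
  Continuity of \<open>mutual\<close> up to the diagonal lets the interior form of the fundamental
  theorem cover this case.\<close>

lemma mutual_has_integral:
  assumes "-1 \<le> p" "p \<le> q" "q \<le> r" "r \<le> t" "t \<le> 1"
  shows "((\<lambda>x. sc_dens x * (cauchy x r - cauchy x t)) has_integral (mutual q r - mutual p r - mutual q t + mutual p t)) {p..q}"
proof -
  have "((\<lambda>x. sc_dens x * (cauchy x r - cauchy x t)) has_integral ((mutual q r - mutual q t) - (mutual p r - mutual p t))) {p..q}"
  proof (rule fundamental_theorem_of_calculus_interior)
    show "continuous_on {p..q} (\<lambda>x. mutual x r - mutual x t)"
      by (intro continuous_on_diff mutual_cont_comp continuous_on_id continuous_on_const) (use assms in auto)
    fix x assume x: "x \<in> {p<..<q}"
    have i: "((\<lambda>y. y) has_real_derivative 1) (at x)" by simp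
    have "((\<lambda>x. mutual x r - mutual x t) has_real_derivative sc_dens x * cauchy x r * 1 - sc_dens x * cauchy x t * 1) (at x)"
      by (rule DERIV_diff[OF mutual_deriv_left[OF i] mutual_deriv_left[OF i]]) (use x assms in auto)
    then show "((\<lambda>x. mutual x r - mutual x t) has_vector_derivative sc_dens x * (cauchy x r - cauchy x t)) (at x)"
      by (simp add: has_real_derivative_iff_has_vector_derivative right_diff_distrib)
  qed (use assms in auto)
  then show ?thesis by (simp add: algebra_simps)
qed

lemma mutual_has_integral_left:
  assumes "-1 \<le> p" "p \<le> q" "q \<le> r" "r \<le> t" "t \<le> 1"
  shows "((\<lambda>x. sc_dens x * (cauchy (- x) (- q) - cauchy (- x) (- p))) has_integral
     (mutual q r - mutual p r - mutual q t + mutual p t)) {r..t}"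
proof (rule reflected_has_integral)
  have "((\<lambda>x. sc_dens x * (cauchy x (- q) - cauchy x (- p))) has_integral
    (mutual (- r) (- q) - mutual (- t) (- q) - mutual (- r) (- p) + mutual (- t) (- p))) {- t..- r}"
    by (rule mutual_has_integral) (use assms in auto)
  then show "((\<lambda>x. sc_dens (- x) * (cauchy (- (- x)) (- q) - cauchy (- (- x)) (- p))) has_integral
     (mutual q r - mutual p r - mutual q t + mutual p t)) {- t..- r}"
    using assms by (simp add: mutual_reflect algebra_simps)
qed

lemma integral_cells:
  fixes h :: "real \<Rightarrow> real"
  assumes x: "\<And>i j. i \<le> j \<Longrightarrow> j \<le> n \<Longrightarrow> x i \<le> x j" and h: "h integrable_on {x 0..x n}"
  shows "integral {x 0..x n} h = (\<Sum>i<n. integral {x i..x (Suc i)} h)"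
proof -
  have "integral {x 0..x k} h = (\<Sum>i<k. integral {x i..x (Suc i)} h)" if "k \<le> n" for k
    using that
  proof (induction k)
    case (Suc k)
    have "integral {x 0..x k} h + integral {x k..x (Suc k)} h = integral {x 0..x (Suc k)} h"
      by (rule Henstock_Kurzweil_Integration.integral_combine)
        (use x[of 0 k] x[of k "Suc k"] x[of "Suc k" n] Suc in \<open>auto intro!: integrable_on_subinterval[OF h]\<close>)
    then show ?case using Suc by simp
  qed simp
  then show ?thesis by simp
qed

section \<open>Grids of equal mass and their limits\<close>

lemma quantile_mesh:
  assumes "0 < (d::real)"
  obtains N :: nat where "\<And>n i :: nat. N \<le> n \<Longrightarrow> i < n \<Longrightarrow> quantile (real (Suc i) / real n) - quantile (real i / real n) < d"
proof -
  have "uniformly_continuous_on {0..1} quantile"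
    using compact_uniformly_continuous[OF quantile_cont] by simp
  then obtain e where e: "e > 0" "\<And>u v. u \<in> {0..1} \<Longrightarrow> v \<in> {0..1} \<Longrightarrow> dist v u < e \<Longrightarrow> dist (quantile v) (quantile u) < d"
    unfolding uniformly_continuous_on_def using assms by metis
  obtain N where N: "0 < N" "1 / real N < e" using e(1) by (metis nat_approx_posE zero_less_Suc)
  show thesis
  proof (rule that)
    fix n i :: nat assume n: "N \<le> n" "i < n"
    have w: "real (Suc i) / real n - real i / real n = 1 / real n" by (simp add: diff_divide_distrib[symmetric])
    have "1 / real n \<le> 1 / real N" using n N by (simp add: frac_le)
    then have "dist (real (Suc i) / real n) (real i / real n) < e" using N w by (simp add: dist_real_def)
    then have "dist (quantile (real (Suc i) / real n)) (quantile (real i / real n)) < d" using n by (intro e(2)) auto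
    then show "quantile (real (Suc i) / real n) - quantile (real i / real n) < d" by (simp add: dist_real_def)
  qed
qed

lemma quantile_grid:
  fixes n :: nat
  assumes "0 < n"
  shows "\<And>i j :: nat. i \<le> j \<Longrightarrow> j \<le> n \<Longrightarrow> quantile (real i / real n) \<le> quantile (real j / real n)"
    and "quantile (real 0 / real n) = -1" and "quantile (real n / real n) = 1"
    and "\<And>i :: nat. i < n \<Longrightarrow> sc_cdf (quantile (real (Suc i) / real n)) - sc_cdf (quantile (real i / real n)) = 1 / n"
    and "\<And>i :: nat. i \<le> n \<Longrightarrow> -1 \<le> quantile (real i / real n) \<and> quantile (real i / real n) \<le> 1"
proof -
  show "sc_cdf (quantile (real (Suc i) / real n)) - sc_cdf (quantile (real i / real n)) = 1 / n" if "i < n" for i :: nat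
    using that assms by (subst (1 2) sc_cdf_quantile) (auto simp: field_simps)
  show "-1 \<le> quantile (real i / real n) \<and> quantile (real i / real n) \<le> 1" if "i \<le> n" for i :: nat
    using that assms by (intro quantile_range) auto
qed (use assms in \<open>auto simp: quantile_le_iff divide_right_mono\<close>)

lemma riemann_sums:
  assumes g: "continuous_on {-1..1} g"
  shows "(\<lambda>n::nat. (\<Sum>i<n. g (quantile (real i / real n))) / n) \<longlonglongrightarrow> integral {-1..1} (\<lambda>x. sc_dens x * g x)"
proof (rule LIMSEQ_I)
  fix e :: real assume e: "0 < e"
  let ?h = "\<lambda>x. sc_dens x * g x"
  have int: "continuous_on {a..b} ?h" if "-1 \<le> a" "b \<le> 1" for a b
    by (intro continuous_intros sc_dens_cont continuous_on_subset[OF g]) (use that in auto)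
  have "uniformly_continuous_on {-1..1} g" using compact_uniformly_continuous[OF g] by simp
  then obtain d where d: "d > 0" "\<And>u v. u \<in> {-1..1} \<Longrightarrow> v \<in> {-1..1} \<Longrightarrow> dist v u < d \<Longrightarrow> dist (g v) (g u) < e / 2"
    unfolding uniformly_continuous_on_def using e by (metis half_gt_zero)
  obtain N where N: "\<And>n i. N \<le> n \<Longrightarrow> i < n \<Longrightarrow> quantile (real (Suc i) / real n) - quantile (real i / real n) < d" using quantile_mesh[OF d(1)] by blast
  have "norm ((\<Sum>i<n. g (quantile (real i / real n))) / n - integral {-1..1} ?h) < e" if n: "Suc N \<le> n" for n :: nat
  proof -
    let ?x = "\<lambda>i. quantile (real i / real n)"
    have n0: "0 < n" using n by simp
    note gr = quantile_grid[OF n0]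
    have split: "integral {-1..1} ?h = (\<Sum>i<n. integral {?x i..?x (Suc i)} ?h)"
      using integral_cells[of n ?x ?h] gr integrable_continuous_real[OF int, of "-1" 1] by simp
    have "\<bar>g (?x i) / n - integral {?x i..?x (Suc i)} ?h\<bar> \<le> (e / 2) / n" if i: "i < n" for i :: nat
    proof -
      have c: "-1 \<le> ?x i" "?x i \<le> ?x (Suc i)" "?x (Suc i) \<le> 1"
        using gr(1)[of i "Suc i"] gr(5)[of i] gr(5)[of "Suc i"] i by auto
      have D: "(sc_dens has_integral 1 / n) {?x i..?x (Suc i)}"
        using sc_dens_has_integral[OF c] gr(4)[OF i] by simp
      have H: "(?h has_integral integral {?x i..?x (Suc i)} ?h) {?x i..?x (Suc i)}"
        by (intro integrable_integral integrable_continuous_real int c)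
      have b: "g (?x i) - e / 2 \<le> g y \<and> g y \<le> g (?x i) + e / 2" if y: "y \<in> {?x i..?x (Suc i)}" for y
      proof -
        have "dist y (?x i) < d" using N[of n i] n i y by (auto simp: dist_real_def)
        then have "dist (g y) (g (?x i)) < e / 2" using y c by (intro d(2)) auto
        then show ?thesis unfolding dist_real_def by linarith
      qed
      have "1 / n * (g (?x i) - e / 2) \<le> integral {?x i..?x (Suc i)} ?h"
        by (rule has_integral_le[OF has_integral_mult_left[OF D] H])
          (use b c in \<open>auto intro!: mult_left_mono sc_dens_nonneg\<close>)
      moreover have "integral {?x i..?x (Suc i)} ?h \<le> 1 / n * (g (?x i) + e / 2)"
        by (rule has_integral_le[OF H has_integral_mult_left[OF D]])
          (use b c in \<open>auto intro!: mult_left_mono sc_dens_nonneg\<close>)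
      ultimately have "\<bar>1 / n * g (?x i) - integral {?x i..?x (Suc i)} ?h\<bar> \<le> 1 / n * (e / 2)"
        unfolding right_diff_distrib distrib_left by linarith
      then show ?thesis by simp
    qed
    then have "\<bar>\<Sum>i<n. g (?x i) / n - integral {?x i..?x (Suc i)} ?h\<bar> \<le> (\<Sum>i<n. (e / 2) / n)"
      by (intro order_trans[OF sum_abs] sum_mono) auto
    also have "\<dots> < e" using n0 e by simp
    finally show ?thesis unfolding split by (simp add: sum_subtractf sum_divide_distrib)
  qed
  then show "\<exists>no::nat. \<forall>n\<ge>no. norm ((\<Sum>i<n. g (quantile (real i / real n))) / n - integral {-1..1} ?h) < e" by blast
qed

text \<open>\<open>cell_perim\<close> is continuous on a compact triangle and vanishes on its
  diagonal, so it is uniformly small on fine grids, while the cell widths add up to 2.\<close>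

lemma cell_perim_limit:
  "(\<lambda>n::nat. \<Sum>i<n. (quantile (real (Suc i) / real n) - quantile (real i / real n)) * cell_perim (\<lambda>i. quantile (real i / real n)) i) \<longlonglongrightarrow> 0"
proof (rule LIMSEQ_I)
  fix e :: real assume e: "0 < e"
  let ?T = "{p::real \<times> real. -1 \<le> fst p \<and> fst p \<le> snd p \<and> snd p \<le> 1}"
  let ?c = "\<lambda>p. edge_perim (fst p) + edge_perim (snd p) - 4 * mutual (fst p) (snd p)"
  have "continuous_on ?T ?c"
    by (intro continuous_intros mutual_cont continuous_on_compose2[OF edge_perim_cont[of UNIV]]) auto
  moreover have "compact ?T"
  proof -
    have "closed {p::real \<times> real. -1 \<le> fst p}" "closed {p::real \<times> real. fst p \<le> snd p}" "closed {p::real \<times> real. snd p \<le> 1}"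
      by (intro closed_Collect_le continuous_intros)+
    then have "closed (({-1..1} \<times> {-1..1}) \<inter> ({p::real \<times> real. -1 \<le> fst p} \<inter> {p. fst p \<le> snd p} \<inter> {p. snd p \<le> 1}))"
      by (intro closed_Int closed_Times) auto
    moreover have "?T = ({-1..1} \<times> {-1..1}) \<inter> ({p::real \<times> real. -1 \<le> fst p} \<inter> {p. fst p \<le> snd p} \<inter> {p. snd p \<le> 1})"
      by auto
    ultimately have "compact (({-1..1} \<times> {-1..1}) \<inter> ?T)"
      by (intro compact_Int_closed compact_Times) (auto simp: Int_assoc)
    moreover have "({-1..1} \<times> {-1..1}) \<inter> ?T = ?T" by auto
    ultimately show ?thesis by simp
  qed
  ultimately have "uniformly_continuous_on ?T ?c" by (rule compact_uniformly_continuous)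
  moreover have "0 < e / 4" using e by simp
  ultimately obtain d where d: "d > 0" "\<And>p q. p \<in> ?T \<Longrightarrow> q \<in> ?T \<Longrightarrow> dist q p < d \<Longrightarrow> dist (?c q) (?c p) < e / 4"
    unfolding uniformly_continuous_on_def by meson
  obtain N where N: "\<And>n i. N \<le> n \<Longrightarrow> i < n \<Longrightarrow> quantile (real (Suc i) / real n) - quantile (real i / real n) < d" using quantile_mesh[OF d(1)] by blast
  have "norm ((\<Sum>i<n. (quantile (real (Suc i) / real n) - quantile (real i / real n)) * cell_perim (\<lambda>i. quantile (real i / real n)) i) - 0) < e" if n: "Suc N \<le> n" for n :: nat
  proof -
    let ?x = "\<lambda>i. quantile (real i / real n)"
    have n0: "0 < n" using n by simp
    note gr = quantile_grid[OF n0]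
    have "\<bar>(?x (Suc i) - ?x i) * cell_perim ?x i\<bar> \<le> (?x (Suc i) - ?x i) * (e / 4)" if i: "i < n" for i :: nat
    proof -
      have c: "-1 \<le> ?x i" "?x i \<le> ?x (Suc i)" "?x (Suc i) \<le> 1"
        using gr(1)[of i "Suc i"] gr(5)[of i] gr(5)[of "Suc i"] i by auto
      have "dist (?c (?x i, ?x (Suc i))) (?c (?x i, ?x i)) < e / 4"
        by (rule d(2)) (use c N[of n i] n i in \<open>auto simp: dist_Pair_Pair dist_real_def\<close>)
      then have "\<bar>cell_perim ?x i\<bar> \<le> e / 4" by (simp add: cell_perim_def mutual_diag dist_real_def)
      then show ?thesis unfolding abs_mult using c by (intro mult_mono) auto
    qed
    then have "\<bar>\<Sum>i<n. (?x (Suc i) - ?x i) * cell_perim ?x i\<bar> \<le> (\<Sum>i<n. (?x (Suc i) - ?x i) * (e / 4))"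
      by (intro order_trans[OF sum_abs] sum_mono) auto
    also have "\<dots> = (?x n - ?x 0) * (e / 4)"
      unfolding sum_distrib_right[symmetric] by (subst sum_lessThan_telescope) simp
    also have "\<dots> < e" using gr(2,3) e by simp
    finally show ?thesis by simp
  qed
  then show "\<exists>no::nat. \<forall>n\<ge>no. norm ((\<Sum>i<n. (quantile (real (Suc i) / real n) - quantile (real i / real n)) * cell_perim (\<lambda>i. quantile (real i / real n)) i) - 0) < e" by blast
qed

section \<open>The double integral and its lower bound by cells\<close>

lemma semicircle_integral:
  fixes h :: "real \<Rightarrow> real"
  assumes [measurable]: "h \<in> borel_measurable borel"
  shows "(LINT x:{-1..1}|semicircle. h x) = (LINT x:{-1..1}|lborel. sc_dens x * h x)"
proof -
  have nn: "0 \<le> indicator {-1..1} x * sc_dens x" for x :: real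
    by (auto simp: indicator_def sc_dens_nonneg)
  have "(LINT x:{-1..1}|semicircle. h x) = (\<integral>x. (indicator {-1..1} x * sc_dens x) *\<^sub>R (indicator {-1..1} x *\<^sub>R h x) \<partial>lborel)"
    unfolding set_lebesgue_integral_def semicircle_sc_dens
    by (rule integral_density) (use nn in \<open>auto intro!: measurable_completion\<close>)
  also have "\<dots> = (LINT x:{-1..1}|lborel. sc_dens x * h x)"
    unfolding set_lebesgue_integral_def by (intro Bochner_Integration.integral_cong) (auto simp: indicator_def)
  finally show ?thesis .
qed

lemma bounded_set_integrable:
  fixes h :: "real \<Rightarrow> real"
  assumes [measurable]: "h \<in> borel_measurable borel" and "\<And>x. x \<in> {a..b} \<Longrightarrow> \<bar>h x\<bar> \<le> B"
  shows "set_integrable lborel {a..b} h"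
  unfolding set_integrable_def
  by (rule integrableI_bounded_set[where A = "{a..b}" and B = B])
    (use assms in \<open>auto simp: indicator_def emeasure_lborel_Icc_eq\<close>)

text \<open>For bounded Borel functions the integral against the semicircle law becomes a gauge
  integral, the setting in which the closed forms were obtained by the fundamental theorem.\<close>

lemma semicircle_integral_HK:
  fixes h :: "real \<Rightarrow> real"
  assumes m: "h \<in> borel_measurable borel" and b: "\<And>x. x \<in> {-1..1} \<Longrightarrow> \<bar>h x\<bar> \<le> B"
  shows "(LINT x:{-1..1}|semicircle. h x) = integral {-1..1} (\<lambda>x. sc_dens x * h x)"
    and "(\<lambda>x. sc_dens x * h x) integrable_on {-1..1}"
proof -
  have "\<bar>sc_dens x * h x\<bar> \<le> 1 * B" if "x \<in> {-1..1}" for x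
  proof -
    have "sc_dens x \<le> 1 * 1"
      unfolding sc_dens_def using pi_gt3 that by (intro mult_mono chord_le_1 chord_nonneg) auto
    then have "\<bar>sc_dens x\<bar> \<le> 1" using sc_dens_nonneg[of x] that by auto
    then show ?thesis unfolding abs_mult using b[OF that] by (intro mult_mono) auto
  qed
  then have s: "set_integrable lborel {-1..1} (\<lambda>x. sc_dens x * h x)"
    using m by (intro bounded_set_integrable) auto
  show "(LINT x:{-1..1}|semicircle. h x) = integral {-1..1} (\<lambda>x. sc_dens x * h x)"
    unfolding semicircle_integral[OF m] by (rule set_borel_integral_eq_integral(2)[OF s])
  show "(\<lambda>x. sc_dens x * h x) integrable_on {-1..1}"
    by (rule set_borel_integral_eq_integral(1)[OF s])
qed

text \<open>The inner integral \<open>k\<close> is left existential because its closed form depends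
  on the side of cell i on which cell j lies.\<close>

lemma cell_energy_has_integral:
  assumes n: "0 < n" and ij: "i < n" "j < n" "i \<noteq> j"
  defines "x \<equiv> \<lambda>i. quantile (real i / real n)"
  obtains k where "\<And>z. z \<in> {x i<..<x (Suc i)} \<Longrightarrow> ((\<lambda>y. sc_dens y / \<bar>z - y\<bar>) has_integral k z) {x j..x (Suc j)}"
    "((\<lambda>z. sc_dens z * k z) has_integral cell_energy x i j) {x i..x (Suc i)}"
proof -
  have gr: "\<And>i j. i \<le> j \<Longrightarrow> j \<le> n \<Longrightarrow> x i \<le> x j" "\<And>i. i \<le> n \<Longrightarrow> -1 \<le> x i \<and> x i \<le> 1"
    using quantile_grid[OF n] by (auto simp: x_def)
  show thesis
  proof (cases "i < j")
    case True
    have o: "-1 \<le> x i" "x i \<le> x (Suc i)" "x (Suc i) \<le> x j" "x j \<le> x (Suc j)" "x (Suc j) \<le> 1"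
      using gr(1)[of i "Suc i"] gr(1)[of "Suc i" j] gr(1)[of j "Suc j"] gr(2)[of i] gr(2)[of "Suc j"] True ij by auto
    show thesis
    proof (rule that)
      show "((\<lambda>y. sc_dens y / \<bar>z - y\<bar>) has_integral (cauchy z (x j) - cauchy z (x (Suc j)))) {x j..x (Suc j)}"
        if "z \<in> {x i<..<x (Suc i)}" for z
        by (rule cauchy_has_integral) (use that o in auto)
      show "((\<lambda>z. sc_dens z * (cauchy z (x j) - cauchy z (x (Suc j)))) has_integral cell_energy x i j) {x i..x (Suc i)}"
        unfolding cell_energy_less[OF True] by (rule mutual_has_integral[OF o])
    qed
  next
    case False
    then have ji: "j < i" using ij by simp
    have o: "-1 \<le> x j" "x j \<le> x (Suc j)" "x (Suc j) \<le> x i" "x i \<le> x (Suc i)" "x (Suc i) \<le> 1"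
      using gr(1)[of i "Suc i"] gr(1)[of "Suc j" i] gr(1)[of j "Suc j"] gr(2)[of j] gr(2)[of "Suc i"] ji ij by auto
    show thesis
    proof (rule that)
      show "((\<lambda>y. sc_dens y / \<bar>z - y\<bar>) has_integral (cauchy (- z) (- x (Suc j)) - cauchy (- z) (- x j))) {x j..x (Suc j)}"
        if "z \<in> {x i<..<x (Suc i)}" for z
        by (rule cauchy_has_integral_left) (use that o in auto)
      show "((\<lambda>z. sc_dens z * (cauchy (- z) (- x (Suc j)) - cauchy (- z) (- x j))) has_integral cell_energy x i j) {x i..x (Suc i)}"
        unfolding cell_energy_commute[of x i j] cell_energy_less[OF ji] by (rule mutual_has_integral_left[OF o])
    qed
  qed
qed

text \<open>For z in cell i and y in cell j the Lipschitz bound gives |F z - F y| >= |F (x i) - F (x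
  j)| - L (w i + w j), where w is the cell width. Integrating over pairs of distinct cells gives
  energies, and the error collects into row sums, that is, into cell perimeters.\<close>

lemma double_integral_ge_cells:
  fixes F :: "real \<Rightarrow> real"
  assumes n: "0 < n" and L: "\<And>x y. \<bar>F x - F y\<bar> \<le> L * \<bar>x - y\<bar>"
    and Fm: "F \<in> borel_measurable borel"
  defines "x \<equiv> \<lambda>i. quantile (real i / real n)"
  shows "(\<Sum>i<n. \<Sum>j<n. \<bar>F (x i) - F (x j)\<bar> * cell_energy x i j)
     - L * (\<Sum>i<n. (x (Suc i) - x i) * cell_perim x i)
     \<le> (LINT x:{-1..1}|semicircle. (LINT y:{-1..1}|semicircle. \<bar>(F x - F y) / (x - y)\<bar>))"
proof -
  note [measurable] = Fm
  have L0: "0 \<le> L" using L[of 0 1] by (simp add: order_trans[OF abs_ge_zero])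
  define g where "g z y = \<bar>(F z - F y) / (z - y)\<bar>" for z y
  \<comment> \<open>On the diagonal division by zero yields 0, so the bounds hold there as
    well.\<close>
  have gb: "0 \<le> g z y" "g z y \<le> L" for z y
    using L[of z y] L0 by (auto simp: g_def abs_divide divide_simps)
  have gm [measurable]: "(\<lambda>(z, y). g z y) \<in> borel_measurable (borel \<Otimes>\<^sub>M borel)"
    unfolding g_def by measurable
  have gm1 [measurable]: "g z \<in> borel_measurable borel" for z
    unfolding g_def by measurable
  define G where "G z = (LINT y:{-1..1}|semicircle. g z y)" for z
  have G: "G z = integral {-1..1} (\<lambda>y. sc_dens y * g z y)" and gi: "(\<lambda>y. sc_dens y * g z y) integrable_on {-1..1}" for z
    unfolding G_def using semicircle_integral_HK[of "g z" L] gb by auto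
  have Gm: "G \<in> borel_measurable borel"
  proof -
    have "G z = (\<integral>y. indicator {-1..1} y *\<^sub>R (sc_dens y * g z y) \<partial>lborel)" for z
      using semicircle_integral[OF gm1[of z]] unfolding G_def set_lebesgue_integral_def .
    then have "G = (\<lambda>z. \<integral>y. indicator {-1..1} y *\<^sub>R (sc_dens y * g z y) \<partial>lborel)" by (rule ext)
    also have "\<dots> \<in> borel_measurable borel"
      by (rule lborel.borel_measurable_lebesgue_integral) measurable
    finally show ?thesis .
  qed
  have one: "(sc_dens has_integral 1) {-1..1}" using sc_dens_has_integral[of "-1" 1] by simp
  have Gb: "\<bar>G z\<bar> \<le> L" for z
  proof -
    have "0 \<le> G z" unfolding G using gb sc_dens_nonneg by (intro integral_nonneg gi) auto
    moreover have "G z \<le> 1 * L"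
      unfolding G by (rule has_integral_le[OF integrable_integral[OF gi] has_integral_mult_left[OF one]])
        (use gb sc_dens_nonneg in \<open>auto intro!: mult_left_mono\<close>)
    ultimately show ?thesis by simp
  qed
  have R: "(LINT x:{-1..1}|semicircle. G x) = integral {-1..1} (\<lambda>z. sc_dens z * G z)"
    and Gi: "(\<lambda>z. sc_dens z * G z) integrable_on {-1..1}"
    using semicircle_integral_HK[OF Gm, of L] Gb by auto
  have gr: "\<And>i j. i \<le> j \<Longrightarrow> j \<le> n \<Longrightarrow> x i \<le> x j" "\<And>i. i \<le> n \<Longrightarrow> -1 \<le> x i \<and> x i \<le> 1"
    and x0: "x 0 = -1" and xn: "x n = 1"
    using quantile_grid[OF n] by (auto simp: x_def)
  define w where "w i = x (Suc i) - x i" for i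
  define D where "D i j = \<bar>F (x i) - F (x j)\<bar> - L * (w i + w j)" for i j
  have cell: "(\<Sum>j<n. D i j * cell_energy x i j) \<le> integral {x i..x (Suc i)} (\<lambda>z. sc_dens z * G z)" if i: "i < n" for i
  proof -
    have "\<exists>k. \<forall>j\<in>{..<n} - {i}. (\<forall>z\<in>{x i<..<x (Suc i)}. ((\<lambda>y. sc_dens y / \<bar>z - y\<bar>) has_integral k j z) {x j..x (Suc j)}) \<and>
        ((\<lambda>z. sc_dens z * k j z) has_integral cell_energy x i j) {x i..x (Suc i)}"
    proof (rule bchoice, rule ballI)
      fix j assume "j \<in> {..<n} - {i}"
      then have j: "j < n" "i \<noteq> j" by auto
      obtain k where "\<And>z. z \<in> {x i<..<x (Suc i)} \<Longrightarrow> ((\<lambda>y. sc_dens y / \<bar>z - y\<bar>) has_integral k z) {x j..x (Suc j)}"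
        "((\<lambda>z. sc_dens z * k z) has_integral cell_energy x i j) {x i..x (Suc i)}"
        using cell_energy_has_integral[OF n i j] unfolding x_def by blast
      then show "\<exists>k. (\<forall>z\<in>{x i<..<x (Suc i)}. ((\<lambda>y. sc_dens y / \<bar>z - y\<bar>) has_integral k z) {x j..x (Suc j)}) \<and>
        ((\<lambda>z. sc_dens z * k z) has_integral cell_energy x i j) {x i..x (Suc i)}" by (intro exI[of _ k] conjI ballI)
    qed
    then obtain k where k: "\<forall>j\<in>{..<n} - {i}. (\<forall>z\<in>{x i<..<x (Suc i)}. ((\<lambda>y. sc_dens y / \<bar>z - y\<bar>) has_integral k j z) {x j..x (Suc j)}) \<and>
        ((\<lambda>z. sc_dens z * k j z) has_integral cell_energy x i j) {x i..x (Suc i)}" ..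
    have k1: "((\<lambda>y. sc_dens y / \<bar>z - y\<bar>) has_integral k j z) {x j..x (Suc j)}"
      if "j \<in> {..<n} - {i}" "z \<in> {x i<..<x (Suc i)}" for j z
      using bspec[OF k that(1), THEN conjunct1, THEN bspec, OF that(2)] .
    have k2: "((\<lambda>z. sc_dens z * k j z) has_integral cell_energy x i j) {x i..x (Suc i)}" if "j \<in> {..<n} - {i}" for j
      using bspec[OF k that, THEN conjunct2] .
    have Gz: "(\<Sum>j\<in>{..<n} - {i}. D i j * k j z) \<le> G z" if z: "z \<in> {x i<..<x (Suc i)}" for z
    proof -
      have sub: "(\<lambda>y. sc_dens y * g z y) integrable_on {x j..x (Suc j)}" if "j < n" for j
        by (rule integrable_on_subinterval[OF gi]) (use gr(2)[of j] gr(2)[of "Suc j"] that in auto)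
      have "G z = (\<Sum>j<n. integral {x j..x (Suc j)} (\<lambda>y. sc_dens y * g z y))"
        unfolding G using integral_cells[of n x "\<lambda>y. sc_dens y * g z y"] gr(1) gi x0 xn by simp
      \<comment> \<open>The singular cell j = i is dropped: its integrand is nonnegative, and
        \<open>cell_energy\<close> is 0 there.\<close>
      also have "\<dots> \<ge> (\<Sum>j\<in>{..<n} - {i}. integral {x j..x (Suc j)} (\<lambda>y. sc_dens y * g z y))"
      proof (rule sum_mono2)
        fix j assume "j \<in> {..<n} - ({..<n} - {i})"
        then show "0 \<le> integral {x j..x (Suc j)} (\<lambda>y. sc_dens y * g z y)"
          using gb sc_dens_nonneg gr(2)[of j] gr(2)[of "Suc j"] i by (intro integral_nonneg sub) auto
      qed auto
      moreover have "D i j * k j z \<le> integral {x j..x (Suc j)} (\<lambda>y. sc_dens y * g z y)" if j: "j \<in> {..<n} - {i}" for j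
      proof (rule has_integral_le[OF has_integral_mult_right[OF k1[OF j z]] integrable_integral[OF sub]])
        show "j < n" using j by simp
        fix y assume y: "y \<in> {x j..x (Suc j)}"
        have "\<not> (x i < y \<and> y < x (Suc i))"
          using gr(1)[of "Suc i" j] gr(1)[of "Suc j" i] y j i by (cases "i < j") auto
        then have zy: "z \<noteq> y" using z by auto
        have "\<bar>F (x i) - F z\<bar> \<le> L * w i"
          using L[of "x i" z] z L0 by (elim order_trans) (auto simp: w_def intro!: mult_left_mono)
        moreover have "\<bar>F (x j) - F y\<bar> \<le> L * w j"
          using L[of "x j" y] y L0 by (elim order_trans) (auto simp: w_def intro!: mult_left_mono)
        ultimately have "D i j \<le> \<bar>F z - F y\<bar>" unfolding D_def distrib_left by linarith
        then have "D i j / \<bar>z - y\<bar> \<le> g z y" unfolding g_def abs_divide by (rule divide_right_mono) simp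
        moreover have "0 \<le> sc_dens y" using sc_dens_nonneg[of y] y gr(2)[of j] gr(2)[of "Suc j"] j by auto
        ultimately have "sc_dens y * (D i j / \<bar>z - y\<bar>) \<le> sc_dens y * g z y" by (rule mult_left_mono)
        then show "D i j * (sc_dens y / \<bar>z - y\<bar>) \<le> sc_dens y * g z y" by (simp add: mult.commute)
      qed
      then have "(\<Sum>j\<in>{..<n} - {i}. D i j * k j z) \<le> (\<Sum>j\<in>{..<n} - {i}. integral {x j..x (Suc j)} (\<lambda>y. sc_dens y * g z y))"
        by (rule sum_mono)
      ultimately show ?thesis by linarith
    qed
    have S: "((\<lambda>z. sc_dens z * (\<Sum>j\<in>{..<n} - {i}. D i j * k j z)) has_integral
        (\<Sum>j\<in>{..<n} - {i}. D i j * cell_energy x i j)) {x i..x (Suc i)}"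
    proof -
      have "((\<lambda>z. \<Sum>j\<in>{..<n} - {i}. D i j * (sc_dens z * k j z)) has_integral
        (\<Sum>j\<in>{..<n} - {i}. D i j * cell_energy x i j)) {x i..x (Suc i)}"
        by (intro has_integral_sum has_integral_mult_right k2) auto
      then show ?thesis by (simp add: sum_distrib_left mult.left_commute)
    qed
    \<comment> \<open>\<open>Gz\<close> is available only inside the cell, because the kernel may
      blow up at an end shared with a neighbour. The ends are null.\<close>
    have S': "((\<lambda>z. sc_dens z * (\<Sum>j\<in>{..<n} - {i}. D i j * k j z)) has_integral
        (\<Sum>j\<in>{..<n} - {i}. D i j * cell_energy x i j)) {x i<..<x (Suc i)}"
      using S has_integral_interior[of "{x i..x (Suc i)}"] by (simp add: has_integral_Icc_iff_Ioo)
    have Gc: "(\<lambda>z. sc_dens z * G z) integrable_on {x i..x (Suc i)}"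
      by (rule integrable_on_subinterval[OF Gi]) (use gr(2)[of i] gr(2)[of "Suc i"] i in auto)
    have G': "((\<lambda>z. sc_dens z * G z) has_integral integral {x i..x (Suc i)} (\<lambda>z. sc_dens z * G z)) {x i<..<x (Suc i)}"
      using integrable_integral[OF Gc] by (simp add: has_integral_Icc_iff_Ioo)
    have "(\<Sum>j\<in>{..<n} - {i}. D i j * cell_energy x i j) \<le> integral {x i..x (Suc i)} (\<lambda>z. sc_dens z * G z)"
      by (rule has_integral_le[OF S' G'])
        (use Gz sc_dens_nonneg gr(2)[of i] gr(2)[of "Suc i"] i in \<open>auto intro!: mult_left_mono\<close>)
    also have "(\<Sum>j\<in>{..<n} - {i}. D i j * cell_energy x i j) = (\<Sum>j<n. D i j * cell_energy x i j)"
      by (rule sum.mono_neutral_left) auto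
    finally show ?thesis .
  qed
  have rows: "2 * (\<Sum>j<n. cell_energy x i j) = cell_perim x i" if "i < n" for i
    using cell_energy_row_sum[of i n x] that x0 xn by simp
  \<comment> \<open>By symmetry of the energy both widths contribute equally, which supplies the
    factor 2 of \<open>cell_energy_row_sum\<close>.\<close>
  have "(\<Sum>i<n. \<Sum>j<n. (w i + w j) * cell_energy x i j)
     = (\<Sum>i<n. \<Sum>j<n. w i * cell_energy x i j) + (\<Sum>i<n. \<Sum>j<n. w j * cell_energy x i j)"
    by (simp add: distrib_right sum.distrib)
  also have "(\<Sum>i<n. \<Sum>j<n. w j * cell_energy x i j) = (\<Sum>j<n. \<Sum>i<n. w j * cell_energy x i j)"
    by (rule sum.swap)
  also have "\<dots> = (\<Sum>i<n. \<Sum>j<n. w i * cell_energy x i j)"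
    by (intro sum.cong refl arg_cong2[of _ _ _ _ "(*)"] cell_energy_commute)
  also have "(\<Sum>i<n. \<Sum>j<n. w i * cell_energy x i j) + (\<Sum>i<n. \<Sum>j<n. w i * cell_energy x i j)
     = (\<Sum>i<n. w i * (2 * (\<Sum>j<n. cell_energy x i j)))"
    by (simp add: sum_distrib_left[symmetric] sum_distrib_right[symmetric] sum.distrib[symmetric] mult.assoc mult.left_commute)
  also have "\<dots> = (\<Sum>i<n. w i * cell_perim x i)" by (intro sum.cong refl) (simp only: rows lessThan_iff)
  finally have W: "(\<Sum>i<n. \<Sum>j<n. (w i + w j) * cell_energy x i j) = (\<Sum>i<n. w i * cell_perim x i)" .
  have "(\<Sum>i<n. \<Sum>j<n. D i j * cell_energy x i j) = (\<Sum>i<n. \<Sum>j<n. \<bar>F (x i) - F (x j)\<bar> * cell_energy x i j)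
      - L * (\<Sum>i<n. \<Sum>j<n. (w i + w j) * cell_energy x i j)"
    by (simp only: D_def left_diff_distrib sum_subtractf sum_distrib_left mult.assoc)
  also have "\<dots> = (\<Sum>i<n. \<Sum>j<n. \<bar>F (x i) - F (x j)\<bar> * cell_energy x i j) - L * (\<Sum>i<n. w i * cell_perim x i)"
    unfolding W ..
  finally have "(\<Sum>i<n. \<Sum>j<n. \<bar>F (x i) - F (x j)\<bar> * cell_energy x i j) - L * (\<Sum>i<n. w i * cell_perim x i)
      = (\<Sum>i<n. \<Sum>j<n. D i j * cell_energy x i j)" by simp
  also have "\<dots> \<le> (\<Sum>i<n. integral {x i..x (Suc i)} (\<lambda>z. sc_dens z * G z))" by (intro sum_mono cell) auto
  also have "\<dots> = integral {-1..1} (\<lambda>z. sc_dens z * G z)"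
    using integral_cells[of n x "\<lambda>z. sc_dens z * G z"] gr(1) Gi x0 xn by simp
  also have "\<dots> = (LINT x:{-1..1}|semicircle. G x)" by (rule R[symmetric])
  finally show ?thesis unfolding G_def g_def w_def .
qed

lemma lipschitz_inequality:
  fixes F :: "real \<Rightarrow> real"
  assumes L: "\<And>x y. \<bar>F x - F y\<bar> \<le> L * \<bar>x - y\<bar>" and F: "\<And>x. 0 \<le> F x \<and> F x \<le> 1"
  shows "free_profile (LINT x:{-1..1}|semicircle. F x) - (LINT x:{-1..1}|semicircle. free_profile (F x))
    \<le> (LINT x:{-1..1}|semicircle. (LINT y:{-1..1}|semicircle. \<bar>(F x - F y) / (x - y)\<bar>))" (is "_ \<le> ?R")
proof -
  have c: "continuous_on UNIV F"
  proof (rule lipschitz_on_continuous_on)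
    show "L-lipschitz_on UNIV F"
      using L L[of 0 1] by (intro lipschitz_onI) (auto simp: dist_real_def order_trans[OF abs_ge_zero])
  qed
  have pc: "continuous_on {0..1} free_profile"
    using continuous_on_compose2[OF edge_perim_cont[of UNIV] quantile_cont] by (subst continuous_on_cong[OF refl free_profile_eq]) auto
  have cF: "continuous_on UNIV (\<lambda>x. free_profile (F x))"
    by (rule continuous_on_compose2[OF pc c]) (use F in auto)
  have m: "F \<in> borel_measurable borel" "(\<lambda>x. free_profile (F x)) \<in> borel_measurable borel"
    by (intro borel_measurable_continuous_onI c cF)+
  have pb: "\<bar>free_profile (F x)\<bar> \<le> 1" for x
  proof -
    have "-1 \<le> quantile (F x)" "quantile (F x) \<le> 1" using quantile_range F by auto
    then have "0 \<le> chord (quantile (F x)) ^ 3" "chord (quantile (F x)) ^ 3 \<le> 1" using chord_nonneg chord_le_1 by (auto intro: power_le_one)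
    moreover have "8 / (3 * pi) \<le> 1" using pi_gt3 by simp
    ultimately have "0 \<le> edge_perim (quantile (F x))" "edge_perim (quantile (F x)) \<le> 1 * 1" unfolding edge_perim_def by (auto intro!: mult_mono)
    then show ?thesis using free_profile_eq F by simp
  qed
  have I1: "(LINT x:{-1..1}|semicircle. F x) = integral {-1..1} (\<lambda>x. sc_dens x * F x)"
    by (rule semicircle_integral_HK(1)[OF m(1), of 1]) (use F in auto)
  have I2: "(LINT x:{-1..1}|semicircle. free_profile (F x)) = integral {-1..1} (\<lambda>x. sc_dens x * free_profile (F x))"
    by (rule semicircle_integral_HK(1)[OF m(2), of 1]) (use pb in auto)
  let ?a = "\<lambda>n::nat. (\<Sum>i<n. F (quantile (real i / real n))) / n"
  let ?b = "\<lambda>n::nat. (\<Sum>i<n. free_profile (F (quantile (real i / real n)))) / n"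
  let ?e = "\<lambda>n::nat. \<Sum>i<n. (quantile (real (Suc i) / real n) - quantile (real i / real n)) * cell_perim (\<lambda>i. quantile (real i / real n)) i"
  have a: "?a \<longlonglongrightarrow> (LINT x:{-1..1}|semicircle. F x)"
    unfolding I1 by (rule riemann_sums) (rule continuous_on_subset[OF c], simp)
  have b: "?b \<longlonglongrightarrow> (LINT x:{-1..1}|semicircle. free_profile (F x))"
    unfolding I2 by (rule riemann_sums) (rule continuous_on_subset[OF cF], simp)
  have ar: "?a n \<in> {0..1}" for n
  proof -
    have "(\<Sum>i<n. F (quantile (real i / real n))) \<le> (\<Sum>i<n. 1)" by (intro sum_mono) (use F in auto)
    moreover have "0 \<le> (\<Sum>i<n. F (quantile (real i / real n)))" by (intro sum_nonneg) (use F in auto)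
    ultimately show ?thesis by (cases "n = 0") (auto simp: divide_simps)
  qed
  \<comment> \<open>Continuity of J is known only on [0, 1], so the limit of the means must be
    placed there.\<close>
  have "(LINT x:{-1..1}|semicircle. F x) \<in> {0..1}"
    by (rule closed_sequentially[OF _ _ a]) (use ar in auto)
  then have pa: "(\<lambda>n. free_profile (?a n)) \<longlonglongrightarrow> free_profile (LINT x:{-1..1}|semicircle. F x)"
    by (rule continuous_on_tendsto_compose[OF pc a]) (use ar in auto)
  have "(\<lambda>n. ?b n + (?R + L * ?e n)) \<longlonglongrightarrow> (LINT x:{-1..1}|semicircle. free_profile (F x)) + (?R + L * 0)"
    by (intro tendsto_intros b cell_perim_limit)
  moreover have "free_profile (?a n) \<le> ?b n + (?R + L * ?e n)" if n: "1 \<le> n" for n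
    using discrete_inequality[of n "\<lambda>i. F (quantile (real i / real n))"] double_integral_ge_cells[of n F L] L m(1) F n by simp
  ultimately have "free_profile (LINT x:{-1..1}|semicircle. F x) \<le> (LINT x:{-1..1}|semicircle. free_profile (F x)) + (?R + L * 0)"
    by (intro LIMSEQ_le[OF pa]) auto
  then show ?thesis by simp
qed

theorem theorem1:
  fixes f f' :: "real \<Rightarrow> real"
  assumes "\<And>x. x \<in> {-1..1} \<Longrightarrow> (f has_real_derivative f' x) (at x within {-1..1})"
    and "continuous_on {-1..1} f'"
    and "\<And>x. x \<in> {-1..1} \<Longrightarrow> 0 \<le> f x \<and> f x \<le> 1"
  shows "free_profile (LINT x:{-1..1}|semicircle. f x)
           - (LINT x:{-1..1}|semicircle. free_profile (f x))
         \<le> (LINT x:{-1..1}|semicircle. (LINT y:{-1..1}|semicircle.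
               \<bar>(f x - f y) / (x - y)\<bar>))"
proof -
  have "bounded (f' ` {-1..1})"
    by (rule compact_imp_bounded[OF compact_continuous_image[OF assms(2)]]) simp
  then obtain L where "\<forall>y\<in>f' ` {-1..1}. norm y \<le> L" unfolding bounded_iff ..
  then have L: "norm (f' x) \<le> L" if "x \<in> {-1..1}" for x using that by blast
  \<comment> \<open>Nothing is known about \<open>f\<close> outside \<open>[-1, 1]\<close>, not even measurability.\<close>
  define c :: "real \<Rightarrow> real" where "c x = max (-1) (min 1 x)" for x
  have c: "c x \<in> {-1..1}" "\<bar>c x - c y\<bar> \<le> \<bar>x - y\<bar>" for x y by (auto simp: c_def)
  have id: "c x = x" if "x \<in> {-1..1}" for x using that by (auto simp: c_def)
  have lip: "\<bar>f (c x) - f (c y)\<bar> \<le> L * \<bar>x - y\<bar>" for x y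
  proof -
    have "norm (f (c x) - f (c y)) \<le> L * norm (c x - c y)"
      by (rule field_differentiable_bound[of "{-1..1}" f f']) (use assms(1) L c in auto)
    also have "\<dots> \<le> L * \<bar>x - y\<bar>"
      using c(2)[of x y] L[of 0] by (intro mult_left_mono) (auto intro: order_trans[OF norm_ge_zero])
    finally show ?thesis by simp
  qed
  have main: "free_profile (LINT x:{-1..1}|semicircle. f (c x)) - (LINT x:{-1..1}|semicircle. free_profile (f (c x)))
    \<le> (LINT x:{-1..1}|semicircle. (LINT y:{-1..1}|semicircle. \<bar>(f (c x) - f (c y)) / (x - y)\<bar>))"
    by (rule lipschitz_inequality[OF lip]) (use assms(3) c in auto)
  have cong: "(LINT x:{-1..1}|semicircle. h1 x) = (LINT x:{-1..1}|semicircle. h2 x)"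
    if "\<And>x. x \<in> {-1..1} \<Longrightarrow> h1 x = h2 x" for h1 h2 :: "real \<Rightarrow> real"
    using that unfolding set_lebesgue_integral_def
    by (intro Bochner_Integration.integral_cong) (auto simp: indicator_def)
  have "(LINT x:{-1..1}|semicircle. f (c x)) = (LINT x:{-1..1}|semicircle. f x)"
    "(LINT x:{-1..1}|semicircle. free_profile (f (c x))) = (LINT x:{-1..1}|semicircle. free_profile (f x))"
    "(LINT x:{-1..1}|semicircle. (LINT y:{-1..1}|semicircle. \<bar>(f (c x) - f (c y)) / (x - y)\<bar>))
     = (LINT x:{-1..1}|semicircle. (LINT y:{-1..1}|semicircle. \<bar>(f x - f y) / (x - y)\<bar>))"
    by (intro cong; simp add: id)+
  then show ?thesis using main by (simp only:)
qed

end
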